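(* Let $\hat\omega,\hat\xi\in\mathbb{R}^d$ and let $\tilde\omega,\tilde\xi\in H^1(0,T;\mathbb{R}^d)$ satisfy $\tilde\omega(0)=\hat\omega$, $\tilde\xi(0)=\hat\xi$. For $\tau\in(0,T)$ identify $\Omega=(\hat\omega,\tilde\omega)$ and $\Xi=(\hat\xi,\tilde\xi)$ with the elements $(\hat\omega,\tilde\omega|_{(0,\tau)})$ and $(\hat\xi,\tilde\xi|_{(0,\tau)})$ of $\mathrm{Dom}\,\mathcal{A}_\tau\subset M^2_\tau$. Then for $\tau\in(0,T)$ the Riccati operator $\mathcal{P}(\tau)$ satisfies $$\frac{d}{d\tau}\langle\Omega,\mathcal{P}(\tau)\Xi\rangle+\langle\mathcal{A}_\tau\Omega,\mathcal{P}(\tau)\Xi\rangle+\langle\mathcal{P}(\tau)\Omega,\mathcal{A}_\tau\Xi\rangle-\langle\mathcal{B}_\tau^*\mathcal{P}(\tau)\Omega,\mathcal{B}_\tau^*\mathcal{P}(\tau)\Xi\rangle+\langle\mathcal{C}_\tau\Omega,\mathcal{C}_\tau\Xi\rangle=0,$$ and $\mathcal{P}(T)=0$.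
   Context: Fix $T>0$, constant real matrices $A\in\mathbb{R}^{d\times d}$, $B\in\mathbb{R}^{d\times m}$, $C\in\mathbb{R}^{p\times d}$, and a continuous function $N:[0,T]\to\mathbb{R}^{d\times d}$. A star denotes transpose/adjoint. For $\tau\in(0,T]$ let $M^2_\tau=\mathbb{R}^d\times L^2(0,\tau;\mathbb{R}^d)$ with its natural inner product. Definition of $P_0,P_1,P_2$. For $\tau\in(0,T)$, $(\hat\xi,\tilde\xi)\in M^2_\tau$ and $u\in L^2(\tau,T;\mathbb{R}^m)$ let $w$ solve on $[\tau,T]$ $$w'(t)=Aw(t)+\int_\tau^tN(t-s)w(s)\,ds+Bu(t)+\int_0^\tau N(t-s)\tilde\xi(s)\,ds,\qquad w(\tau)=\hat\xi,$$ and let $W^0_\tau(\hat\xi,\tilde\xi)=\min_{u}\int_\tau^T\big[\|Cw(t)\|^2+\|u(t)\|^2\big]\,dt$ (zero reference signal). The $d\times d$ matrix functions $P_0(\tau)$ on $[0,T]$, $P_1(s,\tau)$ on $0\le s\le\tau\le T$, $P_2(s,\nu,\tau)$ on $0\le s,\nu\le\tau\le T$ are the continuous functions with $P_0(\tau)=P_0^*(\tau)$, $P_2(s,\nu,\tau)=P_2^*(\nu,s,\tau)$ such that $$W^0_\tau(\hat\xi,\tilde\xi)=\langle\hat\xi,P_0(\tau)\hat\xi\rangle+2\Big\langle\hat\xi,\int_0^\tau P_1(s,\tau)\tilde\xi(s)\,ds\Big\rangle+\int_0^\tau\!\!\int_0^\tau\langle\tilde\xi(s),P_2(s,\nu,\tau)\tilde\xi(\nu)\rangle\,d\nu\,ds$$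 for every $\tau\in(0,T)$ and $(\hat\xi,\tilde\xi)\in M^2_\tau$. Operators. For $\tau\in(0,T]$ put $\mathcal{P}_1(\tau):L^2(0,\tau;\mathbb{R}^d)\to\mathbb{R}^d$, $\mathcal{P}_1(\tau)\tilde\xi=\int_0^\tau P_1(\tau-s,\tau)\tilde\xi(s)\,ds$, and $\mathcal{P}_2(\tau):L^2(0,\tau;\mathbb{R}^d)\to L^2(0,\tau;\mathbb{R}^d)$, $(\mathcal{P}_2(\tau)\tilde\xi)(s)=\int_0^\tau P_2(\tau-s,\tau-\nu,\tau)\tilde\xi(\nu)\,d\nu$. The Riccati operator on $M^2_\tau$ is $$\mathcal{P}(\tau)=\begin{bmatrix}P_0(\tau)&\mathcal{P}_1(\tau)\\ \mathcal{P}_1^*(\tau)&\mathcal{P}_2(\tau)\end{bmatrix}.$$ The state operator $\mathcal{A}_\tau$ on $M^2_\tau$ has domain $\mathrm{Dom}\,\mathcal{A}_\tau=\{(\hat\xi,\tilde\xi)\in M^2_\tau:\ \tilde\xi\in H^1(0,\tau;\mathbb{R}^d),\ \tilde\xi(0)=\hat\xi\}$ and $$\mathcal{A}_\tau(\hat\xi,\tilde\xi)=\Big(A\hat\xi+\int_0^\tau N(s)\tilde\xi(s)\,ds,\ -\tilde\xi'\Big).$$ The input operator $\mathcal{B}_\tau:\mathbb{R}^m\to M^2_\tau$ is $\mathcal{B}_\tau u=(Bu,0)$ and the output operator $\mathcal{C}_\tau:M^2_\tau\to\mathbb{R}^p$ is $\mathcal{C}_\tau(\hat\xi,\tilde\xi)=C\hat\xi$.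 (In this representation the second component of the state at time $t$ is $\tilde\xi(s)=w(t-s)$, $0<s<t$.) *)

theory Defs
  imports "HOL-Analysis.Analysis"
begin

text \<open>
  Elements of \<open>L\<^sup>2(a,b)\<close> are represented by functions on the reals of which only the values on
  \<open>[a,b]\<close> matter; two representatives describe the same element iff they agree almost everywhere
  on \<open>[a,b]\<close>.
\<close>

definition L2 :: "real \<Rightarrow> real \<Rightarrow> (real \<Rightarrow> 'a::euclidean_space) set" where
  "L2 a b = {f. f \<in> borel_measurable (lebesgue_on {a..b}) \<and>
                integrable (lebesgue_on {a..b}) (\<lambda>t. (norm (f t))\<^sup>2)}"

definition L2_inner :: "real \<Rightarrow> real \<Rightarrow> (real \<Rightarrow> 'a::euclidean_space) \<Rightarrow> (real \<Rightarrow> 'a) \<Rightarrow> real" where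
  "L2_inner a b f g = integral {a..b} (\<lambda>t. f t \<bullet> g t)"

text \<open>
  \<open>H\<^sup>1(a,b)\<close> in dimension one: the absolutely continuous functions on \<open>[a,b]\<close> with derivative in
  \<open>L\<^sup>2\<close>. A function in \<open>H1\<close> is thus the continuous representative of its class, so that its value at
  an end point is the trace there. The derivative is unique up to a null set.
\<close>

definition is_H1_deriv ::
  "real \<Rightarrow> real \<Rightarrow> (real \<Rightarrow> 'a::euclidean_space) \<Rightarrow> (real \<Rightarrow> 'a) \<Rightarrow> bool" where
  "is_H1_deriv a b f g \<longleftrightarrow> g \<in> L2 a b \<and> (\<forall>t\<in>{a..b}. f t = f a + integral {a..t} g)"

definition H1 :: "real \<Rightarrow> real \<Rightarrow> (real \<Rightarrow> 'a::euclidean_space) set" where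
  "H1 a b = {f \<in> L2 a b. \<exists>g. is_H1_deriv a b f g}"

definition H1_deriv :: "real \<Rightarrow> real \<Rightarrow> (real \<Rightarrow> 'a::euclidean_space) \<Rightarrow> real \<Rightarrow> 'a" where
  "H1_deriv a b f = (SOME g. is_H1_deriv a b f g)"

definition M2 :: "real \<Rightarrow> ('a::euclidean_space \<times> (real \<Rightarrow> 'a)) set" where
  "M2 \<tau> = UNIV \<times> L2 0 \<tau>"

definition M2_inner ::
  "real \<Rightarrow> 'a::euclidean_space \<times> (real \<Rightarrow> 'a) \<Rightarrow> 'a \<times> (real \<Rightarrow> 'a) \<Rightarrow> real" where
  "M2_inner \<tau> X Y = fst X \<bullet> fst Y + L2_inner 0 \<tau> (snd X) (snd Y)"

text \<open>
  The adjoint of \<open>F : X \<rightarrow> Y\<close>, for inner product spaces given by a carrier and a form, in the style of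
  \<^const>\<open>adjoint\<close>. In spaces of representatives it is determined up to equality almost everywhere.
\<close>

definition adjoint_on ::
  "'a set \<Rightarrow> ('a \<Rightarrow> 'a \<Rightarrow> real) \<Rightarrow> 'b set \<Rightarrow> ('b \<Rightarrow> 'b \<Rightarrow> real) \<Rightarrow> ('a \<Rightarrow> 'b) \<Rightarrow> 'b \<Rightarrow> 'a" where
  "adjoint_on X ipX Y ipY F =
     (SOME G. (\<forall>y\<in>Y. G y \<in> X) \<and> (\<forall>x\<in>X. \<forall>y\<in>Y. ipY (F x) y = ipX x (G y)))"


text \<open>
  Solutions of the controlled Volterra equation are understood in the Caratheodory sense: \<open>w\<close> is
  continuous and satisfies the integrated equation (the control is only in \<open>L\<^sup>2\<close>).
\<close>

definition trajectory ::
  "real \<Rightarrow> real^'d^'d \<Rightarrow> real^'m^'d \<Rightarrow> (real \<Rightarrow> real^'d^'d) \<Rightarrow> real \<Rightarrow>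
   (real^'d) \<times> (real \<Rightarrow> real^'d) \<Rightarrow> (real \<Rightarrow> real^'m) \<Rightarrow> (real \<Rightarrow> real^'d) \<Rightarrow> bool" where
  "trajectory T A B N \<tau> \<Xi> u w \<longleftrightarrow>
     continuous_on {\<tau>..T} w \<and>
     (\<forall>t\<in>{\<tau>..T}. w t = fst \<Xi> + integral {\<tau>..t} (\<lambda>r.
        A *v w r + integral {\<tau>..r} (\<lambda>s. N (r - s) *v w s) + B *v u r
        + integral {0..\<tau>} (\<lambda>s. N (r - s) *v snd \<Xi> s)))"

definition cost ::
  "real \<Rightarrow> real^'d^'p \<Rightarrow> real \<Rightarrow> (real \<Rightarrow> real^'m) \<Rightarrow> (real \<Rightarrow> real^'d) \<Rightarrow> real" where
  "cost T C \<tau> u w = integral {\<tau>..T} (\<lambda>t. (norm (C *v w t))\<^sup>2 + (norm (u t))\<^sup>2)"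

definition is_min_cost ::
  "real \<Rightarrow> real^'d^'d \<Rightarrow> real^'m^'d \<Rightarrow> real^'d^'p \<Rightarrow> (real \<Rightarrow> real^'d^'d) \<Rightarrow> real \<Rightarrow>
   (real^'d) \<times> (real \<Rightarrow> real^'d) \<Rightarrow> real \<Rightarrow> bool" where
  "is_min_cost T A B C N \<tau> \<Xi> W \<longleftrightarrow>
     (\<exists>u w. u \<in> L2 \<tau> T \<and> trajectory T A B N \<tau> \<Xi> u w \<and> cost T C \<tau> u w = W) \<and>
     (\<forall>u w. u \<in> L2 \<tau> T \<and> trajectory T A B N \<tau> \<Xi> u w \<longrightarrow> W \<le> cost T C \<tau> u w)"

definition kernel_form ::
  "(real \<Rightarrow> real^'d^'d) \<Rightarrow> (real \<Rightarrow> real \<Rightarrow> real^'d^'d) \<Rightarrow> (real \<Rightarrow> real \<Rightarrow> real \<Rightarrow> real^'d^'d) \<Rightarrow>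
   real \<Rightarrow> (real^'d) \<times> (real \<Rightarrow> real^'d) \<Rightarrow> real" where
  "kernel_form P0 P1 P2 \<tau> \<Xi> =
     fst \<Xi> \<bullet> (P0 \<tau> *v fst \<Xi>)
     + 2 * (fst \<Xi> \<bullet> integral {0..\<tau>} (\<lambda>s. P1 s \<tau> *v snd \<Xi> s))
     + integral {0..\<tau>} (\<lambda>s. integral {0..\<tau>} (\<lambda>\<nu>. snd \<Xi> s \<bullet> (P2 s \<nu> \<tau> *v snd \<Xi> \<nu>)))"

text \<open>
  The kernels are uniquely determined on their domains. In \<open>kernel_form\<close> the history component is
  in natural time, \<open>s \<mapsto> w(s)\<close>, whereas the Riccati operator below acts on reversed histories
  \<open>s \<mapsto> w(\<tau> - s)\<close>.
\<close>

definition riccati_kernels ::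
  "real \<Rightarrow> real^'d^'d \<Rightarrow> real^'m^'d \<Rightarrow> real^'d^'p \<Rightarrow> (real \<Rightarrow> real^'d^'d) \<Rightarrow>
   (real \<Rightarrow> real^'d^'d) \<Rightarrow> (real \<Rightarrow> real \<Rightarrow> real^'d^'d) \<Rightarrow> (real \<Rightarrow> real \<Rightarrow> real \<Rightarrow> real^'d^'d) \<Rightarrow> bool" where
  "riccati_kernels T A B C N P0 P1 P2 \<longleftrightarrow>
     continuous_on {0..T} P0 \<and>
     continuous_on {(s, \<tau>). 0 \<le> s \<and> s \<le> \<tau> \<and> \<tau> \<le> T} (\<lambda>(s, \<tau>). P1 s \<tau>) \<and>
     continuous_on {(s, \<nu>, \<tau>). 0 \<le> s \<and> s \<le> \<tau> \<and> 0 \<le> \<nu> \<and> \<nu> \<le> \<tau> \<and> \<tau> \<le> T}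
       (\<lambda>(s, \<nu>, \<tau>). P2 s \<nu> \<tau>) \<and>
     (\<forall>\<tau>\<in>{0..T}. P0 \<tau> = transpose (P0 \<tau>)) \<and>
     (\<forall>\<tau>\<in>{0..T}. \<forall>s\<in>{0..\<tau>}. \<forall>\<nu>\<in>{0..\<tau>}. P2 s \<nu> \<tau> = transpose (P2 \<nu> s \<tau>)) \<and>
     (\<forall>\<tau>\<in>{0<..<T}. \<forall>\<Xi>\<in>M2 \<tau>. is_min_cost T A B C N \<tau> \<Xi> (kernel_form P0 P1 P2 \<tau> \<Xi>))"


definition P1_op ::
  "(real \<Rightarrow> real \<Rightarrow> real^'d^'d) \<Rightarrow> real \<Rightarrow> (real \<Rightarrow> real^'d) \<Rightarrow> real^'d" where
  "P1_op P1 \<tau> f = integral {0..\<tau>} (\<lambda>s. P1 (\<tau> - s) \<tau> *v f s)"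

definition P1_op_adj ::
  "(real \<Rightarrow> real \<Rightarrow> real^'d^'d) \<Rightarrow> real \<Rightarrow> real^'d \<Rightarrow> real \<Rightarrow> real^'d" where
  "P1_op_adj P1 \<tau> = adjoint_on (L2 0 \<tau>) (L2_inner 0 \<tau>) UNIV (\<bullet>) (P1_op P1 \<tau>)"

definition P2_op ::
  "(real \<Rightarrow> real \<Rightarrow> real \<Rightarrow> real^'d^'d) \<Rightarrow> real \<Rightarrow> (real \<Rightarrow> real^'d) \<Rightarrow> real \<Rightarrow> real^'d" where
  "P2_op P2 \<tau> f = (\<lambda>s. integral {0..\<tau>} (\<lambda>\<nu>. P2 (\<tau> - s) (\<tau> - \<nu>) \<tau> *v f \<nu>))"

definition riccati_op ::
  "(real \<Rightarrow> real^'d^'d) \<Rightarrow> (real \<Rightarrow> real \<Rightarrow> real^'d^'d) \<Rightarrow> (real \<Rightarrow> real \<Rightarrow> real \<Rightarrow> real^'d^'d) \<Rightarrow>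
   real \<Rightarrow> (real^'d) \<times> (real \<Rightarrow> real^'d) \<Rightarrow> (real^'d) \<times> (real \<Rightarrow> real^'d)" where
  "riccati_op P0 P1 P2 \<tau> \<Xi> =
     (P0 \<tau> *v fst \<Xi> + P1_op P1 \<tau> (snd \<Xi>),
      \<lambda>s. P1_op_adj P1 \<tau> (fst \<Xi>) s + P2_op P2 \<tau> (snd \<Xi>) s)"

definition state_dom :: "real \<Rightarrow> ((real^'d) \<times> (real \<Rightarrow> real^'d)) set" where
  "state_dom \<tau> = {\<Xi> \<in> M2 \<tau>. snd \<Xi> \<in> H1 0 \<tau> \<and> snd \<Xi> 0 = fst \<Xi>}"

definition state_op ::
  "real^'d^'d \<Rightarrow> (real \<Rightarrow> real^'d^'d) \<Rightarrow> real \<Rightarrow>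
   (real^'d) \<times> (real \<Rightarrow> real^'d) \<Rightarrow> (real^'d) \<times> (real \<Rightarrow> real^'d)" where
  "state_op A N \<tau> \<Xi> =
     (A *v fst \<Xi> + integral {0..\<tau>} (\<lambda>s. N s *v snd \<Xi> s), \<lambda>s. - H1_deriv 0 \<tau> (snd \<Xi>) s)"

definition input_op :: "real^'m^'d \<Rightarrow> real^'m \<Rightarrow> (real^'d) \<times> (real \<Rightarrow> real^'d)" where
  "input_op B u = (B *v u, \<lambda>_. 0)"

definition input_op_adj ::
  "real^'m^'d \<Rightarrow> real \<Rightarrow> (real^'d) \<times> (real \<Rightarrow> real^'d) \<Rightarrow> real^'m" where
  "input_op_adj B \<tau> = adjoint_on UNIV (\<bullet>) (M2 \<tau>) (M2_inner \<tau>) (input_op B)"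

definition output_op :: "real^'d^'p \<Rightarrow> (real^'d) \<times> (real \<Rightarrow> real^'d) \<Rightarrow> real^'p" where
  "output_op C \<Xi> = C *v fst \<Xi>"


text \<open>
  Since only values on \<open>[0,\<tau>]\<close> matter in \<^term>\<open>M2 \<tau>\<close>, restricting a history from \<open>(0,T)\<close> to
  \<open>(0,\<tau>)\<close> does not change its representative; the restriction lies in the domain of the state
  operator.
\<close>

lemma L2_subinterval:
  assumes "f \<in> L2 a b" "b' \<le> b"
  shows "f \<in> L2 a b'"
proof -
  have sub: "{a..b'} \<subseteq> {a..b}" using assms by auto
  have m: "f \<in> borel_measurable (lebesgue_on {a..b})"
    and i: "integrable (lebesgue_on {a..b}) (\<lambda>t. (norm (f t))\<^sup>2)"
    using assms by (simp_all add: L2_def)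
  show ?thesis
    using measurable_restrict_mono[OF m sub]
      Equivalence_Lebesgue_Henstock_Integration.integrable_subinterval[OF i sub]
    by (simp add: L2_def)
qed

lemma state_dom_restrict:
  fixes f :: "real \<Rightarrow> real^'d"
  assumes "f \<in> H1 0 T" "f 0 = x" "\<tau> \<le> T"
  shows "(x, f) \<in> state_dom \<tau>"
proof -
  obtain g where g: "is_H1_deriv 0 T f g" and f: "f \<in> L2 0 T"
    using assms(1) by (auto simp: H1_def)
  have "\<forall>t\<in>{0..T}. f t = f 0 + integral {0..t} g" and g2: "g \<in> L2 0 T"
    using g unfolding is_H1_deriv_def by - (erule conjunct2, erule conjunct1)
  moreover have "{0..\<tau>} \<subseteq> {0..T}" using assms(3) by auto
  ultimately have "\<forall>t\<in>{0..\<tau>}. f t = f 0 + integral {0..t} g" by (meson subsetD)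
  then have "is_H1_deriv 0 \<tau> f g"
    unfolding is_H1_deriv_def using L2_subinterval[OF g2 assms(3)] by (rule conjI[rotated])
  then show ?thesis
    using assms(2) L2_subinterval[OF f assms(3)] by (auto simp: state_dom_def M2_def H1_def)
qed

end

(*
  Write form \<tau> Y X = <Y, P(\<tau>) X>; on the diagonal it is the minimal cost from time \<tau>. By polarization
  it suffices to differentiate \<phi>(\<tau>) = form \<tau> \<Xi> \<Xi>. Dynamic programming compares \<phi>(\<tau>) with
  \<phi>(\<sigma>), \<sigma> > \<tau>: a trajectory w from \<tau> with control u arrives at \<sigma> in a state \<Xi> + d with d small, and
    \<phi>(\<tau>) <= \<integral>_\<tau>^\<sigma> (|C w|^2 + |u|^2) + \<phi>(\<sigma>) + 2 form \<sigma> d \<Xi> + form \<sigma> d d,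
  with equality for the optimal u. The kernels being bounded, form is controlled by the L^1 norm of
  the histories, and |d|_1 = O(\<sigma> - \<tau>) for a constant control, so the last term is negligible; for the
  optimal control it is merely dropped, being nonnegative, and the terms in u are bounded below by
  completing the square. The constant control -B^* (P(\<tau>) \<Xi>)_0 gives the same limit from the other side.
  Hence \<phi> has a right derivative, which is continuous in \<tau>, so that \<phi> is differentiable.
  At \<tau> = T the cost of the zero control tends to 0, so the form vanishes.
*)
theory Submission
  imports Defs
begin

section \<open>Matrices and parametric integrals\<close>

text \<open>The kernels are only known to be continuous, so the equation cannot be obtained by
  differentiating them; the regularity comes from the two histories and from optimality. Dynamic
  programming looks forward in time, hence only right difference quotients are accessible. In
  reversed time the fixed pair \<open>\<Xi>\<close> is not transported by a trajectory: after a step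
  of length h the reached history differs from \<open>f\<close> by the translation
  \<open>f (s - h) - f s\<close> and by a short new piece near s = 0. The derivative of
  \<open>f\<close> is merely integrable, so the quotient of this translation is never examined
  pointwise; it is paired with the continuous second component of the Riccati operator. The optimal
  control is merely square integrable, so its values near \<open>\<tau>\<close> carry no
  information, and only its integrals are used. Two devices keep side conditions away: the kernels
  and \<open>N\<close> are extended to bounded continuous functions of unrestricted arguments, and
  the objects obtained by choice (adjoints, weak derivatives) enter through inner products.\<close>

lemma norm_matrix_vector_mult_le: "norm (A *v x) \<le> norm A * norm (x :: real^'n)" for A :: "real^'n^'m"
proof -
  have "norm (A *v x) = L2_set (\<lambda>i. norm ((A *v x) $ i)) UNIV"
    by (simp add: norm_vec_def)
  \<comment> \<open>The norm of a matrix is its Frobenius norm here, and Cauchy-Schwarz is used row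
    by row.\<close>
  also have "\<dots> \<le> L2_set (\<lambda>i. norm (A $ i) * norm x) UNIV"
    by (rule L2_set_mono) (simp_all add: matrix_vector_mul_component Cauchy_Schwarz_ineq2)
  also have "\<dots> = norm A * norm x"
    by (simp add: norm_vec_def L2_set_left_distrib)
  finally show ?thesis .
qed

lemma bounded_bilinear_matrix_vector_mult:
  "bounded_bilinear ((*v) :: real^'n^'m \<Rightarrow> real^'n \<Rightarrow> real^'m)"
  by (rule bounded_bilinear.intro)
     (auto simp: matrix_vector_mult_add_rdistrib matrix_vector_right_distrib scaleR_matrix_vector_assoc
        matrix_vector_mult_scaleR intro!: exI[of _ 1] norm_matrix_vector_mult_le)

lemma norm_transpose [simp]: "norm (transpose A) = norm (A :: real^'n^'m)"
proof -
  have "norm (transpose A) ^ 2 = norm A ^ 2"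
    unfolding power2_norm_eq_inner inner_vec_def transpose_def by (simp add: sum.swap[of _ "UNIV::'n set"])
  then show ?thesis by simp
qed

lemma continuous_on_matrix_vector_mult [continuous_intros]:
  fixes M :: "'a::topological_space \<Rightarrow> real^'n^'m"
  assumes "continuous_on S M" "continuous_on S v"
  shows "continuous_on S (\<lambda>x. M x *v v x)"
  using bounded_bilinear.continuous_on[OF bounded_bilinear_matrix_vector_mult assms] .

lemma tendsto_matrix_vector_mult [tendsto_intros]:
  fixes M :: "'a \<Rightarrow> real^'n^'m"
  assumes "(M \<longlongrightarrow> a) F" "(v \<longlongrightarrow> b) F"
  shows "((\<lambda>x. M x *v v x) \<longlongrightarrow> a *v b) F"
  using bounded_bilinear.tendsto[OF bounded_bilinear_matrix_vector_mult assms] .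

lemma continuous_on_transpose [continuous_intros]:
  fixes M :: "'a::topological_space \<Rightarrow> real^'n^'m"
  assumes "continuous_on S M"
  shows "continuous_on S (\<lambda>x. transpose (M x))"
  unfolding transpose_def by (intro continuous_intros assms)

lemma inner_transpose_vector: "(transpose A *v x) \<bullet> y = x \<bullet> (A *v y)" for A :: "real^'n^'m"
  by (metis dot_lmul_matrix transpose_matrix_vector inner_commute)

text \<open>Dominated convergence speaks of sequences converging at every point. A limit along
  \<open>at z0 within Z\<close> is tested on sequences, and the null set \<open>N\<close>, which
  will hold end points of moving intervals, is cut out of the domain of integration.\<close>

lemma tendsto_integral_within:
  fixes F :: "'a::euclidean_space \<Rightarrow> 'z::metric_space \<Rightarrow> 'b::euclidean_space"
  assumes int: "\<And>z. z \<in> Z \<Longrightarrow> (\<lambda>s. F s z) integrable_on S"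
    and h: "h integrable_on S" and bound: "\<And>z s. z \<in> Z \<Longrightarrow> s \<in> S \<Longrightarrow> norm (F s z) \<le> h s"
    and neg: "negligible N"
    and lim: "\<And>s. s \<in> S \<Longrightarrow> s \<notin> N \<Longrightarrow> ((\<lambda>z. F s z) \<longlongrightarrow> G s) (at z0 within Z)"
  shows "((\<lambda>z. integral S (\<lambda>s. F s z)) \<longlongrightarrow> integral S G) (at z0 within Z)"
  unfolding tendsto_at_iff_sequentially
proof (intro allI impI, unfold comp_def)
  fix X assume X: "\<forall>i. X i \<in> Z - {z0}" "X \<longlonglongrightarrow> z0"
  have eq: "integral (S - N) k = integral S k" for k :: "'a \<Rightarrow> 'b"
    using integral_subset_negligible[of "S - N" S k] negligible_subset[OF neg, of "S - (S - N)"] by auto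
  have ig: "k integrable_on S - N" if "k integrable_on S" for k :: "'a \<Rightarrow> 'c::euclidean_space"
  proof (rule integrable_spike_set[OF that])
    show "negligible {x \<in> S - (S - N). k x \<noteq> 0}" by (rule negligible_subset[OF neg]) auto
    have "{x \<in> S - N - S. k x \<noteq> 0} = {}" by auto
    then show "negligible {x \<in> S - N - S. k x \<noteq> 0}" by (simp only: negligible_empty)
  qed
  have "(\<lambda>i. integral (S - N) (\<lambda>s. F s (X i))) \<longlonglongrightarrow> integral (S - N) G"
  proof (rule dominated_convergence)
    show "(\<lambda>s. F s (X i)) integrable_on S - N" for i using X int ig by blast
    show "h integrable_on S - N" using h ig by blast
    show "norm (F s (X i)) \<le> h s" if "s \<in> S - N" for i s using X bound that by auto
    show "(\<lambda>i. F s (X i)) \<longlonglongrightarrow> G s" if "s \<in> S - N" for s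
      using lim[of s] that X unfolding tendsto_at_iff_sequentially comp_def by auto
  qed
  then show "(\<lambda>i. integral S (\<lambda>s. F s (X i))) \<longlonglongrightarrow> integral S G" by (simp add: eq)
qed

lemmas integral_split = Henstock_Kurzweil_Integration.integral_combine

text \<open>A moving end point is turned into a cut-off of the integrand, so that the domain is
  fixed and dominated convergence applies.\<close>

lemma integral_initial_segment:
  fixes f :: "real \<Rightarrow> 'a::euclidean_space"
  assumes "b \<le> T"
  shows "integral {0..b} f = integral {0..T} (\<lambda>s. if s \<le> b then f s else 0)"
proof -
  have "integral {0..b} f = integral {0..T} (\<lambda>s. if s \<in> {0..b} then f s else 0)"
    using assms by (subst Henstock_Kurzweil_Integration.integral_restrict_Int) (simp add: min_absorb1)
  also have "\<dots> = integral {0..T} (\<lambda>s. if s \<le> b then f s else 0)"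
    by (rule integral_cong) auto
  finally show ?thesis .
qed

lemma integrable_on_initial_segment:
  fixes f :: "real \<Rightarrow> 'a::euclidean_space"
  assumes "f integrable_on {0..b}" "b \<le> T"
  shows "(\<lambda>s. if s \<le> b then f s else 0) integrable_on {0..T}"
proof -
  have "(\<lambda>s. if s \<in> {0..b} then f s else 0) integrable_on {0..T}"
    using assms by (subst integrable_restrict_Int) (simp add: min_absorb1)
  then show ?thesis by (rule integrable_eq) auto
qed

text \<open>For \<open>s\<close> other than \<open>b z0\<close> the cut-off integrand is near
  \<open>z0\<close> either \<open>F s z\<close> or 0, because \<open>b\<close> is continuous; the
  one remaining point is a null set.\<close>

lemma continuous_on_integral_initial:
  fixes F :: "real \<Rightarrow> 'z::metric_space \<Rightarrow> 'b::euclidean_space"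
  assumes int: "\<And>z. z \<in> Z \<Longrightarrow> (\<lambda>s. F s z) integrable_on {0..b z}"
    and h: "h integrable_on {0..T}" and bound: "\<And>z s. z \<in> Z \<Longrightarrow> s \<in> {0..T} \<Longrightarrow> norm (F s z) \<le> h s"
    and b: "continuous_on Z b" "\<And>z. z \<in> Z \<Longrightarrow> b z \<le> T"
    and cont: "\<And>s. s \<in> {0..T} \<Longrightarrow> continuous_on Z (\<lambda>z. F s z)"
  shows "continuous_on Z (\<lambda>z. integral {0..b z} (\<lambda>s. F s z))"
  unfolding continuous_on_def
proof
  fix z0 assume z0: "z0 \<in> Z"
  have h0: "0 \<le> h s" if "s \<in> {0..T}" for s using bound[OF z0 that] norm_ge_zero order_trans by blast
  let ?F = "\<lambda>s z. if s \<le> b z then F s z else 0"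
  have lim: "((\<lambda>z. integral {0..T} (\<lambda>s. ?F s z)) \<longlongrightarrow> integral {0..T} (\<lambda>s. ?F s z0)) (at z0 within Z)"
  proof (rule tendsto_integral_within[where h = h and N = "{b z0}"])
    show "(\<lambda>s. ?F s z) integrable_on {0..T}" if "z \<in> Z" for z
      by (rule integrable_on_initial_segment[OF int[OF that] b(2)[OF that]])
    show "norm (?F s z) \<le> h s" if "z \<in> Z" "s \<in> {0..T}" for z s using bound h0 that by auto
    fix s assume s: "s \<in> {0..T}" "s \<notin> {b z0}"
    have bl: "(b \<longlongrightarrow> b z0) (at z0 within Z)" using b(1) z0 by (simp add: continuous_on_def)
    have Fl: "((\<lambda>z. F s z) \<longlongrightarrow> F s z0) (at z0 within Z)" using cont s z0 by (simp add: continuous_on_def)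
    show "((\<lambda>z. ?F s z) \<longlongrightarrow> ?F s z0) (at z0 within Z)"
    proof (cases "s < b z0")
      case True
      have "\<forall>\<^sub>F z in at z0 within Z. s < b z" using bl True by (rule order_tendstoD)
      then have "\<forall>\<^sub>F z in at z0 within Z. F s z = ?F s z" by eventually_elim simp
      from Lim_transform_eventually[OF Fl this] show ?thesis using True by simp
    next
      case False
      then have F: "b z0 < s" using s by auto
      have "\<forall>\<^sub>F z in at z0 within Z. b z < s" using bl F by (rule order_tendstoD)
      then have "\<forall>\<^sub>F z in at z0 within Z. 0 = ?F s z" by eventually_elim simp
      from Lim_transform_eventually[OF tendsto_const this] show ?thesis using F by simp
    qed
  qed (use h in auto)
  have eq: "integral {0..b z} (\<lambda>s. F s z) = integral {0..T} (\<lambda>s. ?F s z)" if "z \<in> Z" for z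
    by (rule integral_initial_segment) (use b that in auto)
  show "((\<lambda>z. integral {0..b z} (\<lambda>s. F s z)) \<longlongrightarrow> integral {0..b z0} (\<lambda>s. F s z0)) (at z0 within Z)"
    unfolding eq[OF z0]
    by (rule Lim_transform_eventually[OF lim]) (simp add: eventually_at_filter eq)
qed

text \<open>The interval has finite measure, and x <= 1 + x^2 follows from (x - 1/2)^2 >= 0.\<close>

lemma L2_imp_L1:
  assumes "f \<in> L2 a b" shows "f absolutely_integrable_on {a..b}"
proof (rule measurable_bounded_by_integrable_imp_absolutely_integrable)
  show "f \<in> borel_measurable (lebesgue_on {a..b})" using assms by (simp add: L2_def)
  have "(\<lambda>t. (norm (f t))\<^sup>2) integrable_on {a..b}" using assms by (simp add: L2_def integrable_on_lebesgue_on)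
  then show "(\<lambda>t. 1 + (norm (f t))\<^sup>2) integrable_on {a..b}" by (intro integrable_add) auto
  show "norm (f x) \<le> 1 + (norm (f x))\<^sup>2" for x
    using zero_le_power2[of "norm (f x) - 1/2"] by (simp add: power2_eq_square algebra_simps)
qed auto

text \<open>The product bound makes the integrand integrable on the product of two finite measure
  spaces; the rest translates between Lebesgue integrals and the gauge integrals used elsewhere. The
  second claim later gives the integrability of the weighted derivative
  \<open>g r \<bullet> W r \<sigma>\<close>.\<close>

lemma integral_fubini_real:
  fixes H :: "real \<Rightarrow> real \<Rightarrow> real"
  assumes meas: "(\<lambda>(s, r). H s r) \<in> borel_measurable (lebesgue_on {a..b} \<Otimes>\<^sub>M lebesgue_on {a..b})"
    and al: "\<alpha> absolutely_integrable_on {a..b}" and be: "\<beta> absolutely_integrable_on {a..b}"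
    and bound: "\<And>s r. s \<in> {a..b} \<Longrightarrow> r \<in> {a..b} \<Longrightarrow> \<bar>H s r\<bar> \<le> \<alpha> s * \<beta> r"
  shows "integral {a..b} (\<lambda>s. integral {a..b} (\<lambda>r. H s r)) = integral {a..b} (\<lambda>r. integral {a..b} (\<lambda>s. H s r))"
    and "(\<lambda>r. integral {a..b} (\<lambda>s. H s r)) integrable_on {a..b}"
proof -
  let ?M = "lebesgue_on {a..b}"
  interpret F: finite_measure ?M by (rule finite_measure_lebesgue_on) simp
  interpret P: pair_sigma_finite ?M ?M ..
  have ia: "integrable ?M \<alpha>" and ib: "integrable ?M \<beta>"
    using al be by (simp_all add: absolutely_integrable_on_def set_integrable_def integrable_restrict_space)
  have "integrable (?M \<Otimes>\<^sub>M ?M) (\<lambda>(s, r). \<alpha> s * \<beta> r)"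
  proof (rule P.Fubini_integrable)
    have [measurable]: "\<alpha> \<in> borel_measurable ?M" "\<beta> \<in> borel_measurable ?M" using ia ib by auto
    show "(\<lambda>(s, r). \<alpha> s * \<beta> r) \<in> borel_measurable (?M \<Otimes>\<^sub>M ?M)" by measurable
    show "AE s in ?M. integrable ?M (\<lambda>r. case (s, r) of (s, r) \<Rightarrow> \<alpha> s * \<beta> r)" using ib by simp
    show "integrable ?M (\<lambda>s. LINT r|?M. norm (case (s, r) of (s, r) \<Rightarrow> \<alpha> s * \<beta> r))"
      using ia ib by (simp add: abs_mult)
  qed
  then have int: "integrable (?M \<Otimes>\<^sub>M ?M) (\<lambda>(s, r). H s r)"
    by (rule Bochner_Integration.integrable_bound[OF _ meas])
       (auto intro!: AE_I2 order_trans[OF bound abs_ge_self] simp: space_pair_measure)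
  have i1: "integrable ?M (\<lambda>s. integral\<^sup>L ?M (\<lambda>r. H s r))" using P.integrable_fst[OF int] by simp
  have i2: "integrable ?M (\<lambda>r. integral\<^sup>L ?M (\<lambda>s. H s r))" using P.integrable_snd[OF int] by simp
  have m1: "(\<lambda>r. H s r) \<in> borel_measurable ?M" if "s \<in> {a..b}" for s
    using measurable_compose[OF measurable_Pair1'[of s ?M ?M] meas] that by simp
  have m2: "(\<lambda>s. H s r) \<in> borel_measurable ?M" if "r \<in> {a..b}" for r
    using measurable_compose[OF measurable_Pair2'[of r ?M ?M] meas] that by simp
  have j1: "integrable ?M (\<lambda>r. H s r)" if "s \<in> {a..b}" for s
    by (rule Bochner_Integration.integrable_bound[of _ "\<lambda>r. \<alpha> s * \<beta> r"])
       (use that ib m1 in \<open>auto intro!: AE_I2 order_trans[OF bound abs_ge_self]\<close>)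
  have j2: "integrable ?M (\<lambda>s. H s r)" if "r \<in> {a..b}" for r
    by (rule Bochner_Integration.integrable_bound[of _ "\<lambda>s. \<alpha> s * \<beta> r"])
       (use that ia m2 in \<open>auto intro!: AE_I2 order_trans[OF bound abs_ge_self]\<close>)
  have "integral {a..b} (\<lambda>s. integral {a..b} (\<lambda>r. H s r)) = integral {a..b} (\<lambda>s. integral\<^sup>L ?M (\<lambda>r. H s r))"
    by (rule integral_cong) (simp add: lebesgue_integral_eq_integral j1)
  also have "\<dots> = integral\<^sup>L ?M (\<lambda>s. integral\<^sup>L ?M (\<lambda>r. H s r))"
    by (simp add: lebesgue_integral_eq_integral i1)
  also have "\<dots> = integral\<^sup>L ?M (\<lambda>r. integral\<^sup>L ?M (\<lambda>s. H s r))"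
    using P.Fubini_integral[OF int] by simp
  also have "\<dots> = integral {a..b} (\<lambda>r. integral\<^sup>L ?M (\<lambda>s. H s r))"
    by (simp add: lebesgue_integral_eq_integral i2)
  also have "\<dots> = integral {a..b} (\<lambda>r. integral {a..b} (\<lambda>s. H s r))"
    by (rule integral_cong) (simp add: lebesgue_integral_eq_integral j2)
  finally show "integral {a..b} (\<lambda>s. integral {a..b} (\<lambda>r. H s r)) = integral {a..b} (\<lambda>r. integral {a..b} (\<lambda>s. H s r))" .
  have "(\<lambda>r. integral\<^sup>L ?M (\<lambda>s. H s r)) integrable_on {a..b}"
    by (rule integrable_on_lebesgue_on[OF i2]) simp
  then show "(\<lambda>r. integral {a..b} (\<lambda>s. H s r)) integrable_on {a..b}"
    by (rule integrable_eq) (simp add: lebesgue_integral_eq_integral j2)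
qed

section \<open>Time reversal and square integrability\<close>

lemma has_integral_reflect_initial:
  fixes f :: "real \<Rightarrow> 'a::euclidean_space"
  assumes "(f has_integral i) {0..\<tau>}"
  shows "((\<lambda>s. f (\<tau> - s)) has_integral i) {0..\<tau>}"
proof -
  have "((\<lambda>x. f (- x)) has_integral i) {-\<tau>..0}"
    using has_integral_reflect_lemma_real[OF assms] by simp
  from has_integral_affinity[of "\<lambda>x. f (- x)" i "-\<tau>" 0 1 "-\<tau>"] this
  have "((\<lambda>s. f (\<tau> - s)) has_integral i) ((\<lambda>x. x + \<tau>) ` {-\<tau>..0})"
    by simp
  moreover have "(\<lambda>x. x + \<tau>) ` {-\<tau>..0} = {0..\<tau>}"
    using image_add_atLeastAtMost'[of \<tau> "-\<tau>" 0] by simp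
  ultimately show ?thesis by simp
qed

lemma integral_reflect_initial:
  fixes f :: "real \<Rightarrow> 'a::euclidean_space"
  shows "integral {0..\<tau>} (\<lambda>s. f (\<tau> - s)) = integral {0..\<tau>} f"
proof (cases "f integrable_on {0..\<tau>}")
  case True
  then show ?thesis using has_integral_reflect_initial integrable_integral by blast
next
  case False
  \<comment> \<open>Reversal is an involution, so neither side is integrable and both integrals have
    the default value 0.\<close>
  have "\<not> (\<lambda>s. f (\<tau> - s)) integrable_on {0..\<tau>}"
    using has_integral_reflect_initial[of "\<lambda>s. f (\<tau> - s)" _ \<tau>] False by (auto simp: integrable_on_def)
  then show ?thesis using False by (simp add: not_integrable_integral)
qed

lemma absolutely_integrable_reflect_initial:
  fixes f :: "real \<Rightarrow> 'a::euclidean_space"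
  assumes "f absolutely_integrable_on {0..\<tau>}"
  shows "(\<lambda>s. f (\<tau> - s)) absolutely_integrable_on {0..\<tau>}"
  using assms has_integral_reflect_initial[of f _ \<tau>] has_integral_reflect_initial[of "\<lambda>s. norm (f s)" _ \<tau>]
  unfolding absolutely_integrable_on_def by (auto simp: integrable_on_def)

text \<open>In this form measurability is absorbed into gauge integrability, for which subintervals,
  reflection and gluing are easy to handle.\<close>

lemma L2_iff:
  "f \<in> L2 a b \<longleftrightarrow> f absolutely_integrable_on {a..b} \<and> (\<lambda>t. (norm (f t))\<^sup>2) integrable_on {a..b}"
proof
  assume "f \<in> L2 a b"
  then show "f absolutely_integrable_on {a..b} \<and> (\<lambda>t. (norm (f t))\<^sup>2) integrable_on {a..b}"
    by (simp add: L2_imp_L1) (simp add: L2_def integrable_on_lebesgue_on)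
next
  assume *: "f absolutely_integrable_on {a..b} \<and> (\<lambda>t. (norm (f t))\<^sup>2) integrable_on {a..b}"
  then have "(\<lambda>t. (norm (f t))\<^sup>2) absolutely_integrable_on {a..b}"
    by (intro nonnegative_absolutely_integrable_1) auto
  then have "integrable (lebesgue_on {a..b}) (\<lambda>t. (norm (f t))\<^sup>2)"
    by (simp add: set_integrable_def integrable_restrict_space)
  moreover have "f \<in> borel_measurable (lebesgue_on {a..b})"
    using * absolutely_integrable_measurable[of "{a..b}" f] by simp
  ultimately show "f \<in> L2 a b" by (simp add: L2_def)
qed

lemma L2_reflect: "f \<in> L2 0 \<tau> \<Longrightarrow> (\<lambda>s. f (\<tau> - s)) \<in> L2 0 \<tau>"
  using absolutely_integrable_reflect_initial[of \<tau> f] has_integral_reflect_initial[of "\<lambda>s. (norm (f s))\<^sup>2" _ \<tau>]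
  by (auto simp: L2_iff integrable_on_def)

lemma continuous_imp_L2: "continuous_on {a..b} f \<Longrightarrow> f \<in> L2 a b"
  unfolding L2_iff
  by (auto intro!: absolutely_integrable_continuous_real integrable_continuous_real continuous_intros)

lemma absolutely_integrable_matrix_vector_mult:
  fixes M :: "real \<Rightarrow> real^'n^'m"
  assumes "continuous_on {a..b} M" "f absolutely_integrable_on {a..b}"
  shows "(\<lambda>s. M s *v f s) absolutely_integrable_on {a..b}"
proof (rule absolutely_integrable_bounded_measurable_product[where h = "(*v)"])
  show "bilinear ((*v) :: real^'n^'m \<Rightarrow> _)"
    by (simp add: bilinear_conv_bounded_bilinear bounded_bilinear_matrix_vector_mult)
  show "M \<in> borel_measurable (lebesgue_on {a..b})"
    by (rule continuous_imp_measurable_on_sets_lebesgue) (use assms in auto)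
  show "bounded (M ` {a..b})"
    by (intro compact_imp_bounded compact_continuous_image assms) auto
qed (use assms in auto)

lemma absolutely_integrable_inner_continuous:
  fixes v :: "real \<Rightarrow> 'a::euclidean_space"
  assumes "continuous_on {a..b} v" "f absolutely_integrable_on {a..b}"
  shows "(\<lambda>s. f s \<bullet> v s) absolutely_integrable_on {a..b}"
proof -
  have "(\<lambda>s. v s \<bullet> f s) absolutely_integrable_on {a..b}"
  proof (rule absolutely_integrable_bounded_measurable_product[where h = "(\<bullet>)"])
    show "bilinear ((\<bullet>) :: 'a \<Rightarrow> 'a \<Rightarrow> real)"
      by (simp add: bilinear_conv_bounded_bilinear bounded_bilinear_inner)
    show "v \<in> borel_measurable (lebesgue_on {a..b})"
      by (rule continuous_imp_measurable_on_sets_lebesgue) (use assms in auto)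
    show "bounded (v ` {a..b})"
      by (intro compact_imp_bounded compact_continuous_image assms) auto
  qed (use assms in auto)
  then show ?thesis by (simp add: inner_commute)
qed

lemma L1_imp_integrable:
  fixes f :: "'a::euclidean_space \<Rightarrow> 'b::euclidean_space"
  assumes "f absolutely_integrable_on S"
  shows "f integrable_on S" "(\<lambda>s. norm (f s)) integrable_on S"
  using assms by (simp_all add: absolutely_integrable_on_def)

lemma L1_subinterval:
  fixes f :: "real \<Rightarrow> 'a::euclidean_space"
  assumes "f absolutely_integrable_on {a..b}" "a \<le> c" "d \<le> b"
  shows "f absolutely_integrable_on {c..d}"
  using absolutely_integrable_on_subinterval[of "{a..b}" f c d] assms by auto

section \<open>Right derivatives and averages\<close>

text \<open>With the slack \<epsilon> (t - a) subtracted, take the last point at which the remainder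
  \<open>G\<close> is nonpositive. The bound on the right quotients yields such points further to
  the right, so this last point can only be \<open>b\<close>.\<close>

lemma nonincreasing_if_upper_right_derivative_nonpos:
  fixes \<psi> :: "real \<Rightarrow> real"
  assumes "a \<le> b" and cont: "continuous_on {a..b} \<psi>"
    and dini: "\<And>t \<epsilon>. a \<le> t \<Longrightarrow> t < b \<Longrightarrow> \<epsilon> > 0 \<Longrightarrow> \<forall>\<^sub>F s in at_right t. \<psi> s - \<psi> t \<le> \<epsilon> * (s - t)"
  shows "\<psi> b \<le> \<psi> a"
proof (rule field_le_epsilon)
  fix e :: real assume "e > 0"
  \<comment> \<open>The total slack \<epsilon> (b - a) is to be at most \<open>e\<close>; the
    summand 1 keeps the divisor positive also for a = b.\<close>
  define \<epsilon> where "\<epsilon> = e / (b - a + 1)"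
  have eps: "\<epsilon> > 0" using \<open>e > 0\<close> \<open>a \<le> b\<close> by (simp add: \<epsilon>_def)
  have le_e: "\<epsilon> * (b - a) \<le> e" using \<open>e > 0\<close> \<open>a \<le> b\<close> by (simp add: \<epsilon>_def field_simps)
  define G where "G t = \<psi> t - \<psi> a - \<epsilon> * (t - a)" for t
  have contG: "continuous_on {a..b} G" unfolding G_def by (intro continuous_intros cont)
  have "G b \<le> 0"
  proof (rule ccontr)
    assume neg: "\<not> G b \<le> 0"
    define S where "S = {t \<in> {a..b}. G t \<le> 0}"
    have "closed S" unfolding S_def by (intro continuous_on_closed_Collect_le contG continuous_on_const) auto
    moreover have "bounded S"
      by (rule bounded_subset[OF bounded_closed_interval[of a b]]) (auto simp: S_def)
    ultimately have "compact S" by (simp add: compact_eq_bounded_closed)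
    moreover have "a \<in> S" using \<open>a \<le> b\<close> by (simp add: S_def G_def)
    ultimately obtain c where c: "c \<in> S" "\<And>t. t \<in> S \<Longrightarrow> t \<le> c"
      using compact_attains_sup[of S] by auto
    have cb: "a \<le> c" "c < b" using c(1) neg by (auto simp: S_def less_le)
    have "\<forall>\<^sub>F s in at_right c. \<psi> s - \<psi> c \<le> \<epsilon> / 2 * (s - c)"
      by (rule dini) (use cb eps in auto)
    moreover have "\<forall>\<^sub>F s in at_right c. s < b" "\<forall>\<^sub>F s in at_right c. c < s"
      using cb by (auto simp: eventually_at_right[OF cb(2)])
    ultimately have "\<forall>\<^sub>F s in at_right c. False"
    proof eventually_elim
      case (elim s)
      have "\<epsilon> / 2 * (s - c) \<le> \<epsilon> * (s - c)" using eps elim by (intro mult_right_mono) auto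
      with elim(1) have "\<psi> s - \<psi> c \<le> \<epsilon> * (s - c)" by linarith
      then have "G s \<le> G c" by (simp add: G_def algebra_simps)
      with c(1) elim have "s \<in> S" by (simp add: S_def)
      with c(2) elim show False by force
    qed
    then show False by (simp add: eventually_const_iff trivial_limit_at_right_real)
  qed
  then show "\<psi> b \<le> \<psi> a + e" using le_e by (simp add: G_def)
qed

text \<open>Subtracting a primitive of \<open>D\<close> leaves a function \<open>\<psi>\<close> with
  right derivative 0; the monotonicity lemma, applied to \<open>\<psi>\<close> and to its negative,
  makes it constant. This uses the right derivative at every point near \<open>t\<close>, not only
  at \<open>t\<close>.\<close>

lemma has_real_derivative_if_right_derivative_continuous:
  fixes \<phi> D :: "real \<Rightarrow> real"
  assumes cont: "continuous_on {a<..<b} \<phi>" "continuous_on {a<..<b} D"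
    and lim: "\<And>t. t \<in> {a<..<b} \<Longrightarrow> ((\<lambda>s. (\<phi> s - \<phi> t) / (s - t)) \<longlongrightarrow> D t) (at_right t)"
    and t: "t \<in> {a<..<b}"
  shows "(\<phi> has_real_derivative D t) (at t)"
proof -
  obtain c d where cd: "a < c" "c < t" "t < d" "d < b"
    using t dense by (metis greaterThanLessThan_iff)
  define I where "I x = integral {c..x} D" for x
  have Dc: "continuous_on {c..d} D" by (rule continuous_on_subset[OF cont(2)]) (use cd in auto)
  have dI: "(I has_real_derivative D x) (at x within {c..d})" if "x \<in> {c..d}" for x
    unfolding I_def by (rule integral_has_real_derivative[OF Dc that])
  define \<psi> where "\<psi> x = \<phi> x - I x" for x
  have contI: "continuous_on {c..d} I" using dI by (meson DERIV_continuous_on)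
  have cpsi: "continuous_on {c..d} \<psi>"
    unfolding \<psi>_def by (intro continuous_intros contI continuous_on_subset[OF cont(1)]) (use cd in auto)
  have lpsi: "((\<lambda>s. (\<psi> s - \<psi> x) / (s - x)) \<longlongrightarrow> 0) (at_right x)" if x: "c \<le> x" "x < d" for x
  proof -
    have "((\<lambda>s. (I s - I x) / (s - x)) \<longlongrightarrow> D x) (at x within {c..d})"
      using dI[of x] x by (simp add: has_field_derivative_iff)
    then have "((\<lambda>s. (I s - I x) / (s - x)) \<longlongrightarrow> D x) (at x within {x..d})"
      by (rule tendsto_within_subset) (use x in auto)
    then have "((\<lambda>s. (I s - I x) / (s - x)) \<longlongrightarrow> D x) (at_right x)"
      using at_within_Icc_at_right[OF x(2)] by simp
    from tendsto_diff[OF lim[of x] this] cd x show ?thesis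
      by (simp add: \<psi>_def diff_divide_distrib[symmetric] algebra_simps)
  qed
  have dini: "\<forall>\<^sub>F s in at_right x. k * (\<psi> s - \<psi> x) \<le> \<epsilon> * (s - x)"
    if x: "c \<le> x" "x < d" and "\<epsilon> > 0" "\<bar>k\<bar> = 1" for x \<epsilon> k
  proof -
    have "\<forall>\<^sub>F s in at_right x. \<bar>(\<psi> s - \<psi> x) / (s - x)\<bar> < \<epsilon>"
      using tendstoD[OF lpsi[OF x] \<open>\<epsilon> > 0\<close>] by (simp add: dist_real_def)
    moreover have "\<forall>\<^sub>F s in at_right x. x < s" by (simp add: eventually_at_filter)
    ultimately show ?thesis
    proof eventually_elim
      case (elim s)
      then have "\<bar>\<psi> s - \<psi> x\<bar> < \<epsilon> * (s - x)" by (simp add: abs_divide pos_divide_less_eq)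
      moreover have "k * (\<psi> s - \<psi> x) \<le> \<bar>\<psi> s - \<psi> x\<bar>"
        using abs_ge_self[of "k * (\<psi> s - \<psi> x)"] \<open>\<bar>k\<bar> = 1\<close> by (simp add: abs_mult)
      ultimately show ?case by linarith
    qed
  qed
  have const: "\<psi> x = \<psi> c" if x: "x \<in> {c..d}" for x
  proof (rule antisym)
    show "\<psi> x \<le> \<psi> c"
      by (rule nonincreasing_if_upper_right_derivative_nonpos)
         (use x dini[where k = 1] in \<open>auto intro: continuous_on_subset[OF cpsi]\<close>)
    have "- \<psi> x \<le> - \<psi> c"
      by (rule nonincreasing_if_upper_right_derivative_nonpos)
         (use x dini[where k = "-1"] in \<open>auto intro!: continuous_intros intro: continuous_on_subset[OF cpsi] simp: algebra_simps\<close>)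
    then show "\<psi> c \<le> \<psi> x" by simp
  qed
  have "((\<lambda>x. \<psi> c + I x) has_real_derivative D t) (at t within {c<..<d})"
    by (rule DERIV_subset[of _ _ _ "{c..d}"]) (use dI[of t] cd in \<open>auto intro!: derivative_eq_intros\<close>)
  then have "((\<lambda>x. \<psi> c + I x) has_real_derivative D t) (at t)"
    using cd by (simp add: at_within_open[of t "{c<..<d}"])
  then show ?thesis
    by (rule has_field_derivative_transform_within_open[where S = "{c<..<d}"])
       (use cd const in \<open>auto simp: \<psi>_def algebra_simps\<close>)
qed

text \<open>The integrand may vary with \<open>\<sigma>\<close> too, and the window starts at a
  point \<open>r\<close> unrelated to \<open>\<tau>\<close>; the distance of \<open>\<sigma>\<close>
  from \<open>\<tau>\<close> only gives its length. It is used with \<open>r\<close> inside the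
  history, at 0 and at \<open>\<tau>\<close>.\<close>

lemma tendsto_average:
  fixes V :: "real \<Rightarrow> real \<Rightarrow> 'a::euclidean_space"
  assumes lim: "\<And>\<epsilon>. \<epsilon> > 0 \<Longrightarrow> \<exists>\<delta>>0. \<forall>\<sigma> s. \<tau> < \<sigma> \<and> \<sigma> < \<tau> + \<delta> \<and> r \<le> s \<and> s \<le> r + (\<sigma> - \<tau>) \<longrightarrow> norm (V s \<sigma> - L) \<le> \<epsilon>"
    and int: "\<forall>\<^sub>F \<sigma> in at_right \<tau>. (\<lambda>s. V s \<sigma>) integrable_on {r..r + (\<sigma> - \<tau>)}"
  shows "((\<lambda>\<sigma>. (1 / (\<sigma> - \<tau>)) *\<^sub>R integral {r..r + (\<sigma> - \<tau>)} (\<lambda>s. V s \<sigma>)) \<longlongrightarrow> L) (at_right \<tau>)"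
proof (rule tendstoI)
  fix e :: real assume "e > 0"
  then obtain \<delta> where \<delta>: "\<delta> > 0"
    "\<And>\<sigma> s. \<tau> < \<sigma> \<Longrightarrow> \<sigma> < \<tau> + \<delta> \<Longrightarrow> r \<le> s \<Longrightarrow> s \<le> r + (\<sigma> - \<tau>) \<Longrightarrow> norm (V s \<sigma> - L) \<le> e / 2"
    using lim[of "e/2"] by fastforce
  have "\<forall>\<^sub>F \<sigma> in at_right \<tau>. \<tau> < \<sigma> \<and> \<sigma> < \<tau> + \<delta>"
    using \<delta>(1) by (subst eventually_at_right[of \<tau> "\<tau> + \<delta>"]) (auto intro!: exI[of _ "\<tau> + \<delta>"])
  with int show "\<forall>\<^sub>F \<sigma> in at_right \<tau>. dist ((1 / (\<sigma> - \<tau>)) *\<^sub>R integral {r..r + (\<sigma> - \<tau>)} (\<lambda>s. V s \<sigma>)) L < e"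
  proof eventually_elim
    case (elim \<sigma>)
    let ?h = "\<sigma> - \<tau>"
    have "integral {r..r + ?h} (\<lambda>s. V s \<sigma> - L) = integral {r..r + ?h} (\<lambda>s. V s \<sigma>) - ?h *\<^sub>R L"
      using elim by (subst integral_diff) auto
    then have "(1 / ?h) *\<^sub>R integral {r..r + ?h} (\<lambda>s. V s \<sigma>) - L = (1 / ?h) *\<^sub>R integral {r..r + ?h} (\<lambda>s. V s \<sigma> - L)"
      using elim by (simp add: scaleR_diff_right)
    moreover have "norm (integral {r..r + ?h} (\<lambda>s. V s \<sigma> - L)) \<le> integral {r..r + ?h} (\<lambda>s. e / 2)"
      by (rule integral_norm_bound_integral) (use elim \<delta>(2) in \<open>auto intro!: integrable_diff\<close>)
    ultimately have "norm ((1 / ?h) *\<^sub>R integral {r..r + ?h} (\<lambda>s. V s \<sigma>) - L) \<le> e / 2"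
      using elim by (simp add: field_simps)
    then show ?case using \<open>e > 0\<close> by (simp add: dist_norm)
  qed
qed

section \<open>Quadratic forms with continuous kernels\<close>

text \<open>Total, bounded and continuous kernels spare the later estimates the conditions 0 <= s <=
  \<tau> <= T. The direction of time is left open: the axioms hold for kernels in natural time and
  for the reversed ones alike.\<close>

locale kernels =
  fixes T K :: real
    and p0 :: "real \<Rightarrow> real^'d^'d"
    and p1 :: "real \<Rightarrow> real \<Rightarrow> real^'d^'d"
    and p2 :: "real \<Rightarrow> real \<Rightarrow> real \<Rightarrow> real^'d^'d"
  assumes T_pos: "0 < T"
    and cont_p0: "continuous_on UNIV p0"
    and cont_p1: "continuous_on UNIV (\<lambda>(s, \<tau>). p1 s \<tau>)"
    and cont_p2: "continuous_on UNIV (\<lambda>(s, \<nu>, \<tau>). p2 s \<nu> \<tau>)"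
    and bound_p: "norm (p0 \<tau>) \<le> K" "norm (p1 s \<tau>) \<le> K" "norm (p2 s \<nu> \<tau>) \<le> K"
    and sym_p0: "transpose (p0 \<tau>) = p0 \<tau>"
    and sym_p2: "transpose (p2 s \<nu> \<tau>) = p2 \<nu> s \<tau>"
begin

lemma K_nonneg: "0 \<le> K"
  using bound_p(1) norm_ge_zero order_trans by blast

lemma continuous_on_p0 [continuous_intros]:
  "continuous_on S a \<Longrightarrow> continuous_on S (\<lambda>x. p0 (a x))"
  using continuous_on_compose2[OF cont_p0] by auto

lemma continuous_on_p1 [continuous_intros]:
  assumes "continuous_on S a" "continuous_on S b"
  shows "continuous_on S (\<lambda>x. p1 (a x) (b x))"
  using continuous_on_compose2[OF cont_p1 continuous_on_Pair[OF assms]] by auto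

lemma continuous_on_p2 [continuous_intros]:
  assumes "continuous_on S a" "continuous_on S b" "continuous_on S c"
  shows "continuous_on S (\<lambda>x. p2 (a x) (b x) (c x))"
  using continuous_on_compose2[OF cont_p2 continuous_on_Pair[OF assms(1) continuous_on_Pair[OF assms(2,3)]]]
  by auto

lemma norm_mult_le:
  "norm (p0 \<tau> *v x) \<le> K * norm x" "norm (p1 s \<tau> *v x) \<le> K * norm x"
  "norm (transpose (p1 s \<tau>) *v x) \<le> K * norm x" "norm (p2 s \<nu> \<tau> *v x) \<le> K * norm x"
  using norm_matrix_vector_mult_le[of "p0 \<tau>" x] norm_matrix_vector_mult_le[of "p1 s \<tau>" x]
    norm_matrix_vector_mult_le[of "transpose (p1 s \<tau>)" x] norm_matrix_vector_mult_le[of "p2 s \<nu> \<tau>" x]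
    mult_right_mono[OF bound_p(1)[of \<tau>], of "norm x"] mult_right_mono[OF bound_p(2)[of s \<tau>], of "norm x"]
    mult_right_mono[OF bound_p(3)[of s \<nu> \<tau>], of "norm x"]
  by (auto intro: order_trans)

text \<open>\<open>head\<close> and \<open>tail\<close> are the two components of the Riccati
  operator applied to \<open>(x, f)\<close>, and \<open>form\<close> pairs them with
  \<open>(y, g)\<close>. The adjoint in \<open>riccati_op\<close> is fixed only up to null sets,
  whereas \<open>tail\<close> is a continuous representative.\<close>

definition head :: "real \<Rightarrow> real^'d \<Rightarrow> (real \<Rightarrow> real^'d) \<Rightarrow> real^'d" where
  "head \<tau> x f = p0 \<tau> *v x + integral {0..\<tau>} (\<lambda>s. p1 s \<tau> *v f s)"

definition tail :: "real \<Rightarrow> real^'d \<Rightarrow> (real \<Rightarrow> real^'d) \<Rightarrow> real \<Rightarrow> real^'d" where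
  "tail \<tau> x f s = transpose (p1 s \<tau>) *v x + integral {0..\<tau>} (\<lambda>\<nu>. p2 s \<nu> \<tau> *v f \<nu>)"

definition form :: "real \<Rightarrow> real^'d \<Rightarrow> (real \<Rightarrow> real^'d) \<Rightarrow> real^'d \<Rightarrow> (real \<Rightarrow> real^'d) \<Rightarrow> real" where
  "form \<tau> y g x f = y \<bullet> head \<tau> x f + integral {0..\<tau>} (\<lambda>s. g s \<bullet> tail \<tau> x f s)"

section \<open>Continuity and bounds of the two components\<close>

lemma absolutely_integrable_p:
  assumes "f absolutely_integrable_on {a..b}"
  shows "(\<lambda>s. p1 s \<tau> *v f s) absolutely_integrable_on {a..b}"
    "(\<lambda>\<nu>. p2 s \<nu> \<tau> *v f \<nu>) absolutely_integrable_on {a..b}"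
  by (intro absolutely_integrable_matrix_vector_mult assms continuous_intros)+

lemmas integrable_p = absolutely_integrable_p[THEN L1_imp_integrable(1)]

lemma continuous_on_tail:
  assumes f: "f absolutely_integrable_on {0..\<tau>}"
  shows "continuous_on S (tail \<tau> x f)"
proof -
  have "continuous_on S (\<lambda>s. integral {0..\<tau>} (\<lambda>\<nu>. p2 s \<nu> \<tau> *v f \<nu>))"
  proof (rule continuous_on_integral_initial[where b = "\<lambda>_. \<tau>" and T = \<tau>])
    show "(\<lambda>\<nu>. K * norm (f \<nu>)) integrable_on {0..\<tau>}"
      using L1_imp_integrable(2)[OF f] by (rule integrable_on_mult_right)
  qed (auto intro!: integrable_p f norm_mult_le continuous_intros)
  then show ?thesis unfolding tail_def by (intro continuous_intros)
qed

text \<open>Averages along a moving final time evaluate \<open>tail\<close> at \<open>s\<close> and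
  \<open>\<sigma>\<close> that vary together, so separate continuity would not do. The restriction
  on \<open>\<tau>\<close> reflects that \<open>f\<close> is integrable up to
  \<open>T\<close>.\<close>

lemma continuous_on_tail_joint:
  assumes f: "f absolutely_integrable_on {0..T}"
  shows "continuous_on (UNIV \<times> {..T}) (\<lambda>(s, \<tau>). tail \<tau> x f s)"
proof -
  have "continuous_on (UNIV \<times> {..T}) (\<lambda>z. integral {0..snd z} (\<lambda>\<nu>. p2 (fst z) \<nu> (snd z) *v f \<nu>))"
  proof (rule continuous_on_integral_initial[where T = T])
    show "(\<lambda>\<nu>. K * norm (f \<nu>)) integrable_on {0..T}"
      using L1_imp_integrable(2)[OF f] by (rule integrable_on_mult_right)
    show "(\<lambda>\<nu>. p2 (fst z) \<nu> (snd z) *v f \<nu>) integrable_on {0..snd z}" if "z \<in> UNIV \<times> {..T}" for z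
      by (intro integrable_p L1_subinterval[OF f]) (use that in auto)
  qed (auto intro!: norm_mult_le continuous_intros)
  then show ?thesis unfolding tail_def case_prod_beta by (intro continuous_intros)
qed

lemma continuous_on_head:
  assumes f: "f absolutely_integrable_on {0..T}"
  shows "continuous_on {..T} (\<lambda>\<tau>. head \<tau> x f)"
proof -
  have "continuous_on {..T} (\<lambda>\<tau>. integral {0..\<tau>} (\<lambda>\<nu>. p1 \<nu> \<tau> *v f \<nu>))"
  proof (rule continuous_on_integral_initial[where T = T])
    show "(\<lambda>\<nu>. K * norm (f \<nu>)) integrable_on {0..T}"
      using L1_imp_integrable(2)[OF f] by (rule integrable_on_mult_right)
    show "(\<lambda>\<nu>. p1 \<nu> z *v f \<nu>) integrable_on {0..z}" if "z \<in> {..T}" for z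
      by (intro integrable_p L1_subinterval[OF f]) (use that in auto)
  qed (auto intro!: norm_mult_le continuous_intros)
  then show ?thesis unfolding head_def by (intro continuous_intros)
qed

lemma norm_integral_p_le:
  assumes f: "f absolutely_integrable_on {0..\<tau>}"
  shows "norm (integral {0..\<tau>} (\<lambda>s. p1 s \<tau> *v f s)) \<le> K * integral {0..\<tau>} (\<lambda>s. norm (f s))"
    "norm (integral {0..\<tau>} (\<lambda>\<nu>. p2 s \<nu> \<tau> *v f \<nu>)) \<le> K * integral {0..\<tau>} (\<lambda>s. norm (f s))"
  unfolding integral_mult_right[symmetric]
  by (rule integral_norm_bound_integral;
      auto intro!: integrable_p f norm_mult_le integrable_on_mult_right L1_imp_integrable(2)[OF f])+

lemma norm_head_le:
  assumes f: "f absolutely_integrable_on {0..\<tau>}"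
  shows "norm (head \<tau> x f) \<le> K * (norm x + integral {0..\<tau>} (\<lambda>s. norm (f s)))"
  unfolding head_def distrib_left
  by (intro norm_triangle_mono norm_mult_le norm_integral_p_le f)

lemma norm_tail_le:
  assumes f: "f absolutely_integrable_on {0..\<tau>}"
  shows "norm (tail \<tau> x f s) \<le> K * (norm x + integral {0..\<tau>} (\<lambda>s. norm (f s)))"
  unfolding tail_def distrib_left
  by (intro norm_triangle_mono norm_mult_le norm_integral_p_le f)

lemma integrable_inner_tail:
  assumes f: "f absolutely_integrable_on {0..\<tau>}" and g: "g absolutely_integrable_on {a..b}"
  shows "(\<lambda>s. g s \<bullet> tail \<tau> x f s) absolutely_integrable_on {a..b}"
  by (intro absolutely_integrable_inner_continuous continuous_on_tail f g)

lemma abs_form_le: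
  assumes f: "f absolutely_integrable_on {0..\<tau>}" and g: "g absolutely_integrable_on {0..\<tau>}"
  shows "\<bar>form \<tau> y g x f\<bar> \<le> K * (norm y + integral {0..\<tau>} (\<lambda>s. norm (g s))) * (norm x + integral {0..\<tau>} (\<lambda>s. norm (f s)))"
proof -
  let ?M = "K * (norm x + integral {0..\<tau>} (\<lambda>s. norm (f s)))"
  have "\<bar>y \<bullet> head \<tau> x f\<bar> \<le> norm y * ?M"
    by (rule order_trans[OF Cauchy_Schwarz_ineq2 mult_left_mono]) (auto intro: norm_head_le f)
  moreover have "norm (integral {0..\<tau>} (\<lambda>s. g s \<bullet> tail \<tau> x f s)) \<le> integral {0..\<tau>} (\<lambda>s. norm (g s) * ?M)"
  proof (rule integral_norm_bound_integral)
    show "(\<lambda>s. g s \<bullet> tail \<tau> x f s) integrable_on {0..\<tau>}"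
      using integrable_inner_tail[OF f g] L1_imp_integrable(1) by blast
    show "(\<lambda>s. norm (g s) * ?M) integrable_on {0..\<tau>}"
      using L1_imp_integrable(2)[OF g] by (rule integrable_on_mult_left)
    show "norm (g s \<bullet> tail \<tau> x f s) \<le> norm (g s) * ?M" for s
      unfolding real_norm_def
      by (rule order_trans[OF Cauchy_Schwarz_ineq2 mult_left_mono]) (auto intro: norm_tail_le f)
  qed
  ultimately have "\<bar>form \<tau> y g x f\<bar> \<le> norm y * ?M + integral {0..\<tau>} (\<lambda>s. norm (g s)) * ?M"
    unfolding form_def integral_mult_left by simp
  also have "\<dots> = K * (norm y + integral {0..\<tau>} (\<lambda>s. norm (g s))) * (norm x + integral {0..\<tau>} (\<lambda>s. norm (f s)))"
    by (simp add: algebra_simps)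
  finally show ?thesis .
qed

section \<open>Bilinearity and symmetry of the form\<close>

lemma head_add:
  assumes "f absolutely_integrable_on {0..\<tau>}" "f' absolutely_integrable_on {0..\<tau>}"
  shows "head \<tau> (x + x') (\<lambda>s. f s + f' s) = head \<tau> x f + head \<tau> x' f'"
  using integral_add[OF integrable_p(1)[OF assms(1)] integrable_p(1)[OF assms(2)], of \<tau> \<tau>]
  by (simp add: head_def matrix_vector_right_distrib)

lemma tail_add:
  assumes "f absolutely_integrable_on {0..\<tau>}" "f' absolutely_integrable_on {0..\<tau>}"
  shows "tail \<tau> (x + x') (\<lambda>s. f s + f' s) s = tail \<tau> x f s + tail \<tau> x' f' s"
  using integral_add[OF integrable_p(2)[OF assms(1)] integrable_p(2)[OF assms(2)], of s \<tau> s \<tau>]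
  by (simp add: tail_def matrix_vector_right_distrib)

lemma form_add_right:
  assumes "f absolutely_integrable_on {0..\<tau>}" "f' absolutely_integrable_on {0..\<tau>}"
    "g absolutely_integrable_on {0..\<tau>}"
  shows "form \<tau> y g (x + x') (\<lambda>s. f s + f' s) = form \<tau> y g x f + form \<tau> y g x' f'"
  using integral_add[OF integrable_inner_tail[THEN L1_imp_integrable(1), OF assms(1,3), of x]
      integrable_inner_tail[THEN L1_imp_integrable(1), OF assms(2,3), of x']]
  by (simp add: form_def head_add tail_add assms inner_add_right)

lemma form_add_left:
  assumes "f absolutely_integrable_on {0..\<tau>}" "g absolutely_integrable_on {0..\<tau>}"
    "g' absolutely_integrable_on {0..\<tau>}"
  shows "form \<tau> (y + y') (\<lambda>s. g s + g' s) x f = form \<tau> y g x f + form \<tau> y' g' x f"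
  using integral_add[OF integrable_inner_tail[THEN L1_imp_integrable(1), OF assms(1,2), of x]
      integrable_inner_tail[THEN L1_imp_integrable(1), OF assms(1,3), of x]]
  by (simp add: form_def inner_add_left)

text \<open>Written out, the two \<open>p1\<close> terms are visibly exchanged when the arguments
  are swapped, and on the diagonal they add up to the factor 2 of
  \<open>kernel_form\<close>.\<close>

lemma form_eq_sum:
  assumes f: "f absolutely_integrable_on {0..\<tau>}" and g: "g absolutely_integrable_on {0..\<tau>}"
  shows "form \<tau> y g x f = y \<bullet> (p0 \<tau> *v x) + y \<bullet> integral {0..\<tau>} (\<lambda>s. p1 s \<tau> *v f s)
    + x \<bullet> integral {0..\<tau>} (\<lambda>s. p1 s \<tau> *v g s)
    + integral {0..\<tau>} (\<lambda>s. g s \<bullet> integral {0..\<tau>} (\<lambda>\<nu>. p2 s \<nu> \<tau> *v f \<nu>))"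
proof -
  have c: "continuous_on {0..\<tau>} (\<lambda>s. transpose (p1 s \<tau>) *v x)" by (intro continuous_intros)
  have "continuous_on {0..\<tau>} (\<lambda>s. tail \<tau> 0 f s)" by (intro continuous_on_tail f)
  then have d: "continuous_on {0..\<tau>} (\<lambda>s. integral {0..\<tau>} (\<lambda>\<nu>. p2 s \<nu> \<tau> *v f \<nu>))" by (simp add: tail_def)
  have "integral {0..\<tau>} (\<lambda>s. g s \<bullet> tail \<tau> x f s) =
      integral {0..\<tau>} (\<lambda>s. g s \<bullet> (transpose (p1 s \<tau>) *v x))
      + integral {0..\<tau>} (\<lambda>s. g s \<bullet> integral {0..\<tau>} (\<lambda>\<nu>. p2 s \<nu> \<tau> *v f \<nu>))"
    unfolding tail_def inner_add_right
    by (intro integral_add L1_imp_integrable absolutely_integrable_inner_continuous c d g)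
  also have "(\<lambda>s. g s \<bullet> (transpose (p1 s \<tau>) *v x)) = (\<lambda>s. x \<bullet> (p1 s \<tau> *v g s))"
    by (simp add: inner_transpose_vector[symmetric] inner_commute)
  also have "integral {0..\<tau>} (\<lambda>s. x \<bullet> (p1 s \<tau> *v g s)) = x \<bullet> integral {0..\<tau>} (\<lambda>s. p1 s \<tau> *v g s)"
    using integral_linear[OF integrable_p(1)[OF g, of \<tau>] bounded_linear_inner_right[of x]] by (simp add: o_def)
  finally show ?thesis by (simp add: form_def head_def inner_add_right)
qed

text \<open>In the expanded form the \<open>p1\<close> terms trade places and the \<open>p0\<close>
  term is symmetric. For the double integral Fubini exchanges the variables, and the symmetry of
  \<open>p2\<close> restores the order of its arguments.\<close>

lemma form_sym:
  assumes f: "f absolutely_integrable_on {0..\<tau>}" and g: "g absolutely_integrable_on {0..\<tau>}"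
  shows "form \<tau> y g x f = form \<tau> x f y g"
proof -
  have pull: "h s \<bullet> integral {0..\<tau>} (\<lambda>\<nu>. p2 s \<nu> \<tau> *v k \<nu>) = integral {0..\<tau>} (\<lambda>\<nu>. h s \<bullet> (p2 s \<nu> \<tau> *v k \<nu>))"
    if "k absolutely_integrable_on {0..\<tau>}" for h k s
    using integral_linear[OF integrable_p(2)[OF that, of s \<tau>] bounded_linear_inner_right[of "h s"]] by (simp add: o_def)
  have meas: "k \<in> borel_measurable (lebesgue_on {0..\<tau>})" if "k absolutely_integrable_on {0..\<tau>}" for k :: "real \<Rightarrow> real^'d"
    using that absolutely_integrable_measurable[of "{0..\<tau>}" k] by simp
  have "integral {0..\<tau>} (\<lambda>s. integral {0..\<tau>} (\<lambda>\<nu>. g s \<bullet> (p2 s \<nu> \<tau> *v f \<nu>))) =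
        integral {0..\<tau>} (\<lambda>\<nu>. integral {0..\<tau>} (\<lambda>s. g s \<bullet> (p2 s \<nu> \<tau> *v f \<nu>)))"
  proof (rule integral_fubini_real(1))
    let ?M = "lebesgue_on {0..\<tau>}"
    have [measurable]: "f \<in> borel_measurable ?M" "g \<in> borel_measurable ?M" by (intro meas f g)+
    have [measurable]: "(\<lambda>x. x) \<in> measurable ?M borel" using id_borel_measurable_lebesgue_on[of "{0..\<tau>}"] by (simp add: id_def)
    \<comment> \<open>Joint measurability is built by composition: the continuous kernel after the
      pair of coordinates, followed by the continuous matrix product with \<open>f\<close>.\<close>
    have "continuous_on UNIV (\<lambda>z. p2 (fst z) (snd z) \<tau>)" by (intro continuous_intros)
    then have P: "(\<lambda>z. p2 (fst z) (snd z) \<tau>) \<in> borel_measurable borel" by (rule borel_measurable_continuous_onI)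
    have "(\<lambda>z. (fst z, snd z)) \<in> measurable (?M \<Otimes>\<^sub>M ?M) (borel \<Otimes>\<^sub>M borel)"
      by measurable
    then have "(\<lambda>z. (fst z, snd z)) \<in> measurable (?M \<Otimes>\<^sub>M ?M) (borel :: (real \<times> real) measure)" by (simp add: borel_prod)
    from measurable_compose[OF this P]
    have M1: "(\<lambda>z. p2 (fst z) (snd z) \<tau>) \<in> borel_measurable (?M \<Otimes>\<^sub>M ?M)" by simp
    have M2: "(\<lambda>z. f (snd z)) \<in> borel_measurable (?M \<Otimes>\<^sub>M ?M)" by measurable
    have "continuous_on UNIV (\<lambda>z :: (real^'d^'d) \<times> (real^'d). fst z *v snd z)" by (intro continuous_intros)
    from borel_measurable_continuous_Pair[OF M1 M2 this]
    have [measurable]: "(\<lambda>z. p2 (fst z) (snd z) \<tau> *v f (snd z)) \<in> borel_measurable (?M \<Otimes>\<^sub>M ?M)" by simp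
    show "(\<lambda>(s, \<nu>). g s \<bullet> (p2 s \<nu> \<tau> *v f \<nu>)) \<in> borel_measurable (?M \<Otimes>\<^sub>M ?M)"
      unfolding case_prod_beta by measurable
    show "\<bar>g s \<bullet> (p2 s \<nu> \<tau> *v f \<nu>)\<bar> \<le> norm (g s) * (K * norm (f \<nu>))" for s \<nu>
      by (rule order_trans[OF Cauchy_Schwarz_ineq2 mult_left_mono]) (auto intro: norm_mult_le)
    show "(\<lambda>s. norm (g s)) absolutely_integrable_on {0..\<tau>}" using g by (rule set_integrable_norm)
    show "(\<lambda>s. K * norm (f s)) absolutely_integrable_on {0..\<tau>}"
      by (rule set_integrable_mult_right) (rule set_integrable_norm[OF f])
  qed
  also have "\<dots> = integral {0..\<tau>} (\<lambda>\<nu>. integral {0..\<tau>} (\<lambda>s. f \<nu> \<bullet> (p2 \<nu> s \<tau> *v g s)))"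
    using inner_transpose_vector[of "p2 _ _ \<tau>" "g _" "f _"] by (simp add: sym_p2 inner_commute)
  finally have "integral {0..\<tau>} (\<lambda>s. g s \<bullet> integral {0..\<tau>} (\<lambda>\<nu>. p2 s \<nu> \<tau> *v f \<nu>)) =
      integral {0..\<tau>} (\<lambda>s. f s \<bullet> integral {0..\<tau>} (\<lambda>\<nu>. p2 s \<nu> \<tau> *v g \<nu>))"
    by (simp add: pull[OF f, of g] pull[OF g, of f])
  moreover have "y \<bullet> (p0 \<tau> *v x) = x \<bullet> (p0 \<tau> *v y)"
    using inner_transpose_vector[of "p0 \<tau>" y x] by (simp add: sym_p0 inner_commute)
  ultimately show ?thesis by (simp add: form_eq_sum f g)
qed

text \<open>Besides the continuity of the value itself, the case y = 0 with a derivative in place of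
  \<open>g\<close> yields the continuity of the history term of \<open>value_rate\<close>.\<close>

lemma continuous_on_form:
  assumes f: "f absolutely_integrable_on {0..T}" and g: "g absolutely_integrable_on {0..T}"
  shows "continuous_on {..T} (\<lambda>\<tau>. form \<tau> y g x f)"
proof -
  let ?I = "integral {0..T} (\<lambda>s. norm (f s))"
  have fs: "f absolutely_integrable_on {0..\<tau>}" and gs: "g absolutely_integrable_on {0..\<tau>}" if "\<tau> \<le> T" for \<tau>
    using that by (auto intro: L1_subinterval[OF f] L1_subinterval[OF g])
  have "continuous_on {..T} (\<lambda>\<tau>. integral {0..\<tau>} (\<lambda>s. g s \<bullet> tail \<tau> x f s))"
  proof (rule continuous_on_integral_initial[where T = T])
    show "(\<lambda>s. norm (g s) * (K * (norm x + ?I))) integrable_on {0..T}"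
      using L1_imp_integrable(2)[OF g] by (rule integrable_on_mult_left)
    show "(\<lambda>s. g s \<bullet> tail \<tau> x f s) integrable_on {0..\<tau>}" if "\<tau> \<in> {..T}" for \<tau>
      using that by (intro L1_imp_integrable integrable_inner_tail fs gs) auto
    show "norm (g s \<bullet> tail \<tau> x f s) \<le> norm (g s) * (K * (norm x + ?I))" if "\<tau> \<in> {..T}" for \<tau> s
    proof -
      have "integral {0..\<tau>} (\<lambda>s. norm (f s)) \<le> ?I"
        by (rule integral_subset_le) (use that f fs in \<open>auto intro: L1_imp_integrable\<close>)
      then have "norm (tail \<tau> x f s) \<le> K * (norm x + ?I)"
        using that by (intro order_trans[OF norm_tail_le[OF fs] mult_left_mono[OF _ K_nonneg]]) auto
      then show ?thesis
        unfolding real_norm_def by (intro order_trans[OF Cauchy_Schwarz_ineq2 mult_left_mono]) auto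
    qed
    show "continuous_on {..T} (\<lambda>\<tau>. g s \<bullet> tail \<tau> x f s)" for s
    proof -
      have "continuous_on {..T} (\<lambda>\<tau>. (\<lambda>(s, \<tau>). tail \<tau> x f s) (s, \<tau>))"
        by (rule continuous_on_compose2[OF continuous_on_tail_joint[OF f]]) (auto intro!: continuous_intros)
      then show ?thesis by (intro continuous_intros) simp
    qed
  qed auto
  then show ?thesis unfolding form_def by (intro continuous_intros continuous_on_head f)
qed

end

section \<open>The controlled Volterra equation\<close>

text \<open>The past \<open>f\<close> followed by the trajectory \<open>w\<close>, in natural time.
  At the junction the value of \<open>w\<close> counts, a convention that integrals do not
  see.\<close>

definition glue :: "real \<Rightarrow> (real \<Rightarrow> 'a) \<Rightarrow> (real \<Rightarrow> 'a) \<Rightarrow> real \<Rightarrow> 'a" where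
  "glue \<tau> f w = (\<lambda>s. if s < \<tau> then f s else w s)"

lemma glue_simps [simp]: "s < \<tau> \<Longrightarrow> glue \<tau> f w s = f s" "\<tau> \<le> s \<Longrightarrow> glue \<tau> f w s = w s"
  by (simp_all add: glue_def)

lemma integral_spike_point:
  fixes f :: "real \<Rightarrow> 'a::euclidean_space"
  assumes "\<And>s. s \<in> S \<Longrightarrow> s \<noteq> c \<Longrightarrow> g s = f s"
  shows "integral S f = integral S g"
  by (rule integral_spike[of "{c}"]) (use assms in auto)

lemma absolutely_integrable_glue:
  fixes f w :: "real \<Rightarrow> 'a::euclidean_space"
  assumes "f absolutely_integrable_on {a..\<tau>}" "w absolutely_integrable_on {\<tau>..b}" "a \<le> \<tau>" "\<tau> \<le> b"
  shows "glue \<tau> f w absolutely_integrable_on {a..b}"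
proof (rule absolutely_integrable_on_combine[of a \<tau>])
  show "glue \<tau> f w absolutely_integrable_on {a..\<tau>}"
    by (rule absolutely_integrable_spike[OF assms(1), of "{\<tau>}"]) auto
  show "glue \<tau> f w absolutely_integrable_on {\<tau>..b}"
    by (rule absolutely_integrable_spike[OF assms(2), of "{}"]) auto
qed fact+

lemma L2_glue:
  assumes "f \<in> L2 a \<tau>" "w \<in> L2 \<tau> b" "a \<le> \<tau>" "\<tau> \<le> b"
  shows "glue \<tau> f w \<in> L2 a b"
proof -
  have "(\<lambda>t. (norm (glue \<tau> f w t))\<^sup>2) integrable_on {a..b}"
  proof (rule Henstock_Kurzweil_Integration.integrable_combine[of a \<tau>])
    show "(\<lambda>t. (norm (glue \<tau> f w t))\<^sup>2) integrable_on {a..\<tau>}"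
      by (rule integrable_spike_finite[of "{\<tau>}" _ _ "\<lambda>t. (norm (f t))\<^sup>2"]) (use assms in \<open>auto simp: L2_iff\<close>)
    show "(\<lambda>t. (norm (glue \<tau> f w t))\<^sup>2) integrable_on {\<tau>..b}"
      by (rule integrable_spike_finite[of "{}" _ _ "\<lambda>t. (norm (w t))\<^sup>2"]) (use assms in \<open>auto simp: L2_iff\<close>)
  qed fact+
  then show ?thesis using absolutely_integrable_glue[OF L2_imp_L1[OF assms(1)]
        L2_imp_L1[OF assms(2)] assms(3,4)] by (simp add: L2_iff)
qed

lemma L2_subset: "f \<in> L2 a b \<Longrightarrow> a \<le> c \<Longrightarrow> d \<le> b \<Longrightarrow> f \<in> L2 c d"
  unfolding L2_iff by (auto intro: L1_subinterval integrable_subinterval_real)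

locale volterra =
  fixes A :: "real^'d^'d" and B :: "real^'m^'d" and N :: "real \<Rightarrow> real^'d^'d" and M :: real
  assumes cont_N: "continuous_on UNIV N" and bound_N: "norm (N t) \<le> M"
begin

text \<open>The uncontrolled right-hand side, with both memory integrals of
  \<open>trajectory\<close> merged into one over the whole past; the initial time no longer occurs
  in it.\<close>

definition drift :: "(real \<Rightarrow> real^'d) \<Rightarrow> real \<Rightarrow> real^'d" where
  "drift q r = A *v q r + integral {0..r} (\<lambda>s. N (r - s) *v q s)"

lemma M_nonneg: "0 \<le> M"
  using bound_N norm_ge_zero order_trans by blast

lemma continuous_on_N [continuous_intros]: "continuous_on S a \<Longrightarrow> continuous_on S (\<lambda>x. N (a x))"
  using continuous_on_compose2[OF cont_N] by auto

lemma norm_N_mult_le: "norm (N t *v x) \<le> M * norm x"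
  using norm_matrix_vector_mult_le[of "N t" x] mult_right_mono[OF bound_N[of t], of "norm x"] by simp

lemma absolutely_integrable_N:
  assumes "q absolutely_integrable_on {a..b}"
  shows "(\<lambda>s. N (r - s) *v q s) absolutely_integrable_on {a..b}"
  by (intro absolutely_integrable_matrix_vector_mult assms continuous_intros)

lemma continuous_on_convolution:
  assumes q: "q absolutely_integrable_on {0..b}"
  shows "continuous_on {..b} (\<lambda>r. integral {0..r} (\<lambda>s. N (r - s) *v q s))"
proof (rule continuous_on_integral_initial[where T = b])
  show "(\<lambda>\<nu>. M * norm (q \<nu>)) integrable_on {0..b}"
    using L1_imp_integrable(2)[OF q] by (rule integrable_on_mult_right)
  show "(\<lambda>s. N (r - s) *v q s) integrable_on {0..r}" if "r \<in> {..b}" for r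
    using that by (intro L1_imp_integrable absolutely_integrable_N
        L1_subinterval[OF q]) auto
qed (auto intro!: norm_N_mult_le continuous_intros)

lemma continuous_on_drift:
  assumes "q absolutely_integrable_on {0..b}" "continuous_on {a..b} q"
  shows "continuous_on {a..b} (drift q)"
  unfolding drift_def
  by (intro continuous_intros assms continuous_on_subset[OF continuous_on_convolution[OF assms(1)]]) auto

lemma drift_cong: "(\<And>s. s \<in> {0..r} \<Longrightarrow> q s = q' s) \<Longrightarrow> 0 \<le> r \<Longrightarrow> drift q r = drift q' r"
  unfolding drift_def by (auto intro!: arg_cong2[where f = "(+)"] integral_cong)

text \<open>A Lipschitz estimate in the supremum norm; its constant times the length of a time
  interval is the contraction factor of the fixed point argument.\<close>

lemma norm_drift_diff_le:
  assumes "q absolutely_integrable_on {0..r}" "q' absolutely_integrable_on {0..r}" "0 \<le> r"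
    and d: "\<And>s. s \<in> {0..r} \<Longrightarrow> norm (q s - q' s) \<le> d"
  shows "norm (drift q r - drift q' r) \<le> (norm A + M * r) * d"
proof -
  note ints = assms(1,2)[THEN absolutely_integrable_N, THEN L1_imp_integrable(1)]
  have "drift q r - drift q' r = A *v (q r - q' r) + integral {0..r} (\<lambda>s. N (r - s) *v (q s - q' s))"
    unfolding drift_def matrix_vector_mult_diff_distrib
    by (subst integral_diff) (auto intro: ints simp: algebra_simps)
  moreover have "norm (A *v (q r - q' r)) \<le> norm A * d"
    using norm_matrix_vector_mult_le[of A "q r - q' r"] mult_left_mono[OF d, of r "norm A"] assms(3) by simp
  moreover have "norm (integral {0..r} (\<lambda>s. N (r - s) *v (q s - q' s))) \<le> integral {0..r} (\<lambda>s. M * d)"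
  proof (rule integral_norm_bound_integral)
    show "(\<lambda>s. N (r - s) *v (q s - q' s)) integrable_on {0..r}"
      unfolding matrix_vector_mult_diff_distrib by (intro integrable_diff ints)
    show "norm (N (r - s) *v (q s - q' s)) \<le> M * d" if "s \<in> {0..r}" for s
      by (rule order_trans[OF norm_N_mult_le mult_left_mono[OF d[OF that] M_nonneg]])
  qed auto
  ultimately have "norm (drift q r - drift q' r) \<le> norm A * d + integral {0..r} (\<lambda>s. M * d)"
    by (simp only: norm_triangle_mono)
  then show ?thesis using \<open>0 \<le> r\<close> by (simp add: algebra_simps)
qed

text \<open>History and trajectory enter the memory term in the same way, so the glued function
  carries it alone. Restarting and concatenating become identities between glued functions.\<close>

lemma trajectory_iff:
  assumes f: "f absolutely_integrable_on {0..\<tau>}" and "0 \<le> \<tau>"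
  shows "trajectory b A B N \<tau> (x, f) u w \<longleftrightarrow> continuous_on {\<tau>..b} w \<and>
    (\<forall>t\<in>{\<tau>..b}. w t = x + integral {\<tau>..t} (\<lambda>r. drift (glue \<tau> f w) r + B *v u r))"
proof -
  have "A *v w r + integral {\<tau>..r} (\<lambda>s. N (r - s) *v w s) + B *v u r + integral {0..\<tau>} (\<lambda>s. N (r - s) *v f s)
      = drift (glue \<tau> f w) r + B *v u r"
    if w: "continuous_on {\<tau>..b} w" and r: "\<tau> \<le> r" "r \<le> b" for r
  proof -
    have "glue \<tau> f w absolutely_integrable_on {0..r}"
      by (intro absolutely_integrable_glue f absolutely_integrable_continuous_real continuous_on_subset[OF w])
         (use r assms in auto)
    then have "integral {0..r} (\<lambda>s. N (r - s) *v glue \<tau> f w s) =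
        integral {0..\<tau>} (\<lambda>s. N (r - s) *v glue \<tau> f w s) + integral {\<tau>..r} (\<lambda>s. N (r - s) *v glue \<tau> f w s)"
      using r assms by (intro integral_split[symmetric]
          L1_imp_integrable absolutely_integrable_N) auto
    moreover have "integral {0..\<tau>} (\<lambda>s. N (r - s) *v glue \<tau> f w s) = integral {0..\<tau>} (\<lambda>s. N (r - s) *v f s)"
      by (rule integral_spike_point[of _ \<tau>]) auto
    moreover have "integral {\<tau>..r} (\<lambda>s. N (r - s) *v glue \<tau> f w s) = integral {\<tau>..r} (\<lambda>s. N (r - s) *v w s)"
      by (rule integral_cong) auto
    ultimately show ?thesis using r by (simp add: drift_def)
  qed
  then have "integral {\<tau>..t} (\<lambda>r. A *v w r + integral {\<tau>..r} (\<lambda>s. N (r - s) *v w s) + B *v u r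
        + integral {0..\<tau>} (\<lambda>s. N (r - s) *v f s))
      = integral {\<tau>..t} (\<lambda>r. drift (glue \<tau> f w) r + B *v u r)"
    if "continuous_on {\<tau>..b} w" "t \<in> {\<tau>..b}" for t
    by (intro integral_cong) (use that in auto)
  then show ?thesis unfolding trajectory_def by auto
qed

lemma integrable_drift_plus:
  assumes f: "f absolutely_integrable_on {0..\<tau>}" and "0 \<le> \<tau>"
    and u: "u absolutely_integrable_on {\<tau>..b}" and w: "continuous_on {\<tau>..b} w"
    and c: "\<tau> \<le> c" "d \<le> b"
  shows "(\<lambda>r. drift (glue \<tau> f w) r + B *v u r) integrable_on {c..d}"
proof (cases "\<tau> \<le> b")
  case True
  have g: "glue \<tau> f w absolutely_integrable_on {0..b}"
    by (intro absolutely_integrable_glue f absolutely_integrable_continuous_real w) (use assms True in auto)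
  have "continuous_on {\<tau>..b} (glue \<tau> f w)" by (rule continuous_on_eq[OF w]) auto
  then have "continuous_on {\<tau>..b} (drift (glue \<tau> f w))" by (rule continuous_on_drift[OF g])
  then have "(\<lambda>r. drift (glue \<tau> f w) r + B *v u r) integrable_on {\<tau>..b}"
    by (intro integrable_add integrable_continuous_real L1_imp_integrable(1)
        absolutely_integrable_matrix_vector_mult u continuous_intros)
  then show ?thesis by (rule integrable_subinterval_real) (use c in auto)
qed (use c in \<open>auto intro: integrable_on_empty\<close>)

section \<open>Restarting and concatenating trajectories\<close>

lemma glue_glue: "\<tau> \<le> \<sigma> \<Longrightarrow> glue \<sigma> (glue \<tau> f w) w' = glue \<tau> f (glue \<sigma> w w')"
  by (auto simp: glue_def fun_eq_iff)

lemma glue_same: "\<tau> \<le> \<sigma> \<Longrightarrow> glue \<sigma> (glue \<tau> f w) w = glue \<tau> f w"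
  by (auto simp: glue_def fun_eq_iff)

lemma trajectory_initial: "trajectory b A B N \<tau> (x, f) u w \<Longrightarrow> \<tau> \<le> b \<Longrightarrow> w \<tau> = x"
  by (simp add: trajectory_def)

lemma absolutely_integrable_glue_trajectory:
  assumes "f absolutely_integrable_on {0..\<tau>}" "0 \<le> \<tau>" "\<tau> \<le> b" "trajectory b A B N \<tau> (x, f) u w"
  shows "glue \<tau> f w absolutely_integrable_on {0..b}"
proof -
  have "continuous_on {\<tau>..b} w" using assms(4) by (simp add: trajectory_def)
  then show ?thesis
    by (intro absolutely_integrable_glue absolutely_integrable_continuous_real assms)
qed

text \<open>For the restart, the glued function is the same whether the past ends at
  \<open>\<tau>\<close> or at \<open>\<sigma>\<close>; it remains to subtract the integrated
  equation at \<open>\<sigma>\<close> from the one at \<open>t\<close>.\<close>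

lemma trajectory_restrict:
  assumes f: "f absolutely_integrable_on {0..\<tau>}" and \<sigma>: "0 \<le> \<tau>" "\<tau> \<le> \<sigma>" "\<sigma> \<le> b"
    and u: "u absolutely_integrable_on {\<tau>..b}" and w: "trajectory b A B N \<tau> (x, f) u w"
  shows "trajectory \<sigma> A B N \<tau> (x, f) u w"
    and "trajectory b A B N \<sigma> (w \<sigma>, glue \<tau> f w) u w"
proof -
  have c: "continuous_on {\<tau>..b} w"
    and eq: "\<And>t. t \<in> {\<tau>..b} \<Longrightarrow> w t = x + integral {\<tau>..t} (\<lambda>r. drift (glue \<tau> f w) r + B *v u r)"
    using w by (auto simp: trajectory_iff[OF f \<sigma>(1)])
  show "trajectory \<sigma> A B N \<tau> (x, f) u w"
    unfolding trajectory_iff[OF f \<sigma>(1)]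
    using continuous_on_subset[OF c, of "{\<tau>..\<sigma>}"] \<sigma> by (auto intro: eq)
  have g: "glue \<tau> f w absolutely_integrable_on {0..\<sigma>}"
    using L1_subinterval[OF absolutely_integrable_glue_trajectory[OF f _ _ w]] \<sigma> by auto
  have eq': "w t = w \<sigma> + integral {\<sigma>..t} (\<lambda>r. drift (glue \<tau> f w) r + B *v u r)" if "t \<in> {\<sigma>..b}" for t
    using integral_split[of \<tau> \<sigma> t "\<lambda>r. drift (glue \<tau> f w) r + B *v u r"]
      integrable_drift_plus[OF f \<sigma>(1) u c, of \<tau> t] that \<sigma> eq[of t] eq[of \<sigma>] by (simp add: algebra_simps)
  then show "trajectory b A B N \<sigma> (w \<sigma>, glue \<tau> f w) u w"
    unfolding trajectory_iff[OF g order_trans[OF \<sigma>(1,2)]] glue_same[OF \<sigma>(2)]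
    by (intro conjI ballI eq' continuous_on_subset[OF c]) (use \<sigma> in auto)
qed

text \<open>By causality, \<open>drift\<close> at \<open>r\<close> looks only at times up to
  \<open>r\<close>, so the continuation does not disturb the equation before
  \<open>\<sigma>\<close>. After \<open>\<sigma>\<close> the equation of \<open>w2\<close> already
  refers to the glued history.\<close>

lemma trajectory_concat:
  assumes f: "f absolutely_integrable_on {0..\<tau>}" and \<sigma>: "0 \<le> \<tau>" "\<tau> \<le> \<sigma>" "\<sigma> \<le> b"
    and u1: "u1 absolutely_integrable_on {\<tau>..\<sigma>}" and u2: "u2 absolutely_integrable_on {\<sigma>..b}"
    and w1: "trajectory \<sigma> A B N \<tau> (x, f) u1 w1"
    and w2: "trajectory b A B N \<sigma> (w1 \<sigma>, glue \<tau> f w1) u2 w2"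
  shows "trajectory b A B N \<tau> (x, f) (glue \<sigma> u1 u2) (glue \<sigma> w1 w2)"
proof -
  let ?u = "glue \<sigma> u1 u2" and ?w = "glue \<sigma> w1 w2"
  have c1: "continuous_on {\<tau>..\<sigma>} w1"
    and eq1: "\<And>t. t \<in> {\<tau>..\<sigma>} \<Longrightarrow> w1 t = x + integral {\<tau>..t} (\<lambda>r. drift (glue \<tau> f w1) r + B *v u1 r)"
    using w1 by (auto simp: trajectory_iff[OF f \<sigma>(1)])
  have g: "glue \<tau> f w1 absolutely_integrable_on {0..\<sigma>}"
    by (rule absolutely_integrable_glue_trajectory[OF f \<sigma>(1,2) w1])
  have c2: "continuous_on {\<sigma>..b} w2"
    and eq2: "\<And>t. t \<in> {\<sigma>..b} \<Longrightarrow> w2 t = w1 \<sigma> + integral {\<sigma>..t} (\<lambda>r. drift (glue \<tau> f ?w) r + B *v u2 r)"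
    using w2 by (auto simp: trajectory_iff[OF g order_trans[OF \<sigma>(1,2)]] glue_glue[OF \<sigma>(2)])
  \<comment> \<open>The second piece starts where the first one ends, whence the concatenation is
    continuous.\<close>
  have init: "w2 \<sigma> = w1 \<sigma>" using trajectory_initial[OF w2] \<sigma> by simp
  have w1': "?w t = w1 t" if "t \<in> {\<tau>..\<sigma>}" for t using that init by (cases "t = \<sigma>") auto
  have cw: "continuous_on {\<tau>..b} ?w"
  proof -
    have "continuous_on {\<tau>..\<sigma>} ?w" by (rule continuous_on_eq[OF c1]) (simp add: w1')
    moreover have "continuous_on {\<sigma>..b} ?w" by (rule continuous_on_eq[OF c2]) simp
    ultimately have "continuous_on ({\<tau>..\<sigma>} \<union> {\<sigma>..b}) ?w" by (intro continuous_on_closed_Un) auto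
    then show ?thesis using ivl_disj_un_two_touch(4)[of \<tau> \<sigma> b] \<sigma> by simp
  qed
  have ui: "?u absolutely_integrable_on {\<tau>..b}" using \<sigma> by (intro absolutely_integrable_glue u1 u2) auto
  have low: "?w t = x + integral {\<tau>..t} (\<lambda>r. drift (glue \<tau> f ?w) r + B *v ?u r)" if t: "t \<in> {\<tau>..\<sigma>}" for t
  proof -
    have "integral {\<tau>..t} (\<lambda>r. drift (glue \<tau> f w1) r + B *v u1 r) = integral {\<tau>..t} (\<lambda>r. drift (glue \<tau> f ?w) r + B *v ?u r)"
    proof (rule integral_spike_point[of _ \<sigma>])
      fix r assume r: "r \<in> {\<tau>..t}" "r \<noteq> \<sigma>"
      then have "drift (glue \<tau> f ?w) r = drift (glue \<tau> f w1) r"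
        by (intro drift_cong) (use t \<sigma> in \<open>auto simp: glue_def\<close>)
      then show "drift (glue \<tau> f ?w) r + B *v ?u r = drift (glue \<tau> f w1) r + B *v u1 r" using r t by simp
    qed
    then show ?thesis using eq1[OF t] w1'[OF t] by simp
  qed
  have high: "?w t = x + integral {\<tau>..t} (\<lambda>r. drift (glue \<tau> f ?w) r + B *v ?u r)" if t: "t \<in> {\<sigma>..b}" for t
  proof -
    have "integral {\<sigma>..t} (\<lambda>r. drift (glue \<tau> f ?w) r + B *v u2 r) = integral {\<sigma>..t} (\<lambda>r. drift (glue \<tau> f ?w) r + B *v ?u r)"
      by (rule integral_cong) auto
    then have "?w t = ?w \<sigma> + integral {\<sigma>..t} (\<lambda>r. drift (glue \<tau> f ?w) r + B *v ?u r)"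
      using eq2[OF t] t init by simp
    then show ?thesis
      using integral_split[of \<tau> \<sigma> t "\<lambda>r. drift (glue \<tau> f ?w) r + B *v ?u r"]
        integrable_drift_plus[OF f \<sigma>(1) ui cw, of \<tau> t] low[of \<sigma>] t \<sigma> by (simp add: algebra_simps)
  qed
  show ?thesis
    unfolding trajectory_iff[OF f \<sigma>(1)]
  proof (intro conjI ballI cw)
    fix t assume "t \<in> {\<tau>..b}"
    then consider "t \<in> {\<tau>..\<sigma>}" | "t \<in> {\<sigma>..b}" by force
    then show "?w t = x + integral {\<tau>..t} (\<lambda>r. drift (glue \<tau> f ?w) r + B *v ?u r)"
      by cases (rule low, assumption, rule high, assumption)
  qed
qed

text \<open>Banach's fixed point theorem for bounded continuous functions, with a constant control.
  Both applications, to the comparison control just after \<open>\<tau>\<close> and to the zero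
  control just before \<open>T\<close>, concern short intervals. The contraction factor 1/2 also
  gives the bound: the norm of the fixed point is at most \<open>?R\<close> plus half of
  itself.\<close>

lemma local_existence:
  fixes x :: "real^'d" and v :: "real^'m"
  assumes f: "f absolutely_integrable_on {0..\<tau>}" and \<tau>: "0 \<le> \<tau>" "\<tau> \<le> b" "b \<le> T"
    and small: "(b - \<tau>) * (norm A + M * T) \<le> 1 / 2"
  obtains w where "trajectory b A B N \<tau> (x, f) (\<lambda>_. v) w"
    and "\<And>t. t \<in> {\<tau>..b} \<Longrightarrow> norm (w t) \<le> 2 * (norm x + T * (norm (B *v v) + M * integral {0..\<tau>} (\<lambda>s. norm (f s))))"
proof -
  let ?L = "norm A + M * T"
  let ?F = "\<lambda>q t. x + integral {\<tau>..t} (\<lambda>r. drift (glue \<tau> f q) r + B *v v)"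
  have L0: "0 \<le> ?L" using M_nonneg \<tau> by simp
  have gi: "glue \<tau> f (apply_bcontfun q) absolutely_integrable_on {0..r}" if "\<tau> \<le> r" for q :: "real \<Rightarrow>\<^sub>C (real^'d)" and r
    by (intro absolutely_integrable_glue f absolutely_integrable_continuous_real) (use that \<tau> in auto)
  have ii: "(\<lambda>r. drift (glue \<tau> f (apply_bcontfun q)) r + B *v v) integrable_on {\<tau>..t}" if "t \<le> b" for t and q :: "real \<Rightarrow>\<^sub>C (real^'d)"
    using integrable_drift_plus[OF f \<tau>(1), where u = "\<lambda>_. v" and b = b and w = "apply_bcontfun q" and c = \<tau> and d = t] that
    by (auto intro: absolutely_integrable_continuous_real)
  \<comment> \<open>The function space lives on the whole line, so the image of \<open>q\<close> is
    extended by clamping its argument to [\<tau>, b].\<close>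
  have "\<exists>g :: real \<Rightarrow>\<^sub>C (real^'d). (\<forall>t\<in>{\<tau>..b}. g t = ?F q t) \<and> (\<forall>t. g t = ?F q (clamp \<tau> b t))" for q :: "real \<Rightarrow>\<^sub>C (real^'d)"
  proof -
    have "continuous_on (cbox \<tau> b) (?F q)"
      using indefinite_integral_continuous_1[OF ii[of b q]] by (auto intro!: continuous_intros)
    then obtain g :: "real \<Rightarrow>\<^sub>C (real^'d)" where "\<And>t. t \<in> cbox \<tau> b \<Longrightarrow> g t = ?F q t" "\<And>t. g t = ?F q (clamp \<tau> b t)"
      by (rule continuous_on_cbox_bcontfunE) blast
    then show ?thesis by (intro exI[of _ g]) simp
  qed
  then obtain G :: "(real \<Rightarrow>\<^sub>C (real^'d)) \<Rightarrow> (real \<Rightarrow>\<^sub>C (real^'d))" where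
    G: "\<And>q t. t \<in> {\<tau>..b} \<Longrightarrow> G q t = ?F q t" and G': "\<And>q t. G q t = ?F q (clamp \<tau> b t)"
    by metis
  have clamp: "clamp \<tau> b t \<in> {\<tau>..b}" for t using clamp_in_interval[of \<tau> b t] \<tau> by simp
  have drift_le: "norm (drift (glue \<tau> f (apply_bcontfun q)) r - drift (glue \<tau> f (apply_bcontfun q')) r) \<le> ?L * dist q q'"
    if r: "r \<in> {\<tau>..b}" for q q' r
  proof -
    have "norm (drift (glue \<tau> f (apply_bcontfun q)) r - drift (glue \<tau> f (apply_bcontfun q')) r) \<le> (norm A + M * r) * dist q q'"
      by (rule norm_drift_diff_le) (use r \<tau> gi dist_bounded[of q _ q'] in \<open>auto simp: glue_def dist_norm\<close>)
    also have "\<dots> \<le> ?L * dist q q'" using r \<tau> M_nonneg by (intro mult_right_mono add_left_mono mult_left_mono) auto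
    finally show ?thesis .
  qed
  have "dist (G q) (G q') \<le> 1 / 2 * dist q q'" for q q'
  proof (rule dist_bound)
    fix t
    have le: "norm (?F q t' - ?F q' t') \<le> 1 / 2 * dist q q'" if t': "t' \<in> {\<tau>..b}" for t'
    proof -
      have "?F q t' - ?F q' t' = integral {\<tau>..t'} (\<lambda>r. (drift (glue \<tau> f q) r + B *v v) - (drift (glue \<tau> f q') r + B *v v))"
        using ii[of t' q] ii[of t' q'] t' by (subst integral_diff) auto
      also have "norm \<dots> \<le> integral {\<tau>..t'} (\<lambda>r. ?L * dist q q')"
        using ii[of t' q] ii[of t' q'] t' drift_le[of _ q q']
        by (intro integral_norm_bound_integral integrable_diff) auto
      also have "\<dots> = (t' - \<tau>) * (?L * dist q q')"
        by (subst integral_const_real) (use t' in simp)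
      also have "\<dots> \<le> (b - \<tau>) * (?L * dist q q')"
        using t' L0 by (intro mult_right_mono mult_nonneg_nonneg) auto
      also have "\<dots> = (b - \<tau>) * ?L * dist q q'" by (simp only: mult.assoc)
      also have "\<dots> \<le> 1 / 2 * dist q q'" using small by (intro mult_right_mono) auto
      finally show ?thesis .
    qed
    show "dist (G q t) (G q' t) \<le> 1 / 2 * dist q q'"
      using le[OF clamp, of t] by (simp add: G' dist_norm)
  qed
  then obtain q where q: "G q = q" using banach_fix_type[of "1/2" G] by auto
  have eq: "q t = ?F q t" if "t \<in> {\<tau>..b}" for t using G[OF that, of q] q by simp
  let ?I = "integral {0..\<tau>} (\<lambda>s. norm (f s))"
  have bd: "norm (drift (glue \<tau> f q) r + B *v v) \<le> ?L * norm q + (norm (B *v v) + M * ?I)" if r: "r \<in> {\<tau>..b}" for r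
  proof -
    \<comment> \<open>Comparison with the zero function isolates the contribution of the past
      \<open>f\<close>; the Lipschitz estimate covers the rest.\<close>
    have "drift (glue \<tau> f (apply_bcontfun 0)) r = integral {0..\<tau>} (\<lambda>s. N (r - s) *v f s)"
    proof -
      have "integral {0..r} (\<lambda>s. N (r - s) *v glue \<tau> f (apply_bcontfun 0) s) = integral {0..r} (\<lambda>s. if s \<le> \<tau> then N (r - s) *v f s else 0)"
        by (rule integral_spike_point[of _ \<tau>]) auto
      then show ?thesis using integral_initial_segment[of \<tau> r "\<lambda>s. N (r - s) *v f s"] r by (simp add: drift_def)
    qed
    moreover have "norm (integral {0..\<tau>} (\<lambda>s. N (r - s) *v f s)) \<le> integral {0..\<tau>} (\<lambda>s. M * norm (f s))"
      by (intro integral_norm_bound_integral norm_N_mult_le L1_imp_integrable(1)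
          absolutely_integrable_N f integrable_on_mult_right L1_imp_integrable(2))
    ultimately have "norm (drift (glue \<tau> f (apply_bcontfun 0)) r) \<le> M * ?I" by simp
    moreover have "norm (drift (glue \<tau> f q) r - drift (glue \<tau> f (apply_bcontfun 0)) r) \<le> ?L * norm q"
      using drift_le[OF r, of q 0] by simp
    ultimately show ?thesis
      using norm_triangle_ineq[of "drift (glue \<tau> f q) r" "B *v v"]
        norm_triangle_sub[of "drift (glue \<tau> f q) r" "drift (glue \<tau> f (apply_bcontfun 0)) r"] by linarith
  qed
  let ?R = "norm x + T * (norm (B *v v) + M * ?I)"
  have I0: "0 \<le> ?I" by (rule integral_nonneg) (auto intro: L1_imp_integrable f)
  have le: "norm (q t) \<le> ?R + 1 / 2 * norm q" if t: "t \<in> {\<tau>..b}" for t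
  proof -
    have "norm (integral {\<tau>..t} (\<lambda>r. drift (glue \<tau> f q) r + B *v v)) \<le> integral {\<tau>..t} (\<lambda>r. ?L * norm q + (norm (B *v v) + M * ?I))"
      using ii[of t q] bd t by (intro integral_norm_bound_integral) auto
    also have "\<dots> = (t - \<tau>) * (?L * norm q + (norm (B *v v) + M * ?I))" using t by simp
    also have "\<dots> \<le> (b - \<tau>) * (?L * norm q) + T * (norm (B *v v) + M * ?I)"
      unfolding distrib_left using t \<tau> L0 I0 M_nonneg by (intro add_mono mult_right_mono) auto
    also have "(b - \<tau>) * (?L * norm q) \<le> 1 / 2 * norm q"
      unfolding mult.assoc[symmetric] using small by (intro mult_right_mono) auto
    finally have "norm (integral {\<tau>..t} (\<lambda>r. drift (glue \<tau> f q) r + B *v v)) \<le> 1 / 2 * norm q + T * (norm (B *v v) + M * ?I)" by simp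
    then show ?thesis using eq[OF t] norm_triangle_ineq[of x "integral {\<tau>..t} (\<lambda>r. drift (glue \<tau> f q) r + B *v v)"] by simp
  qed
  have "norm q \<le> ?R + 1 / 2 * norm q"
  proof (rule norm_bound)
    fix t
    show "norm (apply_bcontfun q t) \<le> ?R + 1 / 2 * norm q"
      using G'[of q t] q eq[OF clamp, of t] le[OF clamp, of t] by simp
  qed
  then have "norm q \<le> 2 * ?R" by simp
  then have "norm (q t) \<le> 2 * ?R" for t using norm_bounded[of q t] by simp
  moreover have "trajectory b A B N \<tau> (x, f) (\<lambda>_. v) q"
    unfolding trajectory_iff[OF f \<tau>(1)] by (intro conjI ballI eq) auto
  ultimately show ?thesis using that by blast
qed

end

section \<open>Difference quotients of translations\<close>

text \<open>
  \<open>f\<close> is only absolutely continuous; by Fubini the difference quotient is moved from \<open>f\<close> onto the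
  continuous function \<open>v\<close>, where it becomes an average.
\<close>

lemma tendsto_integral_shift_difference:
  fixes f g :: "real \<Rightarrow> 'a::euclidean_space" and v :: "real \<Rightarrow> real \<Rightarrow> 'a"
  assumes f: "\<forall>t\<in>{0..T}. f t = f 0 + integral {0..t} g" and g: "g absolutely_integrable_on {0..T}"
    and v: "continuous_on (UNIV \<times> {..T}) (\<lambda>(s, \<sigma>). v s \<sigma>)"
    and V: "\<And>s \<sigma>. \<sigma> \<le> T \<Longrightarrow> norm (v s \<sigma>) \<le> V"
    and \<tau>: "0 < \<tau>" "\<tau> < T"
  shows "((\<lambda>\<sigma>. (1 / (\<sigma> - \<tau>)) * integral {\<sigma> - \<tau>..\<sigma>} (\<lambda>s. (f (s - (\<sigma> - \<tau>)) - f s) \<bullet> v s \<sigma>)) \<longlongrightarrow>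
    - integral {0..\<tau>} (\<lambda>r. g r \<bullet> v r \<tau>)) (at_right \<tau>)"
proof -
  \<comment> \<open>After the exchange of integrals, \<open>g r\<close> is counted for those s in
    [\<sigma> - \<tau>, \<sigma>] with s - (\<sigma> - \<tau>) <= r <= s; they form the interval of
    integration in \<open>W\<close>.\<close>
  define W where "W r \<sigma> = integral {max (\<sigma> - \<tau>) r..min \<sigma> (r + (\<sigma> - \<tau>))} (\<lambda>s. v s \<sigma>)" for r \<sigma>
  have V0: "0 \<le> V" using V[of T 0] norm_ge_zero order_trans by blast
  have cv: "continuous_on S (\<lambda>s. v s \<sigma>)" if "\<sigma> \<le> T" for S \<sigma>
    using continuous_on_compose2[OF v continuous_on_Pair[OF continuous_on_id continuous_on_const[of _ \<sigma>]], of S] that by auto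
  have iv: "(\<lambda>s. v s \<sigma>) integrable_on {a..b}" if "\<sigma> \<le> T" for a b \<sigma>
    by (intro integrable_continuous_real cv that)
  have Wle: "norm (W r \<sigma>) \<le> V * (\<sigma> - \<tau>)" if \<sigma>: "\<tau> \<le> \<sigma>" "\<sigma> \<le> T" for r \<sigma>
  proof (cases "max (\<sigma> - \<tau>) r \<le> min \<sigma> (r + (\<sigma> - \<tau>))")
    case True
    have "norm (W r \<sigma>) \<le> integral {max (\<sigma> - \<tau>) r..min \<sigma> (r + (\<sigma> - \<tau>))} (\<lambda>s. V)"
      unfolding W_def by (intro integral_norm_bound_integral iv V) (use \<sigma> in auto)
    also have "\<dots> = V * (min \<sigma> (r + (\<sigma> - \<tau>)) - max (\<sigma> - \<tau>) r)" using True by (simp add: mult.commute)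
    also have "\<dots> \<le> V * (\<sigma> - \<tau>)" using V0 by (intro mult_left_mono) auto
    finally show ?thesis .
  next
    case False
    then show ?thesis using V0 \<sigma> by (simp add: W_def)
  qed
  have swap: "integral {\<sigma> - \<tau>..\<sigma>} (\<lambda>s. (f s - f (s - (\<sigma> - \<tau>))) \<bullet> v s \<sigma>) = integral {0..T} (\<lambda>r. g r \<bullet> W r \<sigma>)"
    and int: "(\<lambda>r. g r \<bullet> W r \<sigma>) integrable_on {0..T}" if \<sigma>: "\<tau> \<le> \<sigma>" "\<sigma> \<le> T" for \<sigma>
  proof -
    let ?h = "\<sigma> - \<tau>" and ?M = "lebesgue_on {0..T}"
    define H where "H s r = (if ?h \<le> s \<and> s \<le> \<sigma> \<and> s - ?h \<le> r \<and> r \<le> s then g r \<bullet> v s \<sigma> else 0)" for s r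
    have [measurable]: "g \<in> borel_measurable ?M" using g absolutely_integrable_measurable[of "{0..T}" g] by simp
    have [measurable]: "(\<lambda>x. x) \<in> measurable ?M borel" using id_borel_measurable_lebesgue_on[of "{0..T}"] by (simp add: id_def)
    have [measurable]: "(\<lambda>s. v s \<sigma>) \<in> borel_measurable ?M"
      by (intro continuous_imp_measurable_on_sets_lebesgue cv \<sigma>) simp
    have meas: "(\<lambda>(s, r). H s r) \<in> borel_measurable (?M \<Otimes>\<^sub>M ?M)"
      unfolding H_def case_prod_beta by measurable
    have bound: "\<bar>H s r\<bar> \<le> V * norm (g r)" for s r
    proof -
      have "\<bar>g r \<bullet> v s \<sigma>\<bar> \<le> norm (g r) * V"
        by (rule order_trans[OF Cauchy_Schwarz_ineq2 mult_left_mono[OF V[OF \<sigma>(2)]]]) simp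
      then show ?thesis using V0 by (simp add: H_def mult.commute)
    qed
    have one: "(\<lambda>_. V) absolutely_integrable_on {0..T}" by (intro absolutely_integrable_continuous_real continuous_intros)
    note fub = integral_fubini_real[OF meas one set_integrable_norm[OF g] bound]
    have inner_s: "integral {0..T} (\<lambda>s. H s r) = g r \<bullet> W r \<sigma>" if r: "r \<in> {0..T}" for r
    proof -
      have "(\<lambda>s. H s r) = (\<lambda>s. if s \<in> {max ?h r..min \<sigma> (r + ?h)} then g r \<bullet> v s \<sigma> else 0)"
        by (auto simp: H_def fun_eq_iff)
      moreover have "{max ?h r..min \<sigma> (r + ?h)} \<inter> {0..T} = {max ?h r..min \<sigma> (r + ?h)}"
        using \<sigma> by auto
      ultimately have "integral {0..T} (\<lambda>s. H s r) = integral {max ?h r..min \<sigma> (r + ?h)} (\<lambda>s. g r \<bullet> v s \<sigma>)"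
        by (simp only: Henstock_Kurzweil_Integration.integral_restrict_Int)
      also have "\<dots> = g r \<bullet> W r \<sigma>"
        unfolding W_def using integral_linear[OF iv[OF \<sigma>(2)] bounded_linear_inner_right[of "g r"]] by (simp add: o_def)
      finally show ?thesis .
    qed
    have inner_r: "integral {0..T} (\<lambda>r. H s r) = (if s \<in> {?h..\<sigma>} then (f s - f (s - ?h)) \<bullet> v s \<sigma> else 0)"
      if s: "s \<in> {0..T}" for s
    proof (cases "s \<in> {?h..\<sigma>}")
      case True
      have gi: "g integrable_on {a..b}" if "0 \<le> a" "b \<le> T" for a b
        by (intro L1_imp_integrable(1) L1_subinterval[OF g] that)
      have "(\<lambda>r. H s r) = (\<lambda>r. if r \<in> {s - ?h..s} then g r \<bullet> v s \<sigma> else 0)"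
        using True by (auto simp: H_def fun_eq_iff)
      moreover have "{s - ?h..s} \<inter> {0..T} = {s - ?h..s}" using True s by auto
      ultimately have "integral {0..T} (\<lambda>r. H s r) = integral {s - ?h..s} (\<lambda>r. g r \<bullet> v s \<sigma>)"
        by (simp only: Henstock_Kurzweil_Integration.integral_restrict_Int)
      also have "\<dots> = integral {s - ?h..s} g \<bullet> v s \<sigma>"
        using integral_linear[OF gi bounded_linear_inner_left[of "v s \<sigma>"], of "s - ?h" s] True s by (simp add: o_def)
      also have "integral {s - ?h..s} g = f s - f (s - ?h)"
        using integral_split[of 0 "s - ?h" s g] gi[of 0 s] f[rule_format, of s] f[rule_format, of "s - ?h"] True s \<sigma>
        by (simp add: algebra_simps)
      finally show ?thesis using True by simp
    qed (auto simp: H_def intro!: integral_0)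
    have "integral {?h..\<sigma>} (\<lambda>s. (f s - f (s - ?h)) \<bullet> v s \<sigma>) =
        integral {0..T} (\<lambda>s. if s \<in> {?h..\<sigma>} then (f s - f (s - ?h)) \<bullet> v s \<sigma> else 0)"
    proof -
      have "{?h..\<sigma>} \<inter> {0..T} = {?h..\<sigma>}" using \<sigma> by auto
      then show ?thesis by (simp only: Henstock_Kurzweil_Integration.integral_restrict_Int)
    qed
    also have "\<dots> = integral {0..T} (\<lambda>s. integral {0..T} (\<lambda>r. H s r))"
      by (rule integral_cong) (simp add: inner_r)
    also have "\<dots> = integral {0..T} (\<lambda>r. integral {0..T} (\<lambda>s. H s r))"
      by (rule fub(1))
    also have "\<dots> = integral {0..T} (\<lambda>r. g r \<bullet> W r \<sigma>)"
      by (rule integral_cong) (rule inner_s)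
    finally show "integral {?h..\<sigma>} (\<lambda>s. (f s - f (s - ?h)) \<bullet> v s \<sigma>) = integral {0..T} (\<lambda>r. g r \<bullet> W r \<sigma>)" .
    show "(\<lambda>r. g r \<bullet> W r \<sigma>) integrable_on {0..T}"
      by (rule integrable_eq[OF fub(2)]) (simp_all add: inner_s)
  qed
  have "((\<lambda>\<sigma>. integral {0..T} (\<lambda>r. (1 / (\<sigma> - \<tau>)) * (g r \<bullet> W r \<sigma>))) \<longlongrightarrow>
      integral {0..T} (\<lambda>r. if r \<le> \<tau> then g r \<bullet> v r \<tau> else 0)) (at \<tau> within {\<tau>..T})"
  \<comment> \<open>The window has length at most \<sigma> - \<tau>, so \<open>V\<close> bounds the
    averages uniformly. The case distinction below leaves out r = 0 and r = \<tau>, a null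
    set.\<close>
  proof (rule tendsto_integral_within[where h = "\<lambda>r. norm (g r) * V" and N = "{0, \<tau>}"])
    show "(\<lambda>r. (1 / (\<sigma> - \<tau>)) * (g r \<bullet> W r \<sigma>)) integrable_on {0..T}" if "\<sigma> \<in> {\<tau>..T}" for \<sigma>
      using that by (intro integrable_on_mult_right int) auto
    show "(\<lambda>r. norm (g r) * V) integrable_on {0..T}"
      using L1_imp_integrable(2)[OF g] by (rule integrable_on_mult_left)
    show "norm (1 / (\<sigma> - \<tau>) * (g r \<bullet> W r \<sigma>)) \<le> norm (g r) * V" if \<sigma>: "\<sigma> \<in> {\<tau>..T}" for \<sigma> r
    proof (cases "\<sigma> = \<tau>")
      case False
      have "\<bar>g r \<bullet> W r \<sigma>\<bar> \<le> norm (g r) * (V * (\<sigma> - \<tau>))"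
        by (rule order_trans[OF Cauchy_Schwarz_ineq2 mult_left_mono[OF Wle]]) (use \<sigma> in auto)
      then show ?thesis using False \<sigma> by (simp add: abs_mult field_simps)
    qed (use V0 in auto)
    fix r assume r: "r \<in> {0..T}" "r \<notin> {0, \<tau>}"
    show "((\<lambda>\<sigma>. 1 / (\<sigma> - \<tau>) * (g r \<bullet> W r \<sigma>)) \<longlongrightarrow> (if r \<le> \<tau> then g r \<bullet> v r \<tau> else 0)) (at \<tau> within {\<tau>..T})"
      unfolding at_within_Icc_at_right[OF \<tau>(2)]
    \<comment> \<open>Inside the history the window is eventually all of
      [r, r + (\<sigma> - \<tau>)], so that \<open>W\<close> divided by \<sigma> - \<tau> is an
      average of \<open>v\<close>; beyond \<open>\<tau>\<close> the window is eventually
      empty.\<close>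
    proof (cases "r < \<tau>")
      case True
      have "((\<lambda>\<sigma>. (1 / (\<sigma> - \<tau>)) *\<^sub>R integral {r..r + (\<sigma> - \<tau>)} (\<lambda>s. v s \<sigma>)) \<longlongrightarrow> v r \<tau>) (at_right \<tau>)"
      proof (rule tendsto_average)
        fix \<epsilon> :: real assume "\<epsilon> > 0"
        then obtain d where d: "d > 0" "\<And>z. z \<in> UNIV \<times> {..T} \<Longrightarrow> dist z (r, \<tau>) < d \<Longrightarrow> dist (case z of (s, \<sigma>) \<Rightarrow> v s \<sigma>) (v r \<tau>) < \<epsilon>"
          using v \<tau> unfolding continuous_on_iff by (force dest!: bspec[of _ _ "(r, \<tau>)"])
        show "\<exists>\<delta>>0. \<forall>\<sigma> s. \<tau> < \<sigma> \<and> \<sigma> < \<tau> + \<delta> \<and> r \<le> s \<and> s \<le> r + (\<sigma> - \<tau>) \<longrightarrow> norm (v s \<sigma> - v r \<tau>) \<le> \<epsilon>"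
        proof (intro exI[of _ "min (d / 2) (T - \<tau>)"] conjI allI impI)
          fix \<sigma> s assume *: "\<tau> < \<sigma> \<and> \<sigma> < \<tau> + min (d / 2) (T - \<tau>) \<and> r \<le> s \<and> s \<le> r + (\<sigma> - \<tau>)"
          then have "\<sigma> - \<tau> < d / 2" using min.cobounded1[of "d / 2" "T - \<tau>"] by linarith
          then have "s - r + (\<sigma> - \<tau>) < d" using * by linarith
          with * have "dist (s, \<sigma>) (r, \<tau>) < d"
            using sqrt_sum_squares_le_sum_abs[of "s - r" "\<sigma> - \<tau>"] by (simp add: dist_prod_def dist_real_def)
          then show "norm (v s \<sigma> - v r \<tau>) \<le> \<epsilon>" using d(2)[of "(s, \<sigma>)"] * by (auto simp: dist_norm min_def split: if_splits)
        qed (use d \<tau> in auto)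
      next
        show "\<forall>\<^sub>F \<sigma> in at_right \<tau>. (\<lambda>s. v s \<sigma>) integrable_on {r..r + (\<sigma> - \<tau>)}"
          using eventually_at_right_real[OF \<tau>(2)] by eventually_elim (simp add: iv)
      qed
      from tendsto_inner[OF tendsto_const[of "g r"] this]
      have "((\<lambda>\<sigma>. g r \<bullet> ((1 / (\<sigma> - \<tau>)) *\<^sub>R integral {r..r + (\<sigma> - \<tau>)} (\<lambda>s. v s \<sigma>))) \<longlongrightarrow> g r \<bullet> v r \<tau>) (at_right \<tau>)" .
      moreover have "\<forall>\<^sub>F \<sigma> in at_right \<tau>. g r \<bullet> ((1 / (\<sigma> - \<tau>)) *\<^sub>R integral {r..r + (\<sigma> - \<tau>)} (\<lambda>s. v s \<sigma>)) = 1 / (\<sigma> - \<tau>) * (g r \<bullet> W r \<sigma>)"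
      proof (rule eventually_mono[OF eventually_at_right_real[of \<tau> "\<tau> + r"]])
        fix \<sigma> assume "\<sigma> \<in> {\<tau><..<\<tau> + r}"
        then have "max (\<sigma> - \<tau>) r = r" "min \<sigma> (r + (\<sigma> - \<tau>)) = r + (\<sigma> - \<tau>)" using True by auto
        then show "g r \<bullet> ((1 / (\<sigma> - \<tau>)) *\<^sub>R integral {r..r + (\<sigma> - \<tau>)} (\<lambda>s. v s \<sigma>)) = 1 / (\<sigma> - \<tau>) * (g r \<bullet> W r \<sigma>)"
          by (simp add: W_def)
      qed (use r in auto)
      ultimately show "((\<lambda>\<sigma>. 1 / (\<sigma> - \<tau>) * (g r \<bullet> W r \<sigma>)) \<longlongrightarrow> (if r \<le> \<tau> then g r \<bullet> v r \<tau> else 0)) (at_right \<tau>)"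
        using True by (simp add: Lim_transform_eventually)
    next
      case False
      then have r': "\<tau> < r" using r by auto
      have "\<forall>\<^sub>F \<sigma> in at_right \<tau>. 0 = 1 / (\<sigma> - \<tau>) * (g r \<bullet> W r \<sigma>)"
        using eventually_at_right_real[OF r'] by eventually_elim (auto simp: W_def)
      then show "((\<lambda>\<sigma>. 1 / (\<sigma> - \<tau>) * (g r \<bullet> W r \<sigma>)) \<longlongrightarrow> (if r \<le> \<tau> then g r \<bullet> v r \<tau> else 0)) (at_right \<tau>)"
        using r' by (auto intro: Lim_transform_eventually[OF tendsto_const])
    qed
  qed auto
  then have "((\<lambda>\<sigma>. - integral {0..T} (\<lambda>r. (1 / (\<sigma> - \<tau>)) * (g r \<bullet> W r \<sigma>))) \<longlongrightarrow> - integral {0..\<tau>} (\<lambda>r. g r \<bullet> v r \<tau>)) (at_right \<tau>)"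
    unfolding at_within_Icc_at_right[OF \<tau>(2)] using integral_initial_segment[of \<tau> T "\<lambda>r. g r \<bullet> v r \<tau>"] \<tau>
    by (intro tendsto_minus) simp
  moreover have "\<forall>\<^sub>F \<sigma> in at_right \<tau>. - integral {0..T} (\<lambda>r. (1 / (\<sigma> - \<tau>)) * (g r \<bullet> W r \<sigma>)) =
      (1 / (\<sigma> - \<tau>)) * integral {\<sigma> - \<tau>..\<sigma>} (\<lambda>s. (f (s - (\<sigma> - \<tau>)) - f s) \<bullet> v s \<sigma>)"
    using eventually_at_right_real[OF \<tau>(2)]
  proof eventually_elim
    case (elim \<sigma>)
    have "integral {\<sigma> - \<tau>..\<sigma>} (\<lambda>s. (f (s - (\<sigma> - \<tau>)) - f s) \<bullet> v s \<sigma>) =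
        integral {\<sigma> - \<tau>..\<sigma>} (\<lambda>s. - ((f s - f (s - (\<sigma> - \<tau>))) \<bullet> v s \<sigma>))"
      by (simp add: inner_diff_left)
    then show ?case using swap[of \<sigma>] elim by simp
  qed
  ultimately show ?thesis by (rule Lim_transform_eventually)
qed

lemma continuous_on_indefinite:
  fixes f g :: "real \<Rightarrow> 'a::euclidean_space"
  assumes "\<forall>t\<in>{0..T}. f t = f 0 + integral {0..t} g" "g absolutely_integrable_on {0..T}"
  shows "continuous_on {0..T} f"
proof -
  have "continuous_on {0..T} (\<lambda>t. f 0 + integral {0..t} g)"
    by (intro continuous_intros indefinite_integral_continuous_1 L1_imp_integrable assms)
  then show ?thesis by (rule continuous_on_eq) (simp add: assms(1)[rule_format, symmetric])
qed

lemma tendsto_average_continuous: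
  fixes k :: "real \<Rightarrow> 'a::euclidean_space"
  assumes k: "continuous_on {\<tau>..b} k" and b: "\<tau> < b"
  shows "((\<lambda>\<sigma>. (1 / (\<sigma> - \<tau>)) *\<^sub>R integral {\<tau>..\<sigma>} k) \<longlongrightarrow> k \<tau>) (at_right \<tau>)"
proof -
  have "((\<lambda>\<sigma>. (1 / (\<sigma> - \<tau>)) *\<^sub>R integral {\<tau>..\<tau> + (\<sigma> - \<tau>)} k) \<longlongrightarrow> k \<tau>) (at_right \<tau>)"
  proof (rule tendsto_average)
    fix \<epsilon> :: real assume "\<epsilon> > 0"
    then obtain d where d: "d > 0" "\<And>s. s \<in> {\<tau>..b} \<Longrightarrow> dist s \<tau> \<le> d \<Longrightarrow> dist (k s) (k \<tau>) < \<epsilon>"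
      using continuous_onE[OF k, of \<tau> \<epsilon>] b by auto
    show "\<exists>\<delta>>0. \<forall>\<sigma> s. \<tau> < \<sigma> \<and> \<sigma> < \<tau> + \<delta> \<and> \<tau> \<le> s \<and> s \<le> \<tau> + (\<sigma> - \<tau>) \<longrightarrow> norm (k s - k \<tau>) \<le> \<epsilon>"
    proof (intro exI[of _ "min d (b - \<tau>)"] conjI allI impI)
      fix \<sigma> s assume *: "\<tau> < \<sigma> \<and> \<sigma> < \<tau> + min d (b - \<tau>) \<and> \<tau> \<le> s \<and> s \<le> \<tau> + (\<sigma> - \<tau>)"
      show "norm (k s - k \<tau>) \<le> \<epsilon>" using d(2)[of s] * by (auto simp: dist_norm min_def split: if_splits)
    qed (use d b in auto)
  next
    show "\<forall>\<^sub>F \<sigma> in at_right \<tau>. k integrable_on {\<tau>..\<tau> + (\<sigma> - \<tau>)}"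
      using eventually_at_right_real[OF b]
      by eventually_elim (auto intro!: integrable_continuous_real continuous_on_subset[OF k])
  qed
  then show ?thesis by simp
qed

section \<open>The value function along a fixed history\<close>

text \<open>
  Reversed history reached at time \<open>\<sigma>\<close> by the trajectory \<open>w\<close> that starts at \<open>\<tau>\<close> from the reversed history \<open>f\<close>,
  minus \<open>f\<close> itself.
\<close>

definition dev :: "(real \<Rightarrow> 'a::real_vector) \<Rightarrow> real \<Rightarrow> (real \<Rightarrow> 'a) \<Rightarrow> real \<Rightarrow> real \<Rightarrow> 'a" where
  "dev f \<tau> w \<sigma> s = glue \<tau> (\<lambda>s. f (\<tau> - s)) w (\<sigma> - s) - f s"

text \<open>
  Histories are reversed in time, as in the Riccati operator: \<open>p1 s \<tau>\<close> stands for \<open>P\<^sub>1 (\<tau> - s, \<tau>)\<close>,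
  extended continuously to all real arguments.
\<close>

locale riccati = kernels T K p0 p1 p2 + volterra A B N M
  for T K :: real
    and p0 :: "real \<Rightarrow> real^'d^'d"
    and p1 :: "real \<Rightarrow> real \<Rightarrow> real^'d^'d"
    and p2 :: "real \<Rightarrow> real \<Rightarrow> real \<Rightarrow> real^'d^'d"
    and A :: "real^'d^'d" and B :: "real^'m^'d" and N :: "real \<Rightarrow> real^'d^'d" and M :: real +
  fixes C :: "real^'d^'p"
  assumes min_form: "\<lbrakk>0 < \<tau>; \<tau> < T; f \<in> L2 0 \<tau>\<rbrakk> \<Longrightarrow>
    is_min_cost T A B C N \<tau> (x, \<lambda>s. f (\<tau> - s)) (form \<tau> x f x f)"
begin

text \<open>The minimal cost as a function of the history in natural time.\<close>

definition Q :: "real \<Rightarrow> real^'d \<Rightarrow> (real \<Rightarrow> real^'d) \<Rightarrow> real" where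
  "Q \<tau> x h = form \<tau> x (\<lambda>s. h (\<tau> - s)) x (\<lambda>s. h (\<tau> - s))"

lemma min_Q:
  assumes "0 < \<tau>" "\<tau> < T" "h \<in> L2 0 \<tau>"
  shows "is_min_cost T A B C N \<tau> (x, h) (Q \<tau> x h)"
  using min_form[OF assms(1,2) L2_reflect[OF assms(3)], of x] by (simp add: Q_def)

section \<open>Dynamic programming\<close>

lemma cost_nonneg: "0 \<le> cost T C \<tau> u w"
  unfolding cost_def by (cases "(\<lambda>t. (norm (C *v w t))\<^sup>2 + (norm (u t))\<^sup>2) integrable_on {\<tau>..T}")
    (auto intro: integral_nonneg simp: not_integrable_integral)

text \<open>The minimum is attained, so the value of the form is the cost of some control.\<close>

lemma form_nonneg:
  assumes "0 < \<tau>" "\<tau> < T" "f \<in> L2 0 \<tau>"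
  shows "0 \<le> form \<tau> x f x f"
  using min_form[OF assms, of x] cost_nonneg unfolding is_min_cost_def by metis

lemma integrable_running_cost:
  assumes "u \<in> L2 a b" "continuous_on {a..b} w"
  shows "(\<lambda>t. (norm (C *v w t))\<^sup>2 + (norm (u t))\<^sup>2) integrable_on {a..b}"
proof (rule integrable_add)
  show "(\<lambda>t. (norm (C *v w t))\<^sup>2) integrable_on {a..b}"
    by (intro integrable_continuous_real continuous_intros assms)
  show "(\<lambda>t. (norm (u t))\<^sup>2) integrable_on {a..b}" using assms by (simp add: L2_iff)
qed

lemma trajectory_continuous: "trajectory b A B N \<tau> X u w \<Longrightarrow> continuous_on {\<tau>..b} w"
  by (simp add: trajectory_def)

text \<open>One optimal pair serves every \<open>\<sigma>\<close>: its remainder is admissible for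
  the problem restarted at \<open>\<sigma>\<close> and costs at least the minimum there. Having the
  same \<open>u\<close> and \<open>w\<close> for all \<open>\<sigma>\<close> makes a limit
  possible.\<close>

lemma dynamic_programming_ge:
  assumes \<tau>: "0 < \<tau>" "\<tau> < T" and h: "h \<in> L2 0 \<tau>"
  obtains u w where "u \<in> L2 \<tau> T" "trajectory T A B N \<tau> (x, h) u w"
    "\<And>\<sigma>. \<tau> < \<sigma> \<Longrightarrow> \<sigma> < T \<Longrightarrow>
      integral {\<tau>..\<sigma>} (\<lambda>t. (norm (C *v w t))\<^sup>2 + (norm (u t))\<^sup>2) + Q \<sigma> (w \<sigma>) (glue \<tau> h w) \<le> Q \<tau> x h"
proof -
  obtain u w where u: "u \<in> L2 \<tau> T" and w: "trajectory T A B N \<tau> (x, h) u w" and c: "cost T C \<tau> u w = Q \<tau> x h"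
    using min_Q[OF \<tau> h, of x] unfolding is_min_cost_def by metis
  note cw = trajectory_continuous[OF w]
  have "integral {\<tau>..\<sigma>} (\<lambda>t. (norm (C *v w t))\<^sup>2 + (norm (u t))\<^sup>2) + Q \<sigma> (w \<sigma>) (glue \<tau> h w) \<le> Q \<tau> x h"
    if \<sigma>: "\<tau> < \<sigma>" "\<sigma> < T" for \<sigma>
  proof -
    have g: "glue \<tau> h w \<in> L2 0 \<sigma>"
      by (intro L2_glue h continuous_imp_L2 continuous_on_subset[OF cw]) (use \<sigma> \<tau> in auto)
    have "trajectory T A B N \<sigma> (w \<sigma>, glue \<tau> h w) u w"
      by (rule trajectory_restrict(2)[OF _ _ _ _ _ w]) (use \<sigma> \<tau> h u in \<open>auto intro: L2_imp_L1\<close>)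
    moreover have "u \<in> L2 \<sigma> T" by (rule L2_subset[OF u]) (use \<sigma> in auto)
    ultimately have "Q \<sigma> (w \<sigma>) (glue \<tau> h w) \<le> cost T C \<sigma> u w"
      using min_Q[OF _ _ g, of "w \<sigma>"] \<sigma> \<tau> unfolding is_min_cost_def by simp
    then show ?thesis
      using integral_split[OF _ _ integrable_running_cost[OF u cw], of \<sigma>] \<sigma> c
      unfolding cost_def by simp
  qed
  then show ?thesis using that u w by blast
qed

text \<open>Any start up to \<open>\<sigma>\<close>, continued by an optimal pair from the state
  reached there, is admissible from \<open>\<tau>\<close>.\<close>

lemma dynamic_programming_le:
  assumes \<tau>: "0 < \<tau>" "\<tau> < \<sigma>" "\<sigma> < T" and h: "h \<in> L2 0 \<tau>"
    and u: "u \<in> L2 \<tau> \<sigma>" and w: "trajectory \<sigma> A B N \<tau> (x, h) u w"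
  shows "Q \<tau> x h \<le> integral {\<tau>..\<sigma>} (\<lambda>t. (norm (C *v w t))\<^sup>2 + (norm (u t))\<^sup>2) + Q \<sigma> (w \<sigma>) (glue \<tau> h w)"
proof -
  note cw = trajectory_continuous[OF w]
  have g: "glue \<tau> h w \<in> L2 0 \<sigma>"
    by (intro L2_glue h continuous_imp_L2 cw) (use \<tau> in auto)
  obtain u2 w2 where u2: "u2 \<in> L2 \<sigma> T" and w2: "trajectory T A B N \<sigma> (w \<sigma>, glue \<tau> h w) u2 w2"
    and c: "cost T C \<sigma> u2 w2 = Q \<sigma> (w \<sigma>) (glue \<tau> h w)"
    using min_Q[OF less_trans[OF \<tau>(1,2)] \<tau>(3) g, of "w \<sigma>"] unfolding is_min_cost_def by blast
  let ?u = "glue \<sigma> u u2" and ?w = "glue \<sigma> w w2"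
  have ut: "?u \<in> L2 \<tau> T" by (rule L2_glue[OF u u2]) (use \<tau> in auto)
  have wt: "trajectory T A B N \<tau> (x, h) ?u ?w"
    by (rule trajectory_concat[OF _ _ _ _ _ _ w w2])
       (use \<tau> h u u2 in \<open>auto intro: L2_imp_L1\<close>)
  have "Q \<tau> x h \<le> cost T C \<tau> ?u ?w"
    using min_Q[OF _ _ h, of x] \<tau> ut wt unfolding is_min_cost_def by simp
  also have "\<dots> = integral {\<tau>..\<sigma>} (\<lambda>t. (norm (C *v ?w t))\<^sup>2 + (norm (?u t))\<^sup>2)
      + integral {\<sigma>..T} (\<lambda>t. (norm (C *v ?w t))\<^sup>2 + (norm (?u t))\<^sup>2)"
    unfolding cost_def
    using integral_split[OF _ _ integrable_running_cost[OF ut trajectory_continuous[OF wt]], of \<sigma>] \<tau>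
    by simp
  also have "integral {\<tau>..\<sigma>} (\<lambda>t. (norm (C *v ?w t))\<^sup>2 + (norm (?u t))\<^sup>2) = integral {\<tau>..\<sigma>} (\<lambda>t. (norm (C *v w t))\<^sup>2 + (norm (u t))\<^sup>2)"
    by (rule integral_spike_point[of _ \<sigma>]) auto
  also have "integral {\<sigma>..T} (\<lambda>t. (norm (C *v ?w t))\<^sup>2 + (norm (?u t))\<^sup>2) = cost T C \<sigma> u2 w2"
    unfolding cost_def by (rule integral_cong) auto
  finally show ?thesis using c by simp
qed

text \<open>The derivative that the Riccati equation predicts for the diagonal form, with
  \<open>g\<close> as the derivative of \<open>f\<close>. The history term has the sign opposite to
  the drift term because the second component of the state operator is minus the derivative.\<close>

definition value_rate :: "(real \<Rightarrow> real^'d) \<Rightarrow> (real \<Rightarrow> real^'d) \<Rightarrow> real \<Rightarrow> real" where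
  "value_rate f g \<tau> = - (norm (C *v f 0))\<^sup>2
     - 2 * ((A *v f 0 + integral {0..\<tau>} (\<lambda>s. N s *v f s)) \<bullet> head \<tau> (f 0) f)
     + 2 * integral {0..\<tau>} (\<lambda>s. g s \<bullet> tail \<tau> (f 0) f s)
     + (norm (transpose B *v head \<tau> (f 0) f))\<^sup>2"

context
  fixes f g :: "real \<Rightarrow> real^'d"
  assumes f_eq: "\<forall>t\<in>{0..T}. f t = f 0 + integral {0..t} g"
    and g_int: "g absolutely_integrable_on {0..T}"
begin

lemma continuous_on_f: "continuous_on {0..T} f"
  by (rule continuous_on_indefinite[OF f_eq g_int])

lemma f_int: "a \<ge> 0 \<Longrightarrow> b \<le> T \<Longrightarrow> f absolutely_integrable_on {a..b}"
  by (intro absolutely_integrable_continuous_real continuous_on_subset[OF continuous_on_f]) auto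

lemma continuous_on_value_rate: "continuous_on {0..T} (value_rate f g)"
proof -
  have "continuous_on {0..T} (\<lambda>\<tau>. form \<tau> 0 g (f 0) f)"
    by (rule continuous_on_subset[OF continuous_on_form]) (use g_int f_int in auto)
  moreover have "continuous_on {0..T} (\<lambda>\<tau>. head \<tau> (f 0) f)"
    by (rule continuous_on_subset[OF continuous_on_head]) (use f_int in auto)
  moreover have "continuous_on {0..T} (\<lambda>\<tau>. integral {0..\<tau>} (\<lambda>s. N s *v f s))"
    by (intro indefinite_integral_continuous_1 integrable_continuous_real continuous_intros continuous_on_f)
  ultimately show ?thesis
    unfolding value_rate_def by (intro continuous_intros) (simp_all add: form_def)
qed

context
  fixes \<tau> b :: real and w :: "real \<Rightarrow> real^'d"
  assumes \<tau>: "0 < \<tau>" "\<tau> < b" "b \<le> T"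
    and w_cont: "continuous_on {\<tau>..b} w" and w_init: "w \<tau> = f 0"
begin

text \<open>The reversed history ends in \<open>f 0\<close> and the trajectory starts there. This
  matching reflects the condition in \<open>state_dom\<close> that the history at 0 is the
  finite-dimensional component.\<close>

lemma continuous_on_history: "continuous_on {0..b} (glue \<tau> (\<lambda>s. f (\<tau> - s)) w)"
proof -
  have "continuous_on {0..\<tau>} (\<lambda>s. f (\<tau> - s))"
    by (intro continuous_on_compose2[OF continuous_on_f] continuous_intros) (use \<tau> in auto)
  then have "continuous_on {0..\<tau>} (glue \<tau> (\<lambda>s. f (\<tau> - s)) w)"
    by (rule continuous_on_eq) (use w_init in \<open>auto simp: glue_def\<close>)
  moreover have "continuous_on {\<tau>..b} (glue \<tau> (\<lambda>s. f (\<tau> - s)) w)"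
    by (rule continuous_on_eq[OF w_cont]) auto
  ultimately have "continuous_on ({0..\<tau>} \<union> {\<tau>..b}) (glue \<tau> (\<lambda>s. f (\<tau> - s)) w)"
    by (intro continuous_on_closed_Un) auto
  then show ?thesis using ivl_disj_un_two_touch(4)[of 0 \<tau> b] \<tau> by simp
qed

section \<open>Deviation of the reached history from the given one\<close>

lemma continuous_on_dev: "\<sigma> \<le> b \<Longrightarrow> continuous_on {0..\<sigma>} (dev f \<tau> w \<sigma>)"
  unfolding dev_def
  by (intro continuous_intros continuous_on_compose2[OF continuous_on_history] continuous_on_subset[OF continuous_on_f])
     (use \<tau> in auto)

lemma dev_early: "\<tau> \<le> \<sigma> \<Longrightarrow> s \<le> \<sigma> - \<tau> \<Longrightarrow> dev f \<tau> w \<sigma> s = w (\<sigma> - s) - f s"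
  by (simp add: dev_def)

text \<open>Seen from \<open>\<sigma>\<close> in reversed time, the part of the history before
  \<open>\<tau>\<close> is a translate of \<open>f\<close>. At the common point s = \<sigma> -
  \<tau> this agrees with \<open>dev_early\<close>, since the trajectory starts at
  \<open>f 0\<close>.\<close>

lemma dev_late: "\<tau> \<le> \<sigma> \<Longrightarrow> \<sigma> - \<tau> \<le> s \<Longrightarrow> dev f \<tau> w \<sigma> s = f (s - (\<sigma> - \<tau>)) - f s"
  using w_init by (auto simp: dev_def glue_def algebra_simps)

text \<open>On the new piece both \<open>w (\<sigma> - s)\<close> and \<open>f s\<close> are close
  to \<open>f 0\<close>. The end point is written \<open>0 + (\<sigma> - \<tau>)\<close> to fit
  \<open>tendsto_average\<close> with base point 0.\<close>

lemma dev_small: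
  assumes "\<epsilon> > 0"
  shows "\<exists>\<delta>>0. \<forall>\<sigma> s. \<tau> < \<sigma> \<and> \<sigma> < \<tau> + \<delta> \<and> 0 \<le> s \<and> s \<le> 0 + (\<sigma> - \<tau>) \<longrightarrow> norm (dev f \<tau> w \<sigma> s) \<le> \<epsilon>"
proof -
  obtain d where d: "d > 0" "\<And>s. s \<in> {\<tau>..b} \<Longrightarrow> dist s \<tau> \<le> d \<Longrightarrow> dist (w s) (w \<tau>) < \<epsilon> / 2"
    using continuous_onE[OF w_cont, of \<tau> "\<epsilon> / 2"] \<tau> \<open>\<epsilon> > 0\<close> by auto
  obtain d' where d': "d' > 0" "\<And>s. s \<in> {0..T} \<Longrightarrow> dist s 0 \<le> d' \<Longrightarrow> dist (f s) (f 0) < \<epsilon> / 2"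
    using continuous_onE[OF continuous_on_f, of 0 "\<epsilon> / 2"] T_pos \<open>\<epsilon> > 0\<close> by auto
  show ?thesis
  proof (intro exI[of _ "min (min d d') (b - \<tau>)"] conjI allI impI)
    fix \<sigma> s assume *: "\<tau> < \<sigma> \<and> \<sigma> < \<tau> + min (min d d') (b - \<tau>) \<and> 0 \<le> s \<and> s \<le> 0 + (\<sigma> - \<tau>)"
    then have "dist (w (\<sigma> - s)) (f 0) < \<epsilon> / 2" "dist (f s) (f 0) < \<epsilon> / 2"
      using d(2)[of "\<sigma> - s"] d'(2)[of s] w_init \<tau> by (auto simp: dist_real_def min_def split: if_splits)
    then have "dist (w (\<sigma> - s)) (f s) \<le> \<epsilon>"
      using dist_triangle2[of "w (\<sigma> - s)" "f s" "f 0"] by simp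
    then show "norm (dev f \<tau> w \<sigma> s) \<le> \<epsilon>" using * by (simp add: dev_early dist_norm)
  qed (use d d' \<tau> in auto)
qed

lemma eventually_between: "\<forall>\<^sub>F \<sigma> in at_right \<tau>. \<tau> < \<sigma> \<and> \<sigma> < b"
  using eventually_at_right_real[OF \<tau>(2)] by eventually_elim simp

text \<open>The new piece has length \<sigma> - \<tau> and a uniformly small integrand, so it does
  not contribute to first order; what remains is a pure translation of \<open>f\<close>.\<close>

lemma tendsto_dev:
  fixes v :: "real \<Rightarrow> real \<Rightarrow> real^'d"
  assumes v: "continuous_on (UNIV \<times> {..T}) (\<lambda>(s, \<sigma>). v s \<sigma>)"
    and V: "\<And>s \<sigma>. \<sigma> \<le> T \<Longrightarrow> norm (v s \<sigma>) \<le> V"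
  shows "((\<lambda>\<sigma>. (1 / (\<sigma> - \<tau>)) * integral {0..\<sigma>} (\<lambda>s. dev f \<tau> w \<sigma> s \<bullet> v s \<sigma>)) \<longlongrightarrow>
    - integral {0..\<tau>} (\<lambda>r. g r \<bullet> v r \<tau>)) (at_right \<tau>)"
proof -
  have cv: "continuous_on S (\<lambda>s. v s \<sigma>)" if "\<sigma> \<le> T" for S \<sigma>
    using continuous_on_compose2[OF v continuous_on_Pair[OF continuous_on_id continuous_on_const[of _ \<sigma>]], of S] that by auto
  have int: "(\<lambda>s. dev f \<tau> w \<sigma> s \<bullet> v s \<sigma>) integrable_on {0..\<sigma>}" if "\<sigma> \<le> b" for \<sigma>
    by (intro integrable_continuous_real continuous_intros continuous_on_dev cv) (use that \<tau> in auto)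
  have V0: "0 \<le> V" using V[of T 0] norm_ge_zero order_trans by blast
  have "((\<lambda>\<sigma>. (1 / (\<sigma> - \<tau>)) *\<^sub>R integral {0..0 + (\<sigma> - \<tau>)} (\<lambda>s. dev f \<tau> w \<sigma> s \<bullet> v s \<sigma>)) \<longlongrightarrow> 0) (at_right \<tau>)"
  proof (rule tendsto_average)
    fix \<epsilon> :: real assume "\<epsilon> > 0"
    \<comment> \<open>The summand 1 keeps the quotient positive when V = 0.\<close>
    then have "\<epsilon> / (V + 1) > 0" using V0 by simp
    from dev_small[OF this] obtain \<delta> where \<delta>: "\<delta> > 0"
      "\<And>\<sigma> s. \<tau> < \<sigma> \<Longrightarrow> \<sigma> < \<tau> + \<delta> \<Longrightarrow> 0 \<le> s \<Longrightarrow> s \<le> 0 + (\<sigma> - \<tau>) \<Longrightarrow> norm (dev f \<tau> w \<sigma> s) \<le> \<epsilon> / (V + 1)" by blast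
    show "\<exists>\<delta>>0. \<forall>\<sigma> s. \<tau> < \<sigma> \<and> \<sigma> < \<tau> + \<delta> \<and> 0 \<le> s \<and> s \<le> 0 + (\<sigma> - \<tau>) \<longrightarrow> norm (dev f \<tau> w \<sigma> s \<bullet> v s \<sigma> - 0) \<le> \<epsilon>"
    proof (intro exI[of _ "min \<delta> (b - \<tau>)"] conjI allI impI)
      fix \<sigma> s assume *: "\<tau> < \<sigma> \<and> \<sigma> < \<tau> + min \<delta> (b - \<tau>) \<and> 0 \<le> s \<and> s \<le> 0 + (\<sigma> - \<tau>)"
      have "\<bar>dev f \<tau> w \<sigma> s \<bullet> v s \<sigma>\<bar> \<le> norm (dev f \<tau> w \<sigma> s) * norm (v s \<sigma>)" by (rule Cauchy_Schwarz_ineq2)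
      also have "\<dots> \<le> \<epsilon> / (V + 1) * V"
      proof (rule mult_mono)
        show "norm (dev f \<tau> w \<sigma> s) \<le> \<epsilon> / (V + 1)" by (rule \<delta>(2)) (use * in \<open>auto simp: min_def split: if_splits\<close>)
        show "norm (v s \<sigma>) \<le> V" by (rule V) (use * \<tau> in \<open>auto simp: min_def split: if_splits\<close>)
        show "0 \<le> \<epsilon> / (V + 1)" using V0 \<open>\<epsilon> > 0\<close> by simp
      qed simp
      also have "\<dots> \<le> \<epsilon>" using V0 \<open>\<epsilon> > 0\<close> by (simp add: field_simps)
      finally show "norm (dev f \<tau> w \<sigma> s \<bullet> v s \<sigma> - 0) \<le> \<epsilon>" by simp
    qed (use \<delta> \<tau> in auto)
  next
    show "\<forall>\<^sub>F \<sigma> in at_right \<tau>. (\<lambda>s. dev f \<tau> w \<sigma> s \<bullet> v s \<sigma>) integrable_on {0..0 + (\<sigma> - \<tau>)}"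
      using eventually_between
      by eventually_elim (rule integrable_subinterval_real[OF int], use \<tau> in auto)
  qed
  from tendsto_add[OF this tendsto_integral_shift_difference[OF f_eq g_int v V]] \<tau>
  have "((\<lambda>\<sigma>. (1 / (\<sigma> - \<tau>)) *\<^sub>R integral {0..0 + (\<sigma> - \<tau>)} (\<lambda>s. dev f \<tau> w \<sigma> s \<bullet> v s \<sigma>) +
      (1 / (\<sigma> - \<tau>)) * integral {\<sigma> - \<tau>..\<sigma>} (\<lambda>s. (f (s - (\<sigma> - \<tau>)) - f s) \<bullet> v s \<sigma>)) \<longlongrightarrow>
    - integral {0..\<tau>} (\<lambda>r. g r \<bullet> v r \<tau>)) (at_right \<tau>)" by simp
  then show ?thesis
  proof (rule Lim_transform_eventually)
    show "\<forall>\<^sub>F \<sigma> in at_right \<tau>. (1 / (\<sigma> - \<tau>)) *\<^sub>R integral {0..0 + (\<sigma> - \<tau>)} (\<lambda>s. dev f \<tau> w \<sigma> s \<bullet> v s \<sigma>) +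
      (1 / (\<sigma> - \<tau>)) * integral {\<sigma> - \<tau>..\<sigma>} (\<lambda>s. (f (s - (\<sigma> - \<tau>)) - f s) \<bullet> v s \<sigma>) =
      (1 / (\<sigma> - \<tau>)) * integral {0..\<sigma>} (\<lambda>s. dev f \<tau> w \<sigma> s \<bullet> v s \<sigma>)"
      using eventually_between
    proof eventually_elim
      case (elim \<sigma>)
      have "integral {\<sigma> - \<tau>..\<sigma>} (\<lambda>s. (f (s - (\<sigma> - \<tau>)) - f s) \<bullet> v s \<sigma>) = integral {\<sigma> - \<tau>..\<sigma>} (\<lambda>s. dev f \<tau> w \<sigma> s \<bullet> v s \<sigma>)"
        by (rule integral_cong) (use elim in \<open>simp add: dev_late\<close>)
      moreover have "integral {0..\<sigma> - \<tau>} (\<lambda>s. dev f \<tau> w \<sigma> s \<bullet> v s \<sigma>) + integral {\<sigma> - \<tau>..\<sigma>} (\<lambda>s. dev f \<tau> w \<sigma> s \<bullet> v s \<sigma>) =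
          integral {0..\<sigma>} (\<lambda>s. dev f \<tau> w \<sigma> s \<bullet> v s \<sigma>)"
        by (rule integral_split) (use elim \<tau> int in auto)
      ultimately show ?case by (simp add: add_divide_distrib[symmetric])
    qed
  qed
qed

text \<open>Increments of \<open>f\<close> are dominated by those of \<open>\<Gamma>\<close>, the
  primitive of \<open>norm (g s)\<close>, and the translation limit applies to this scalar function
  with the constant weight 1. The mean increment thus stays bounded although \<open>g\<close> may be
  unbounded.\<close>

lemma dev_L1_bound: "\<exists>c. \<forall>\<^sub>F \<sigma> in at_right \<tau>. integral {0..\<sigma>} (\<lambda>s. norm (dev f \<tau> w \<sigma> s)) \<le> c * (\<sigma> - \<tau>)"
proof -
  define \<Gamma> where "\<Gamma> t = integral {0..t} (\<lambda>s. norm (g s))" for t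
  let ?I = "integral {0..\<tau>} (\<lambda>r. norm (g r))"
  have "((\<lambda>\<sigma>. (1 / (\<sigma> - \<tau>)) * integral {\<sigma> - \<tau>..\<sigma>} (\<lambda>s. (\<Gamma> (s - (\<sigma> - \<tau>)) - \<Gamma> s) \<bullet> 1)) \<longlongrightarrow>
    - integral {0..\<tau>} (\<lambda>r. norm (g r) \<bullet> 1)) (at_right \<tau>)"
    by (rule tendsto_integral_shift_difference[where V = 1 and T = T])
       (use \<tau> g_int in \<open>auto simp: \<Gamma>_def intro!: set_integrable_norm continuous_intros\<close>)
  then have lim: "((\<lambda>\<sigma>. (1 / (\<sigma> - \<tau>)) * integral {\<sigma> - \<tau>..\<sigma>} (\<lambda>s. \<Gamma> (s - (\<sigma> - \<tau>)) - \<Gamma> s)) \<longlongrightarrow> - ?I) (at_right \<tau>)" by simp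
  have ev: "\<forall>\<^sub>F \<sigma> in at_right \<tau>. - ?I - 1 < (1 / (\<sigma> - \<tau>)) * integral {\<sigma> - \<tau>..\<sigma>} (\<lambda>s. \<Gamma> (s - (\<sigma> - \<tau>)) - \<Gamma> s)"
    by (rule order_tendstoD(1)[OF lim]) simp
  obtain \<delta> where \<delta>: "\<delta> > 0" "\<And>\<sigma> s. \<tau> < \<sigma> \<Longrightarrow> \<sigma> < \<tau> + \<delta> \<Longrightarrow> 0 \<le> s \<Longrightarrow> s \<le> 0 + (\<sigma> - \<tau>) \<Longrightarrow> norm (dev f \<tau> w \<sigma> s) \<le> 1"
    using dev_small[of 1] by auto
  have ev2: "\<forall>\<^sub>F \<sigma> in at_right \<tau>. \<sigma> < \<tau> + \<delta>"
    using eventually_at_right_real[of \<tau> "\<tau> + \<delta>"] \<delta>(1) by (auto elim: eventually_mono)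
  have gi: "g integrable_on {x..y}" "(\<lambda>s. norm (g s)) integrable_on {x..y}" if "0 \<le> x" "y \<le> T" for x y
    using L1_imp_integrable[OF L1_subinterval[OF g_int that]] .
  have c\<Gamma>: "continuous_on {0..T} \<Gamma>"
    unfolding \<Gamma>_def by (rule indefinite_integral_continuous_1) (use gi in auto)
  have inc: "norm (f s - f r) \<le> \<Gamma> s - \<Gamma> r" if "0 \<le> r" "r \<le> s" "s \<le> T" for r s
  proof -
    have "f s - f r = integral {r..s} g"
      using integral_split[of 0 r s g] gi[of 0 s] f_eq[rule_format, of s] f_eq[rule_format, of r] that by (simp add: algebra_simps)
    also have "norm \<dots> \<le> integral {r..s} (\<lambda>s. norm (g s))"
      by (rule integral_norm_bound_integral) (use gi that in auto)
    also have "\<dots> = \<Gamma> s - \<Gamma> r"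
      using integral_split[of 0 r s "\<lambda>s. norm (g s)"] gi[of 0 s] that by (simp add: \<Gamma>_def)
    finally show ?thesis .
  qed
  have "\<forall>\<^sub>F \<sigma> in at_right \<tau>. integral {0..\<sigma>} (\<lambda>s. norm (dev f \<tau> w \<sigma> s)) \<le> (?I + 2) * (\<sigma> - \<tau>)"
    using ev ev2 eventually_between
  proof eventually_elim
    \<comment> \<open>Of the constant \<open>?I + 2\<close>, the new piece takes 1, where the
      deviation is at most 1, and the translation takes \<open>?I + 1\<close>, its quotient having
      the limit \<open>?I\<close>.\<close>
    case (elim \<sigma>)
    let ?h = "\<sigma> - \<tau>"
    have int: "(\<lambda>s. norm (dev f \<tau> w \<sigma> s)) integrable_on {x..y}" if "0 \<le> x" "y \<le> \<sigma>" for x y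
      by (intro integrable_continuous_real continuous_intros continuous_on_subset[OF continuous_on_dev]) (use elim that in auto)
    have "integral {0..\<sigma>} (\<lambda>s. norm (dev f \<tau> w \<sigma> s)) = integral {0..?h} (\<lambda>s. norm (dev f \<tau> w \<sigma> s)) + integral {?h..\<sigma>} (\<lambda>s. norm (dev f \<tau> w \<sigma> s))"
      by (rule integral_split[symmetric]) (use elim \<tau> int in auto)
    also have "integral {0..?h} (\<lambda>s. norm (dev f \<tau> w \<sigma> s)) \<le> integral {0..?h} (\<lambda>s. 1)"
      by (rule integral_le) (use elim \<tau> int \<delta>(2)[of \<sigma>] in auto)
    also have "integral {?h..\<sigma>} (\<lambda>s. norm (dev f \<tau> w \<sigma> s)) \<le> integral {?h..\<sigma>} (\<lambda>s. \<Gamma> s - \<Gamma> (s - ?h))"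
    proof (rule integral_le)
      show "(\<lambda>s. \<Gamma> s - \<Gamma> (s - ?h)) integrable_on {?h..\<sigma>}"
        by (intro integrable_continuous_real continuous_intros continuous_on_subset[OF c\<Gamma>] continuous_on_compose2[OF c\<Gamma>])
           (use elim \<tau> in auto)
      show "norm (dev f \<tau> w \<sigma> s) \<le> \<Gamma> s - \<Gamma> (s - ?h)" if "s \<in> {?h..\<sigma>}" for s
        using inc[of "s - ?h" s] that elim \<tau> by (simp add: dev_late norm_minus_commute)
    qed (use elim \<tau> int in auto)
    also have "integral {?h..\<sigma>} (\<lambda>s. \<Gamma> s - \<Gamma> (s - ?h)) = - integral {?h..\<sigma>} (\<lambda>s. \<Gamma> (s - ?h) - \<Gamma> s)"
      unfolding integral_neg[symmetric] by simp
    also have "- integral {?h..\<sigma>} (\<lambda>s. \<Gamma> (s - ?h) - \<Gamma> s) \<le> (?I + 1) * ?h"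
      using elim by (simp add: field_simps)
    finally show ?case using elim by (simp add: algebra_simps)
  qed
  then show ?thesis by blast
qed

text \<open>The reached history is \<open>f\<close> plus \<open>dev\<close>, and the two mixed terms
  coincide by symmetry. The linear term carries the first-order information; the last term is the
  quadratic remainder.\<close>

lemma Q_expand:
  assumes \<sigma>: "\<tau> < \<sigma>" "\<sigma> < b"
  shows "Q \<sigma> (w \<sigma>) (glue \<tau> (\<lambda>s. f (\<tau> - s)) w) = form \<sigma> (f 0) f (f 0) f
    + 2 * ((w \<sigma> - f 0) \<bullet> head \<sigma> (f 0) f + integral {0..\<sigma>} (\<lambda>s. dev f \<tau> w \<sigma> s \<bullet> tail \<sigma> (f 0) f s))
    + form \<sigma> (w \<sigma> - f 0) (dev f \<tau> w \<sigma>) (w \<sigma> - f 0) (dev f \<tau> w \<sigma>)"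
proof -
  have fi: "f absolutely_integrable_on {0..\<sigma>}" using f_int \<sigma> \<tau> by simp
  have di: "dev f \<tau> w \<sigma> absolutely_integrable_on {0..\<sigma>}"
    by (intro absolutely_integrable_continuous_real continuous_on_dev) (use \<sigma> in auto)
  have sum: "(\<lambda>s. f s + dev f \<tau> w \<sigma> s) absolutely_integrable_on {0..\<sigma>}" using fi di by (rule set_integral_add(1))
  have "Q \<sigma> (w \<sigma>) (glue \<tau> (\<lambda>s. f (\<tau> - s)) w) =
      form \<sigma> (f 0 + (w \<sigma> - f 0)) (\<lambda>s. f s + dev f \<tau> w \<sigma> s) (f 0 + (w \<sigma> - f 0)) (\<lambda>s. f s + dev f \<tau> w \<sigma> s)"
    by (simp add: Q_def dev_def)
  also have "\<dots> = form \<sigma> (f 0) f (f 0) f + form \<sigma> (f 0) f (w \<sigma> - f 0) (dev f \<tau> w \<sigma>)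
      + (form \<sigma> (w \<sigma> - f 0) (dev f \<tau> w \<sigma>) (f 0) f + form \<sigma> (w \<sigma> - f 0) (dev f \<tau> w \<sigma>) (w \<sigma> - f 0) (dev f \<tau> w \<sigma>))"
    unfolding form_add_left[OF sum fi di] form_add_right[OF fi di fi] form_add_right[OF fi di di] by simp
  also have "form \<sigma> (f 0) f (w \<sigma> - f 0) (dev f \<tau> w \<sigma>) = form \<sigma> (w \<sigma> - f 0) (dev f \<tau> w \<sigma>) (f 0) f"
    by (rule form_sym[OF di fi])
  finally show ?thesis by (simp add: form_def)
qed

end

end

end

lemma tendsto_at_right_if_continuous_on:
  fixes k :: "real \<Rightarrow> 'a::topological_space"
  assumes "continuous_on {\<tau>..b} k" "\<tau> < b"
  shows "(k \<longlongrightarrow> k \<tau>) (at_right \<tau>)"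
  using assms at_within_Icc_at_right[of \<tau> b] by (auto simp: continuous_on_def dest!: bspec[of _ _ \<tau>])

text \<open>The integrand is the square of \<open>norm (u t + \<beta>)\<close>. This bounds the
  control terms from below without any pointwise information on a control in L^2.\<close>

lemma integral_norm_shift_square_nonneg:
  fixes u :: "real \<Rightarrow> 'a::euclidean_space"
  assumes u: "u \<in> L2 a b" and "a \<le> b"
  shows "0 \<le> integral {a..b} (\<lambda>t. (norm (u t))\<^sup>2) + 2 * (\<beta> \<bullet> integral {a..b} u) + (b - a) * (norm \<beta>)\<^sup>2"
proof -
  have i1: "(\<lambda>t. (norm (u t))\<^sup>2) integrable_on {a..b}" and iu: "u integrable_on {a..b}"
    using u by (auto simp: L2_iff intro: L1_imp_integrable)
  have i2: "((\<lambda>t. \<beta> \<bullet> u t) has_integral \<beta> \<bullet> integral {a..b} u) {a..b}"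
    using has_integral_linear[OF integrable_integral[OF iu] bounded_linear_inner_right[of \<beta>]] by (simp add: o_def)
  have "((\<lambda>t. (norm (u t))\<^sup>2 + 2 * (\<beta> \<bullet> u t) + (norm \<beta>)\<^sup>2) has_integral
      integral {a..b} (\<lambda>t. (norm (u t))\<^sup>2) + 2 * (\<beta> \<bullet> integral {a..b} u) + (b - a) * (norm \<beta>)\<^sup>2) {a..b}"
    using has_integral_const_real[of "(norm \<beta>)\<^sup>2" a b] \<open>a \<le> b\<close>
    by (intro has_integral_add integrable_integral i1 has_integral_mult_right i2) simp
  moreover have "0 \<le> (norm (u t))\<^sup>2 + 2 * (\<beta> \<bullet> u t) + (norm \<beta>)\<^sup>2" for t
    using zero_le_power2[of "norm (u t + \<beta>)"]
    by (simp add: power2_norm_eq_inner inner_add_left inner_add_right inner_commute)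
  ultimately show ?thesis by (rule has_integral_nonneg)
qed

context riccati
begin

text \<open>The terms of the expansion in which the control does not occur explicitly are treated
  here once for both controls to be compared. The square in the last limit only compensates for the
  one inside \<open>value_rate\<close>.\<close>

lemma value_increment_along_trajectory:
  assumes f_eq: "\<forall>t\<in>{0..T}. f t = f 0 + integral {0..t} g" and g_int: "g absolutely_integrable_on {0..T}"
    and \<tau>: "0 < \<tau>" "\<tau> < b" "b \<le> T"
    and u: "u absolutely_integrable_on {\<tau>..b}" and w: "trajectory b A B N \<tau> (f 0, \<lambda>s. f (\<tau> - s)) u w"
  defines "q \<equiv> glue \<tau> (\<lambda>s. f (\<tau> - s)) w"
  shows "\<And>\<sigma>. \<sigma> \<in> {\<tau>..b} \<Longrightarrow> w \<sigma> - f 0 = integral {\<tau>..\<sigma>} (drift q) + B *v integral {\<tau>..\<sigma>} u"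
    and "((\<lambda>\<sigma>. (1 / (\<sigma> - \<tau>)) *\<^sub>R integral {\<tau>..\<sigma>} (drift q)) \<longlongrightarrow>
        A *v f 0 + integral {0..\<tau>} (\<lambda>s. N s *v f s)) (at_right \<tau>)"
    and "((\<lambda>\<sigma>. (1 / (\<sigma> - \<tau>)) * (integral {\<tau>..\<sigma>} (\<lambda>t. (norm (C *v w t))\<^sup>2)
          + 2 * (integral {\<tau>..\<sigma>} (drift q) \<bullet> head \<sigma> (f 0) f)
          + 2 * integral {0..\<sigma>} (\<lambda>s. dev f \<tau> w \<sigma> s \<bullet> tail \<sigma> (f 0) f s)))
      \<longlongrightarrow> (norm (transpose B *v head \<tau> (f 0) f))\<^sup>2 - value_rate f g \<tau>) (at_right \<tau>)"
proof -
  note cf = continuous_on_f[OF f_eq g_int]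
  have fT: "f absolutely_integrable_on {0..T}" by (rule f_int[OF f_eq g_int]) auto
  have f\<tau>: "(\<lambda>s. f (\<tau> - s)) absolutely_integrable_on {0..\<tau>}"
    by (rule absolutely_integrable_reflect_initial, rule f_int[OF f_eq g_int]) (use \<tau> in auto)
  have cw: "continuous_on {\<tau>..b} w" using w by (rule trajectory_continuous)
  have w_eq: "w t = f 0 + integral {\<tau>..t} (\<lambda>r. drift q r + B *v u r)" if "t \<in> {\<tau>..b}" for t
    using w[unfolded trajectory_iff[OF f\<tau> less_imp_le[OF \<tau>(1)]], folded q_def, THEN conjunct2] that
    by (rule bspec)
  have w0: "w \<tau> = f 0" using trajectory_initial[OF w] \<tau> by simp
  have cq: "continuous_on {0..b} q"
    unfolding q_def by (rule continuous_on_history[OF f_eq g_int \<tau> cw w0])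
  then have cd: "continuous_on {\<tau>..b} (drift q)"
    by (intro continuous_on_drift absolutely_integrable_continuous_real continuous_on_subset[OF cq]) (use \<tau> in auto)
  show "w \<sigma> - f 0 = integral {\<tau>..\<sigma>} (drift q) + B *v integral {\<tau>..\<sigma>} u" if \<sigma>: "\<sigma> \<in> {\<tau>..b}" for \<sigma>
  proof -
    have iu: "u integrable_on {\<tau>..\<sigma>}"
      by (intro L1_imp_integrable L1_subinterval[OF u]) (use \<sigma> in auto)
    have "w \<sigma> = f 0 + integral {\<tau>..\<sigma>} (\<lambda>r. drift q r + B *v u r)"
      by (rule w_eq[OF \<sigma>])
    moreover have "((\<lambda>r. drift q r + B *v u r) has_integral integral {\<tau>..\<sigma>} (drift q) + B *v integral {\<tau>..\<sigma>} u) {\<tau>..\<sigma>}"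
      using has_integral_linear[OF integrable_integral[OF iu] matrix_vector_mul_bounded_linear[of B]] \<sigma>
      by (intro has_integral_add integrable_integral integrable_continuous_real continuous_on_subset[OF cd])
         (auto simp: o_def)
    ultimately show ?thesis by (simp add: integral_unique)
  qed
  \<comment> \<open>In natural time the past is \<open>f (\<tau> - s)\<close>; reversing the memory
    integral produces the first component of the state operator.\<close>
  have "integral {0..\<tau>} (\<lambda>s. N (\<tau> - s) *v q s) = integral {0..\<tau>} (\<lambda>s. N (\<tau> - s) *v f (\<tau> - s))"
    by (rule integral_spike_point[of _ \<tau>]) (simp add: q_def)
  then have "drift q \<tau> = A *v f 0 + integral {0..\<tau>} (\<lambda>s. N (\<tau> - s) *v f (\<tau> - s))"
    using w0 by (simp add: drift_def q_def)
  then have d\<tau>: "drift q \<tau> = A *v f 0 + integral {0..\<tau>} (\<lambda>s. N s *v f s)"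
    using integral_reflect_initial[of \<tau> "\<lambda>s. N s *v f s"] by simp
  show lim_d: "((\<lambda>\<sigma>. (1 / (\<sigma> - \<tau>)) *\<^sub>R integral {\<tau>..\<sigma>} (drift q)) \<longlongrightarrow>
        A *v f 0 + integral {0..\<tau>} (\<lambda>s. N s *v f s)) (at_right \<tau>)"
    using tendsto_average_continuous[OF cd \<tau>(2)] unfolding d\<tau> .
  have "((\<lambda>\<sigma>. (1 / (\<sigma> - \<tau>)) *\<^sub>R integral {\<tau>..\<sigma>} (\<lambda>t. (norm (C *v w t))\<^sup>2)) \<longlongrightarrow> (norm (C *v w \<tau>))\<^sup>2) (at_right \<tau>)"
    by (rule tendsto_average_continuous[OF _ \<tau>(2)]) (intro continuous_intros cw)
  then have lim_C: "((\<lambda>\<sigma>. (1 / (\<sigma> - \<tau>)) * integral {\<tau>..\<sigma>} (\<lambda>t. (norm (C *v w t))\<^sup>2)) \<longlongrightarrow> (norm (C *v f 0))\<^sup>2) (at_right \<tau>)"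
    by (simp add: w0)
  have lim_h: "((\<lambda>\<sigma>. head \<sigma> (f 0) f) \<longlongrightarrow> head \<tau> (f 0) f) (at_right \<tau>)"
    by (rule tendsto_at_right_if_continuous_on[OF continuous_on_subset[OF continuous_on_head[OF fT]]]) (use \<tau> in auto)
  have lim_t: "((\<lambda>\<sigma>. (1 / (\<sigma> - \<tau>)) * integral {0..\<sigma>} (\<lambda>s. dev f \<tau> w \<sigma> s \<bullet> tail \<sigma> (f 0) f s)) \<longlongrightarrow>
    - integral {0..\<tau>} (\<lambda>r. g r \<bullet> tail \<tau> (f 0) f r)) (at_right \<tau>)"
  proof (rule tendsto_dev[OF f_eq g_int \<tau> cw w0 continuous_on_tail_joint[OF fT]])
    fix s \<sigma> assume \<sigma>: "\<sigma> \<le> T"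
    have "integral {0..\<sigma>} (\<lambda>s. norm (f s)) \<le> integral {0..T} (\<lambda>s. norm (f s))"
      by (rule integral_subset_le)
         (use \<sigma> fT in \<open>auto intro!: L1_imp_integrable f_int[OF f_eq g_int]\<close>)
    then show "norm (tail \<sigma> (f 0) f s) \<le> K * (norm (f 0) + integral {0..T} (\<lambda>s. norm (f s)))"
      by (intro order_trans[OF norm_tail_le mult_left_mono[OF _ K_nonneg]] f_int[OF f_eq g_int]) (use \<sigma> in auto)
  qed
  have "((\<lambda>\<sigma>. (1 / (\<sigma> - \<tau>)) * integral {\<tau>..\<sigma>} (\<lambda>t. (norm (C *v w t))\<^sup>2)
          + 2 * (((1 / (\<sigma> - \<tau>)) *\<^sub>R integral {\<tau>..\<sigma>} (drift q)) \<bullet> head \<sigma> (f 0) f)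
          + 2 * ((1 / (\<sigma> - \<tau>)) * integral {0..\<sigma>} (\<lambda>s. dev f \<tau> w \<sigma> s \<bullet> tail \<sigma> (f 0) f s)))
      \<longlongrightarrow> (norm (C *v f 0))\<^sup>2 + 2 * ((A *v f 0 + integral {0..\<tau>} (\<lambda>s. N s *v f s)) \<bullet> head \<tau> (f 0) f)
        + 2 * (- integral {0..\<tau>} (\<lambda>r. g r \<bullet> tail \<tau> (f 0) f r))) (at_right \<tau>)"
    by (intro tendsto_intros lim_C lim_d lim_h lim_t)
  then show "((\<lambda>\<sigma>. (1 / (\<sigma> - \<tau>)) * (integral {\<tau>..\<sigma>} (\<lambda>t. (norm (C *v w t))\<^sup>2)
          + 2 * (integral {\<tau>..\<sigma>} (drift q) \<bullet> head \<sigma> (f 0) f)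
          + 2 * integral {0..\<sigma>} (\<lambda>s. dev f \<tau> w \<sigma> s \<bullet> tail \<sigma> (f 0) f s)))
      \<longlongrightarrow> (norm (transpose B *v head \<tau> (f 0) f))\<^sup>2 - value_rate f g \<tau>) (at_right \<tau>)"
    by (simp add: value_rate_def algebra_simps)
qed

lemma value_has_right_derivative:
  assumes f_eq: "\<forall>t\<in>{0..T}. f t = f 0 + integral {0..t} g" and g_int: "g absolutely_integrable_on {0..T}"
    and \<tau>: "0 < \<tau>" "\<tau> < T"
  shows "((\<lambda>\<sigma>. (form \<sigma> (f 0) f (f 0) f - form \<tau> (f 0) f (f 0) f) / (\<sigma> - \<tau>)) \<longlongrightarrow> value_rate f g \<tau>) (at_right \<tau>)"
proof -
  let ?\<phi> = "\<lambda>\<sigma>. form \<sigma> (f 0) f (f 0) f" and ?h = "\<lambda>s. f (\<tau> - s)"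
  let ?H = "\<lambda>\<sigma>. head \<sigma> (f 0) f"
  define step where "step w \<sigma> = (1 / (\<sigma> - \<tau>)) * (integral {\<tau>..\<sigma>} (\<lambda>t. (norm (C *v w t))\<^sup>2)
          + 2 * (integral {\<tau>..\<sigma>} (drift (glue \<tau> ?h w)) \<bullet> ?H \<sigma>)
          + 2 * integral {0..\<sigma>} (\<lambda>s. dev f \<tau> w \<sigma> s \<bullet> tail \<sigma> (f 0) f s))" for w \<sigma>
  have cf: "continuous_on {0..T} f" by (rule continuous_on_f[OF f_eq g_int])
  have fi: "f absolutely_integrable_on {0..b}" if "b \<le> T" for b
    by (rule f_int[OF f_eq g_int]) (use that in auto)
  have f2: "f \<in> L2 0 b" if "b \<le> T" for b by (rule continuous_imp_L2, rule continuous_on_subset[OF cf]) (use that in auto)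
  have h2: "?h \<in> L2 0 \<tau>" by (rule L2_reflect, rule f2) (use \<tau> in auto)
  have Q\<tau>: "Q \<tau> (f 0) ?h = ?\<phi> \<tau>" by (simp add: Q_def)
  have lim_H: "(?H \<longlongrightarrow> ?H \<tau>) (at_right \<tau>)"
    by (rule tendsto_at_right_if_continuous_on[OF continuous_on_subset[OF continuous_on_head[OF fi]]]) (use \<tau> in auto)
  have BH: "(B *v z) \<bullet> y = (transpose B *v y) \<bullet> z" for z y
    using inner_transpose_vector[of B y z] by (simp add: inner_commute)
  have split_cost: "integral {\<tau>..\<sigma>} (\<lambda>t. (norm (C *v w t))\<^sup>2 + (norm (u t))\<^sup>2) =
      integral {\<tau>..\<sigma>} (\<lambda>t. (norm (C *v w t))\<^sup>2) + integral {\<tau>..\<sigma>} (\<lambda>t. (norm (u t))\<^sup>2)"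
    if "continuous_on {\<tau>..b} w" "u \<in> L2 \<tau> b" "\<sigma> \<le> b" for u :: "real \<Rightarrow> real^'m" and w b \<sigma>
  proof (rule integral_add)
    show "(\<lambda>t. (norm (C *v w t))\<^sup>2) integrable_on {\<tau>..\<sigma>}"
      by (intro integrable_continuous_real continuous_intros continuous_on_subset[OF that(1)]) (use that in auto)
    show "(\<lambda>t. (norm (u t))\<^sup>2) integrable_on {\<tau>..\<sigma>}"
      using L2_subset[OF that(2) order_refl that(3)] by (simp add: L2_iff)
  qed

  obtain u w where u: "u \<in> L2 \<tau> T" and w: "trajectory T A B N \<tau> (f 0, ?h) u w"
    and ge: "\<And>\<sigma>. \<tau> < \<sigma> \<Longrightarrow> \<sigma> < T \<Longrightarrow>
      integral {\<tau>..\<sigma>} (\<lambda>t. (norm (C *v w t))\<^sup>2 + (norm (u t))\<^sup>2) + Q \<sigma> (w \<sigma>) (glue \<tau> ?h w) \<le> Q \<tau> (f 0) ?h"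
    using dynamic_programming_ge[OF \<tau> h2, of "f 0"] by blast
  note stepw = value_increment_along_trajectory[OF f_eq g_int \<tau> order_refl L2_imp_L1[OF u] w]
  have cw: "continuous_on {\<tau>..T} w" and w0: "w \<tau> = f 0"
    using trajectory_continuous[OF w] trajectory_initial[OF w] \<tau> by auto
  have upper: "(?\<phi> \<sigma> - ?\<phi> \<tau>) / (\<sigma> - \<tau>) \<le> (norm (transpose B *v ?H \<sigma>))\<^sup>2 - step w \<sigma>" if \<sigma>: "\<tau> < \<sigma>" "\<sigma> < T" for \<sigma>
  proof -
    \<comment> \<open>The square is completed with \<open>head\<close> taken at
      \<open>\<sigma>\<close>, as it occurs in the expansion; continuity of \<open>head\<close>
      brings it back to \<open>\<tau>\<close> in the limit.\<close>
    let ?d = "dev f \<tau> w \<sigma>" and ?\<beta> = "transpose B *v ?H \<sigma>"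
    have "?d \<in> L2 0 \<sigma>"
      by (rule continuous_imp_L2, rule continuous_on_dev[OF f_eq g_int \<tau> order_refl cw w0]) (use \<sigma> in auto)
    then have pos: "0 \<le> form \<sigma> (w \<sigma> - f 0) ?d (w \<sigma> - f 0) ?d" by (intro form_nonneg) (use \<sigma> \<tau> in auto)
    have sq: "0 \<le> integral {\<tau>..\<sigma>} (\<lambda>t. (norm (u t))\<^sup>2) + 2 * (?\<beta> \<bullet> integral {\<tau>..\<sigma>} u) + (\<sigma> - \<tau>) * (norm ?\<beta>)\<^sup>2"
      by (rule integral_norm_shift_square_nonneg[OF L2_subset[OF u]]) (use \<sigma> in auto)
    have "w \<sigma> - f 0 = integral {\<tau>..\<sigma>} (drift (glue \<tau> ?h w)) + B *v integral {\<tau>..\<sigma>} u"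
      using \<sigma> by (intro stepw(1)) auto
    then have e: "(w \<sigma> - f 0) \<bullet> ?H \<sigma> = integral {\<tau>..\<sigma>} (drift (glue \<tau> ?h w)) \<bullet> ?H \<sigma> + ?\<beta> \<bullet> integral {\<tau>..\<sigma>} u"
      by (simp only: inner_add_left BH)
    \<comment> \<open>The bookkeeping over plain reals: \<open>p\<close> and \<open>p'\<close> are
      the values at \<open>\<sigma>\<close> and \<open>\<tau>\<close>, \<open>k\<close> is the
      pairing of the control with \<open>?\<beta>\<close>, \<open>r\<close> the dropped quadratic
      term and \<open>n\<close> the square that completes the control terms.\<close>
    have arith: "p - p' \<le> n - (c1 + 2 * d + 2 * j)"
      if "c + q \<le> p'" "0 \<le> r" "0 \<le> c2 + 2 * k + n" "q = p + 2 * (d + k + j) + r" "c = c1 + c2"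
      for c q p' r c1 c2 k n p d j :: real using that by (simp add: algebra_simps)
    have "?\<phi> \<sigma> - ?\<phi> \<tau> \<le> (\<sigma> - \<tau>) * (norm ?\<beta>)\<^sup>2 - (integral {\<tau>..\<sigma>} (\<lambda>t. (norm (C *v w t))\<^sup>2)
          + 2 * (integral {\<tau>..\<sigma>} (drift (glue \<tau> ?h w)) \<bullet> ?H \<sigma>)
          + 2 * integral {0..\<sigma>} (\<lambda>s. ?d s \<bullet> tail \<sigma> (f 0) f s))"
      by (rule arith[OF ge[OF \<sigma>, unfolded Q\<tau>] pos sq Q_expand[OF f_eq g_int \<tau> order_refl cw w0 \<sigma>, unfolded e]
            split_cost[OF cw u less_imp_le[OF \<sigma>(2)]]])
    also have "\<dots> = (\<sigma> - \<tau>) * ((norm ?\<beta>)\<^sup>2 - step w \<sigma>)"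
      using \<sigma> by (simp add: step_def right_diff_distrib)
    finally show ?thesis using \<sigma> by (simp add: pos_divide_le_eq mult.commute)
  qed
  have lim_upper: "((\<lambda>\<sigma>. (norm (transpose B *v ?H \<sigma>))\<^sup>2 - step w \<sigma>) \<longlongrightarrow> value_rate f g \<tau>) (at_right \<tau>)"
  proof -
    have "((\<lambda>\<sigma>. (norm (transpose B *v ?H \<sigma>))\<^sup>2 - step w \<sigma>) \<longlongrightarrow>
        (norm (transpose B *v ?H \<tau>))\<^sup>2 - ((norm (transpose B *v ?H \<tau>))\<^sup>2 - value_rate f g \<tau>)) (at_right \<tau>)"
      unfolding step_def by (rule tendsto_diff[OF _ stepw(3)]) (intro tendsto_intros lim_H)
    then show ?thesis by simp
  qed

  \<comment> \<open>The minimiser of |v|^2 + 2 (B v) \<bullet> head with \<open>head\<close> frozen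
    at \<open>\<tau>\<close>. Being constant, it keeps the increment of the trajectory of the order
    \<sigma> - \<tau>.\<close>
  let ?v = "- (transpose B *v ?H \<tau>)"
  obtain b where b: "\<tau> < b" "b < T" "(b - \<tau>) * (norm A + M * T) \<le> 1 / 2"
  proof -
    \<comment> \<open>The second entry of the minimum provides the contraction factor 1/2, with a
      summand 1 against a vanishing divisor; the first entry keeps \<open>b\<close> below
      \<open>T\<close>.\<close>
    define b where "b = \<tau> + min ((T - \<tau>) / 2) (1 / (2 * (norm A + M * T + 1)))"
    have pos: "0 < norm A + M * T + 1" using M_nonneg T_pos by (simp add: add_nonneg_pos)
    have "\<tau> < b" using \<tau> pos by (simp add: b_def)
    moreover have "b \<le> \<tau> + (T - \<tau>) / 2" unfolding b_def by (intro add_left_mono min.cobounded1)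
    then have "b < T" using \<tau> by (simp add: field_simps)
    moreover have small: "(b - \<tau>) * (norm A + M * T) \<le> 1 / (2 * (norm A + M * T + 1)) * (norm A + M * T)"
      using M_nonneg T_pos by (intro mult_right_mono) (auto simp: b_def)
    have "1 / (2 * (norm A + M * T + 1)) * (norm A + M * T) \<le> 1 / 2" using pos by (simp add: field_simps)
    with small have "(b - \<tau>) * (norm A + M * T) \<le> 1 / 2" by (rule order_trans)
    ultimately show ?thesis using that by blast
  qed
  obtain w' where w': "trajectory b A B N \<tau> (f 0, ?h) (\<lambda>_. ?v) w'"
    by (rule local_existence[OF L2_imp_L1[OF h2] less_imp_le[OF \<tau>(1)] less_imp_le[OF b(1)] less_imp_le[OF b(2)] b(3), of "f 0" ?v])
  have u': "(\<lambda>_. ?v) \<in> L2 \<tau> c" for c by (intro continuous_imp_L2 continuous_intros)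
  note stepw' = value_increment_along_trajectory[OF f_eq g_int \<tau>(1) b(1) less_imp_le[OF b(2)] L2_imp_L1[OF u'] w']
  have cw': "continuous_on {\<tau>..b} w'" and w0': "w' \<tau> = f 0"
    using trajectory_continuous[OF w'] trajectory_initial[OF w'] b by auto
  define err where "err \<sigma> = form \<sigma> (w' \<sigma> - f 0) (dev f \<tau> w' \<sigma>) (w' \<sigma> - f 0) (dev f \<tau> w' \<sigma>)" for \<sigma>
  have lower: "- step w' \<sigma> - (norm ?v)\<^sup>2 - 2 * ((B *v ?v) \<bullet> ?H \<sigma>) - err \<sigma> / (\<sigma> - \<tau>) \<le> (?\<phi> \<sigma> - ?\<phi> \<tau>) / (\<sigma> - \<tau>)"
    if \<sigma>: "\<tau> < \<sigma>" "\<sigma> < b" for \<sigma>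
  proof -
    have traj: "trajectory \<sigma> A B N \<tau> (f 0, ?h) (\<lambda>_. ?v) w'"
      by (rule trajectory_restrict(1)[OF L2_imp_L1[OF h2] _ _ _ L2_imp_L1[OF u'] w'])
         (use \<sigma> \<tau> in auto)
    have le: "Q \<tau> (f 0) ?h \<le> integral {\<tau>..\<sigma>} (\<lambda>t. (norm (C *v w' t))\<^sup>2 + (norm ?v)\<^sup>2) + Q \<sigma> (w' \<sigma>) (glue \<tau> ?h w')"
      by (rule dynamic_programming_le[OF \<tau>(1) \<sigma>(1) _ h2 u' traj]) (use \<sigma> b in auto)
    have "w' \<sigma> - f 0 = integral {\<tau>..\<sigma>} (drift (glue \<tau> ?h w')) + B *v integral {\<tau>..\<sigma>} (\<lambda>_. ?v)"
      using \<sigma> by (intro stepw'(1)) auto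
    also have "integral {\<tau>..\<sigma>} (\<lambda>_. ?v) = (\<sigma> - \<tau>) *\<^sub>R ?v" using \<sigma> by simp
    finally have e: "(w' \<sigma> - f 0) \<bullet> ?H \<sigma> = integral {\<tau>..\<sigma>} (drift (glue \<tau> ?h w')) \<bullet> ?H \<sigma> + (\<sigma> - \<tau>) * ((B *v ?v) \<bullet> ?H \<sigma>)"
      by (simp only: inner_add_left matrix_vector_mult_scaleR inner_scaleR_left)
    have n: "integral {\<tau>..\<sigma>} (\<lambda>t. (norm ?v)\<^sup>2) = (\<sigma> - \<tau>) * (norm ?v)\<^sup>2" using \<sigma> by simp
    have arith': "x - r \<le> p - p'"
      if "x = - (c1 + 2 * d + 2 * j) - n - 2 * k" "p' \<le> c + q" "q = p + 2 * (d + k + j) + r" "c = c1 + n"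
      for c q p' r c1 k n p d j x :: real using that by (simp add: algebra_simps)
    have "(\<sigma> - \<tau>) * (- step w' \<sigma> - (norm ?v)\<^sup>2 - 2 * ((B *v ?v) \<bullet> ?H \<sigma>)) =
        - (integral {\<tau>..\<sigma>} (\<lambda>t. (norm (C *v w' t))\<^sup>2)
          + 2 * (integral {\<tau>..\<sigma>} (drift (glue \<tau> ?h w')) \<bullet> ?H \<sigma>)
          + 2 * integral {0..\<sigma>} (\<lambda>s. dev f \<tau> w' \<sigma> s \<bullet> tail \<sigma> (f 0) f s))
        - (\<sigma> - \<tau>) * (norm ?v)\<^sup>2 - 2 * ((\<sigma> - \<tau>) * ((B *v ?v) \<bullet> ?H \<sigma>))"
      using \<sigma> by (simp add: step_def right_diff_distrib)
    then have "(\<sigma> - \<tau>) * (- step w' \<sigma> - (norm ?v)\<^sup>2 - 2 * ((B *v ?v) \<bullet> ?H \<sigma>)) - err \<sigma> \<le> ?\<phi> \<sigma> - ?\<phi> \<tau>"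
      using le Q_expand[OF f_eq g_int \<tau>(1) b(1) less_imp_le[OF b(2)] cw' w0' \<sigma>] split_cost[OF cw' u' less_imp_le[OF \<sigma>(2)]]
      unfolding Q\<tau> e n err_def by (intro arith')
    then have "((\<sigma> - \<tau>) * (- step w' \<sigma> - (norm ?v)\<^sup>2 - 2 * ((B *v ?v) \<bullet> ?H \<sigma>)) - err \<sigma>) / (\<sigma> - \<tau>) \<le> (?\<phi> \<sigma> - ?\<phi> \<tau>) / (\<sigma> - \<tau>)"
      using \<sigma> by (intro divide_right_mono) auto
    then show ?thesis using \<sigma> by (simp add: diff_divide_distrib)
  qed
  have lim_err: "((\<lambda>\<sigma>. err \<sigma> / (\<sigma> - \<tau>)) \<longlongrightarrow> 0) (at_right \<tau>)"
  proof -
    let ?a = "A *v f 0 + integral {0..\<tau>} (\<lambda>s. N s *v f s)"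
    obtain c where c: "\<forall>\<^sub>F \<sigma> in at_right \<tau>. integral {0..\<sigma>} (\<lambda>s. norm (dev f \<tau> w' \<sigma> s)) \<le> c * (\<sigma> - \<tau>)"
      using dev_L1_bound[OF f_eq g_int \<tau>(1) b(1) less_imp_le[OF b(2)] cw' w0'] by blast
    \<comment> \<open>The mean drift converges, so its norm is eventually below the norm of the
      limit plus 1; the constant control adds \<open>norm (B *v ?v)\<close>.\<close>
    define c' where "c' = norm ?a + 1 + norm (B *v ?v)"
    have ev: "\<forall>\<^sub>F \<sigma> in at_right \<tau>. norm ((1 / (\<sigma> - \<tau>)) *\<^sub>R integral {\<tau>..\<sigma>} (drift (glue \<tau> ?h w'))) < norm ?a + 1"
      by (rule order_tendstoD(2)[OF tendsto_norm[OF stepw'(2)]]) simp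
    have bound: "\<forall>\<^sub>F \<sigma> in at_right \<tau>. norm (err \<sigma> / (\<sigma> - \<tau>)) \<le> K * (c' + c)\<^sup>2 * (\<sigma> - \<tau>)"
      using c ev eventually_at_right_real[OF b(1)]
    proof eventually_elim
      case (elim \<sigma>)
      then have \<sigma>: "0 < \<sigma> - \<tau>" "\<tau> < \<sigma>" "\<sigma> < b" by auto
      have "w' \<sigma> - f 0 = integral {\<tau>..\<sigma>} (drift (glue \<tau> ?h w')) + B *v integral {\<tau>..\<sigma>} (\<lambda>_. ?v)"
        using \<sigma> by (intro stepw'(1)) auto
      also have "integral {\<tau>..\<sigma>} (\<lambda>_. ?v) = (\<sigma> - \<tau>) *\<^sub>R ?v" using \<sigma> by simp
      finally have "norm (w' \<sigma> - f 0) \<le> norm (integral {\<tau>..\<sigma>} (drift (glue \<tau> ?h w'))) + (\<sigma> - \<tau>) * norm (B *v ?v)"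
        using norm_triangle_ineq[of "integral {\<tau>..\<sigma>} (drift (glue \<tau> ?h w'))" "(\<sigma> - \<tau>) *\<^sub>R (B *v ?v)"] \<sigma>
        by (simp only: matrix_vector_mult_scaleR norm_scaleR abs_of_pos)
      also have "norm (integral {\<tau>..\<sigma>} (drift (glue \<tau> ?h w'))) \<le> (norm ?a + 1) * (\<sigma> - \<tau>)"
        using elim(2) \<sigma> by (simp add: pos_divide_less_eq less_imp_le)
      finally have "norm (w' \<sigma> - f 0) \<le> c' * (\<sigma> - \<tau>)" by (simp add: c'_def algebra_simps)
      then have le: "norm (w' \<sigma> - f 0) + integral {0..\<sigma>} (\<lambda>s. norm (dev f \<tau> w' \<sigma> s)) \<le> (c' + c) * (\<sigma> - \<tau>)"
        using elim(1) by (simp add: distrib_right)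
      have cd: "continuous_on {0..\<sigma>} (dev f \<tau> w' \<sigma>)"
        by (rule continuous_on_dev[OF f_eq g_int \<tau>(1) b(1) less_imp_le[OF b(2)] cw' w0']) (use \<sigma> in auto)
      then have di: "dev f \<tau> w' \<sigma> absolutely_integrable_on {0..\<sigma>}" by (rule absolutely_integrable_continuous_real)
      have nn: "0 \<le> norm (w' \<sigma> - f 0) + integral {0..\<sigma>} (\<lambda>s. norm (dev f \<tau> w' \<sigma> s))"
        by (intro add_nonneg_nonneg integral_nonneg L1_imp_integrable(2)[OF di]) auto
      have "\<bar>err \<sigma>\<bar> \<le> K * ((norm (w' \<sigma> - f 0) + integral {0..\<sigma>} (\<lambda>s. norm (dev f \<tau> w' \<sigma> s))) *
          (norm (w' \<sigma> - f 0) + integral {0..\<sigma>} (\<lambda>s. norm (dev f \<tau> w' \<sigma> s))))"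
        unfolding err_def mult.assoc[symmetric] by (rule abs_form_le[OF di di])
      also have "\<dots> \<le> K * (((c' + c) * (\<sigma> - \<tau>)) * ((c' + c) * (\<sigma> - \<tau>)))"
        by (intro mult_left_mono[OF mult_mono[OF le le order_trans[OF nn le] nn]] K_nonneg)
      also have "\<dots> = (K * (c' + c)\<^sup>2 * (\<sigma> - \<tau>)) * (\<sigma> - \<tau>)" by (simp add: power2_eq_square)
      finally show ?case using \<sigma> by (simp add: abs_divide pos_divide_le_eq)
    qed
    have "((\<lambda>\<sigma>. K * (c' + c)\<^sup>2 * (\<sigma> - \<tau>)) \<longlongrightarrow> K * (c' + c)\<^sup>2 * (\<tau> - \<tau>)) (at_right \<tau>)"
      by (intro tendsto_intros)
    then have "((\<lambda>\<sigma>. K * (c' + c)\<^sup>2 * (\<sigma> - \<tau>)) \<longlongrightarrow> 0) (at_right \<tau>)" by simp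
    with bound show ?thesis by (rule Lim_null_comparison)
  qed
  have lim_lower: "((\<lambda>\<sigma>. - step w' \<sigma> - (norm ?v)\<^sup>2 - 2 * ((B *v ?v) \<bullet> ?H \<sigma>) - err \<sigma> / (\<sigma> - \<tau>)) \<longlongrightarrow> value_rate f g \<tau>) (at_right \<tau>)"
  proof -
    have "((\<lambda>\<sigma>. - step w' \<sigma> - (norm ?v)\<^sup>2 - 2 * ((B *v ?v) \<bullet> ?H \<sigma>) - err \<sigma> / (\<sigma> - \<tau>)) \<longlongrightarrow>
      - ((norm (transpose B *v ?H \<tau>))\<^sup>2 - value_rate f g \<tau>) - (norm ?v)\<^sup>2 - 2 * ((B *v ?v) \<bullet> ?H \<tau>) - 0) (at_right \<tau>)"
      unfolding step_def 
      by (rule tendsto_diff[OF tendsto_diff[OF tendsto_diff[OF tendsto_minus[OF stepw'(3)] tendsto_const]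
            tendsto_mult_left[OF tendsto_inner[OF tendsto_const lim_H]]] lim_err])
    \<comment> \<open>Minus one square from the control cost and plus two from this pairing leave
      one square, the same control contribution as in the upper estimate.\<close>
    moreover have "(B *v ?v) \<bullet> ?H \<tau> = - (norm (transpose B *v ?H \<tau>))\<^sup>2"
      unfolding BH power2_norm_eq_inner inner_minus_right ..
    ultimately show ?thesis by simp
  qed
  show ?thesis
  proof (rule tendsto_sandwich[OF _ _ lim_lower lim_upper])
    show "\<forall>\<^sub>F \<sigma> in at_right \<tau>. (?\<phi> \<sigma> - ?\<phi> \<tau>) / (\<sigma> - \<tau>) \<le> (norm (transpose B *v ?H \<sigma>))\<^sup>2 - step w \<sigma>"
      using eventually_at_right_real[OF \<tau>(2)] by eventually_elim (rule upper, auto)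
    show "\<forall>\<^sub>F \<sigma> in at_right \<tau>. - step w' \<sigma> - (norm ?v)\<^sup>2 - 2 * ((B *v ?v) \<bullet> ?H \<sigma>) - err \<sigma> / (\<sigma> - \<tau>) \<le> (?\<phi> \<sigma> - ?\<phi> \<tau>) / (\<sigma> - \<tau>)"
      using eventually_at_right_real[OF b(1)] by eventually_elim (rule lower, auto)
  qed
qed

end

lemma L2_add:
  assumes "f \<in> L2 a b" "g \<in> L2 a b"
  shows "(\<lambda>s. f s + g s) \<in> L2 a b"
proof -
  have ai: "(\<lambda>s. f s + g s) absolutely_integrable_on {a..b}"
    using assms by (intro set_integral_add(1)) (auto simp: L2_iff)
  then have m: "(\<lambda>s. f s + g s) \<in> borel_measurable (lebesgue_on {a..b})"
    using absolutely_integrable_measurable[of "{a..b}" "\<lambda>s. f s + g s"] by simp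
  have "(\<lambda>s. (norm (f s + g s))\<^sup>2) absolutely_integrable_on {a..b}"
  proof (rule measurable_bounded_by_integrable_imp_absolutely_integrable)
    show "(\<lambda>s. (norm (f s + g s))\<^sup>2) \<in> borel_measurable (lebesgue_on {a..b})"
      using m by measurable
    show "(\<lambda>s. 2 * (norm (f s))\<^sup>2 + 2 * (norm (g s))\<^sup>2) integrable_on {a..b}"
      using assms by (intro integrable_add integrable_on_mult_right) (auto simp: L2_iff)
    show "norm ((norm (f s + g s))\<^sup>2) \<le> 2 * (norm (f s))\<^sup>2 + 2 * (norm (g s))\<^sup>2" for s
    proof -
      have "(norm (f s + g s))\<^sup>2 \<le> (norm (f s) + norm (g s))\<^sup>2"
        by (intro power_mono norm_triangle_ineq) simp
      also have "\<dots> \<le> 2 * (norm (f s))\<^sup>2 + 2 * (norm (g s))\<^sup>2"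
        using zero_le_power2[of "norm (f s) - norm (g s)"] by (simp add: power2_eq_square algebra_simps)
      finally show ?thesis by simp
    qed
  qed auto
  with ai show ?thesis by (auto simp: L2_iff intro: L1_imp_integrable)
qed

text \<open>
  Applied to the difference of two derivatives of the same function; the shift-difference limit for the
  zero function replaces the almost everywhere uniqueness of the derivative.
\<close>

lemma integral_inner_eq_0_if_primitive_eq_0:
  fixes d v :: "real \<Rightarrow> 'a::euclidean_space"
  assumes d: "d absolutely_integrable_on {0..\<tau>}" "\<And>t. t \<in> {0..\<tau>} \<Longrightarrow> integral {0..t} d = 0"
    and v: "continuous_on UNIV v" "\<And>s. norm (v s) \<le> V" and "0 < \<tau>"
  shows "integral {0..\<tau>} (\<lambda>s. d s \<bullet> v s) = 0"
proof -
  \<comment> \<open>Extended by 0 up to \<open>\<tau> + 1\<close>, because the translation limit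
    asks for room to the right of \<open>\<tau>\<close>.\<close>
  let ?g = "\<lambda>s. if s \<le> \<tau> then d s else 0"
  have int: "?g absolutely_integrable_on {0..\<tau> + 1}"
  proof (rule absolutely_integrable_on_combine[of 0 \<tau>])
    show "?g absolutely_integrable_on {0..\<tau>}"
      by (rule absolutely_integrable_spike[OF d(1), of "{}"]) auto
    show "?g absolutely_integrable_on {\<tau>..\<tau> + 1}"
      by (rule absolutely_integrable_spike[where f = "\<lambda>_. 0" and S = "{\<tau>}"]) auto
  qed (use \<open>0 < \<tau>\<close> in auto)
  have prim: "integral {0..t} ?g = 0" if "t \<in> {0..\<tau> + 1}" for t
  proof (cases "t \<le> \<tau>")
    case True
    then have "integral {0..t} ?g = integral {0..t} d" by (intro integral_cong) auto
    then show ?thesis using d(2)[of t] True that by simp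
  next
    case False
    then show ?thesis using integral_initial_segment[of \<tau> t d] d(2)[of \<tau>] \<open>0 < \<tau>\<close> by simp
  qed
  have "((\<lambda>\<sigma>. (1 / (\<sigma> - \<tau>)) * integral {\<sigma> - \<tau>..\<sigma>} (\<lambda>s. (0 - 0) \<bullet> v s)) \<longlongrightarrow>
    - integral {0..\<tau>} (\<lambda>r. ?g r \<bullet> v r)) (at_right \<tau>)"
  proof (rule tendsto_integral_shift_difference[where f = "\<lambda>_. 0" and T = "\<tau> + 1" and V = V])
    show "\<forall>t\<in>{0..\<tau> + 1}. 0 = 0 + integral {0..t} ?g" using prim by simp
    show "continuous_on (UNIV \<times> {..\<tau> + 1}) (\<lambda>(s, \<sigma>). v s)"
      unfolding case_prod_beta by (rule continuous_on_compose2[OF v(1)]) (auto intro!: continuous_intros)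
  qed (use int v(2) \<open>0 < \<tau>\<close> in auto)
  then have "- integral {0..\<tau>} (\<lambda>r. ?g r \<bullet> v r) = 0"
    by (simp add: tendsto_const_iff)
  moreover have "integral {0..\<tau>} (\<lambda>r. ?g r \<bullet> v r) = integral {0..\<tau>} (\<lambda>r. d r \<bullet> v r)"
    by (rule integral_cong) auto
  ultimately show ?thesis by simp
qed

section \<open>Differentiability and terminal value of the form\<close>

text \<open>Reversing the history variables preserves the axioms, so continuity of the form is
  available both for fixed reversed histories and for histories fixed in natural time.\<close>

lemma (in kernels) kernels_reflect:
  "kernels T K p0 (\<lambda>s \<tau>. p1 (\<tau> - s) \<tau>) (\<lambda>s \<nu> \<tau>. p2 (\<tau> - s) (\<tau> - \<nu>) \<tau>)"
  by unfold_locales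
     (auto simp: case_prod_beta T_pos sym_p0 sym_p2 cont_p0 bound_p intro!: continuous_intros)

lemma (in kernels) form_reflect:
  "kernels.form p0 (\<lambda>s \<tau>. p1 (\<tau> - s) \<tau>) (\<lambda>s \<nu> \<tau>. p2 (\<tau> - s) (\<tau> - \<nu>) \<tau>) \<tau> y g x f =
    form \<tau> y (\<lambda>s. g (\<tau> - s)) x (\<lambda>s. f (\<tau> - s))"
proof -
  interpret R: kernels T K p0 "\<lambda>s \<tau>. p1 (\<tau> - s) \<tau>" "\<lambda>s \<nu> \<tau>. p2 (\<tau> - s) (\<tau> - \<nu>) \<tau>"
    by (rule kernels_reflect)
  have "R.head \<tau> x f = head \<tau> x (\<lambda>s. f (\<tau> - s))"
    using integral_reflect_initial[of \<tau> "\<lambda>s. p1 s \<tau> *v f (\<tau> - s)"] by (simp add: R.head_def head_def)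
  moreover have "R.tail \<tau> x f s = tail \<tau> x (\<lambda>s. f (\<tau> - s)) (\<tau> - s)" for s
    using integral_reflect_initial[of \<tau> "\<lambda>\<nu>. p2 (\<tau> - s) \<nu> \<tau> *v f (\<tau> - \<nu>)"] by (simp add: R.tail_def tail_def)
  ultimately show ?thesis
    using integral_reflect_initial[of \<tau> "\<lambda>s. g (\<tau> - s) \<bullet> tail \<tau> x (\<lambda>s. f (\<tau> - s)) s"]
    by (simp add: R.form_def form_def)
qed

context riccati
begin

lemma value_has_derivative:
  assumes f_eq: "\<forall>t\<in>{0..T}. f t = f 0 + integral {0..t} g" and g_int: "g absolutely_integrable_on {0..T}"
    and \<tau>: "0 < \<tau>" "\<tau> < T"
  shows "((\<lambda>\<sigma>. form \<sigma> (f 0) f (f 0) f) has_real_derivative value_rate f g \<tau>) (at \<tau>)"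
proof (rule has_real_derivative_if_right_derivative_continuous[of 0 T])
  have "f absolutely_integrable_on {0..T}" by (rule f_int[OF f_eq g_int]) auto
  then show "continuous_on {0<..<T} (\<lambda>\<sigma>. form \<sigma> (f 0) f (f 0) f)"
    by (intro continuous_on_subset[OF continuous_on_form]) auto
  show "continuous_on {0<..<T} (value_rate f g)"
    by (rule continuous_on_subset[OF continuous_on_value_rate[OF f_eq g_int]]) auto
  show "((\<lambda>s. (form s (f 0) f (f 0) f - form t (f 0) f (f 0) f) / (s - t)) \<longlongrightarrow> value_rate f g t) (at_right t)"
    if "t \<in> {0<..<T}" for t
    using value_has_right_derivative[OF f_eq g_int] that by simp
qed (use \<tau> in auto)

text \<open>\<open>value_rate\<close> is quadratic in the pair of \<open>f\<close> and its
  derivative, and the stated derivative is its polar form.\<close>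

lemma form_has_derivative:
  assumes f: "\<forall>t\<in>{0..T}. f t = f 0 + integral {0..t} g" "g absolutely_integrable_on {0..T}"
    and f': "\<forall>t\<in>{0..T}. f' t = f' 0 + integral {0..t} g'" "g' absolutely_integrable_on {0..T}"
    and \<tau>: "0 < \<tau>" "\<tau> < T"
  shows "((\<lambda>\<sigma>. form \<sigma> (f 0) f (f' 0) f') has_real_derivative
    - ((C *v f 0) \<bullet> (C *v f' 0))
    - (A *v f 0 + integral {0..\<tau>} (\<lambda>s. N s *v f s)) \<bullet> head \<tau> (f' 0) f'
    - (A *v f' 0 + integral {0..\<tau>} (\<lambda>s. N s *v f' s)) \<bullet> head \<tau> (f 0) f
    + integral {0..\<tau>} (\<lambda>s. g s \<bullet> tail \<tau> (f' 0) f' s)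
    + integral {0..\<tau>} (\<lambda>s. g' s \<bullet> tail \<tau> (f 0) f s)
    + (transpose B *v head \<tau> (f 0) f) \<bullet> (transpose B *v head \<tau> (f' 0) f')) (at \<tau>)" (is "(_ has_real_derivative ?D) _")
proof -
  let ?s = "\<lambda>t. f t + f' t" and ?g = "\<lambda>t. g t + g' t"
  have fi: "f absolutely_integrable_on {0..b}" "f' absolutely_integrable_on {0..b}"
    "g absolutely_integrable_on {0..b}" "g' absolutely_integrable_on {0..b}" if "b \<le> T" for b
    using that f_int[OF f, of 0 b] f_int[OF f', of 0 b]
      L1_subinterval[OF f(2)] L1_subinterval[OF f'(2)] by auto
  have s: "\<forall>t\<in>{0..T}. ?s t = ?s 0 + integral {0..t} ?g"
  proof
    fix t assume t: "t \<in> {0..T}"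
    have "integral {0..t} ?g = integral {0..t} g + integral {0..t} g'"
      by (intro integral_add L1_imp_integrable fi) (use t in auto)
    then show "?s t = ?s 0 + integral {0..t} ?g"
      using f(1)[rule_format, OF t] f'(1)[rule_format, OF t] by (simp add: algebra_simps)
  qed
  have gi: "?g absolutely_integrable_on {0..T}" using f(2) f'(2) by (rule set_integral_add(1))
  have pol: "form \<sigma> (?s 0) ?s (?s 0) ?s = form \<sigma> (f 0) f (f 0) f + 2 * form \<sigma> (f 0) f (f' 0) f' + form \<sigma> (f' 0) f' (f' 0) f'"
    if "\<sigma> \<le> T" for \<sigma>
    using fi[OF that] form_sym[OF fi(1,2)[OF that], of "f' 0" "f 0"]
    by (subst form_add_left) (auto simp: form_add_right intro: set_integral_add(1))
  have "((\<lambda>\<sigma>. (form \<sigma> (?s 0) ?s (?s 0) ?s - form \<sigma> (f 0) f (f 0) f - form \<sigma> (f' 0) f' (f' 0) f') / 2) has_real_derivative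
      (value_rate ?s ?g \<tau> - value_rate f g \<tau> - value_rate f' g' \<tau>) / 2) (at \<tau>)"
    by (intro DERIV_cdivide DERIV_diff value_has_derivative[OF s gi \<tau>] value_has_derivative[OF f \<tau>] value_has_derivative[OF f' \<tau>])
  then have "((\<lambda>\<sigma>. form \<sigma> (f 0) f (f' 0) f') has_real_derivative
      (value_rate ?s ?g \<tau> - value_rate f g \<tau> - value_rate f' g' \<tau>) / 2) (at \<tau>)"
    by (rule has_field_derivative_transform_within_open[where S = "{..<T}"]) (use \<tau> pol in auto)
  moreover have "(value_rate ?s ?g \<tau> - value_rate f g \<tau> - value_rate f' g' \<tau>) / 2 = ?D"
  proof -
    have \<tau>T: "\<tau> \<le> T" using \<tau> by simp
    note F = fi[OF \<tau>T]
    have cN: "continuous_on {0..\<tau>} N" by (rule continuous_on_subset[OF cont_N]) auto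
    have h: "head \<tau> (?s 0) ?s = head \<tau> (f 0) f + head \<tau> (f' 0) f'" by (rule head_add[OF F(1,2)])
    have n: "integral {0..\<tau>} (\<lambda>s. N s *v ?s s) = integral {0..\<tau>} (\<lambda>s. N s *v f s) + integral {0..\<tau>} (\<lambda>s. N s *v f' s)"
      unfolding matrix_vector_right_distrib
      by (intro integral_add L1_imp_integrable absolutely_integrable_matrix_vector_mult cN F)
    have it: "(\<lambda>s. k s \<bullet> tail \<tau> x l s) integrable_on {0..\<tau>}"
      if "k absolutely_integrable_on {0..\<tau>}" "l absolutely_integrable_on {0..\<tau>}" for k l x
      by (intro L1_imp_integrable integrable_inner_tail that)
    have "integral {0..\<tau>} (\<lambda>s. ?g s \<bullet> tail \<tau> (?s 0) ?s s) =
        integral {0..\<tau>} (\<lambda>s. (g s \<bullet> tail \<tau> (f 0) f s + g' s \<bullet> tail \<tau> (f' 0) f' s)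
          + (g s \<bullet> tail \<tau> (f' 0) f' s + g' s \<bullet> tail \<tau> (f 0) f s))"
      by (simp add: tail_add[OF F(1,2)] inner_add_left inner_add_right algebra_simps)
    also have "\<dots> = (integral {0..\<tau>} (\<lambda>s. g s \<bullet> tail \<tau> (f 0) f s) + integral {0..\<tau>} (\<lambda>s. g' s \<bullet> tail \<tau> (f' 0) f' s))
          + (integral {0..\<tau>} (\<lambda>s. g s \<bullet> tail \<tau> (f' 0) f' s) + integral {0..\<tau>} (\<lambda>s. g' s \<bullet> tail \<tau> (f 0) f s))"
      by (simp add: integral_add integrable_add it F)
    finally have t: "integral {0..\<tau>} (\<lambda>s. ?g s \<bullet> tail \<tau> (?s 0) ?s s) = \<dots>" .
    show ?thesis
      unfolding value_rate_def h n t unfolding power2_norm_eq_inner matrix_vector_right_distrib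
      by (simp only: inner_add_left inner_add_right) (simp add: inner_commute field_simps)
  qed
  ultimately show ?thesis by (simp only:)
qed

lemma Q_le_cost:
  assumes "0 < \<tau>" "\<tau> < T" "h \<in> L2 0 \<tau>" "u \<in> L2 \<tau> T" "trajectory T A B N \<tau> (x, h) u w"
  shows "Q \<tau> x h \<le> cost T C \<tau> u w"
  using min_Q[OF assms(1-3), of x] assms(4,5) unfolding is_min_cost_def by simp

text \<open>The history is kept fixed in natural time while \<open>\<tau>\<close> tends to
  \<open>T\<close>, so that all the trajectories share one past; the reflected kernels give
  continuity of the cost along it. Nonnegativity before \<open>T\<close> passes to the limit and
  supplies the other inequality. The history is only in L^2, since the terminal condition concerns
  the whole state space.\<close>

lemma form_terminal:
  assumes f: "f \<in> L2 0 T"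
  shows "form T x f x f = 0"
proof -
  let ?h = "\<lambda>s. f (T - s)"
  interpret R: kernels T K p0 "\<lambda>s \<tau>. p1 (\<tau> - s) \<tau>" "\<lambda>s \<nu> \<tau>. p2 (\<tau> - s) (\<tau> - \<nu>) \<tau>"
    by (rule kernels_reflect)
  have h: "?h \<in> L2 0 T" by (rule L2_reflect[OF f])
  have RQ: "R.form \<tau> x ?h x ?h = Q \<tau> x ?h" for \<tau> by (simp add: form_reflect Q_def)
  have hi: "?h absolutely_integrable_on {0..\<tau>}" if "\<tau> \<le> T" for \<tau>
    by (rule L1_subinterval[OF L2_imp_L1[OF h]]) (use that in auto)
  \<comment> \<open>The bound of \<open>local_existence\<close> with the history norm taken over all
    of [0, T], so that it is uniform in \<open>\<tau>\<close> near \<open>T\<close>.\<close>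
  define W where "W = 2 * (norm x + T * (norm (B *v 0) + M * integral {0..T} (\<lambda>s. norm (?h s))))"
  define L where "L = norm A + M * T"
  have L0: "0 \<le> L" using M_nonneg T_pos by (simp add: L_def)
  have ub: "Q \<tau> x ?h \<le> (T - \<tau>) * (norm C * W)\<^sup>2" if \<tau>: "0 < \<tau>" "\<tau> < T" "(T - \<tau>) * L \<le> 1 / 2" for \<tau>
  proof -
    have h\<tau>: "?h \<in> L2 0 \<tau>" by (rule L2_subset[OF h]) (use \<tau> in auto)
    obtain w where w: "trajectory T A B N \<tau> (x, ?h) (\<lambda>_. 0) w"
      and wb: "\<And>t. t \<in> {\<tau>..T} \<Longrightarrow> norm (w t) \<le> 2 * (norm x + T * (norm (B *v 0) + M * integral {0..\<tau>} (\<lambda>s. norm (?h s))))"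
      by (rule local_existence[OF hi less_imp_le[OF \<tau>(1)] less_imp_le[OF \<tau>(2)] order_refl \<tau>(3)[unfolded L_def], of x 0]) (use \<tau> in auto)
    have cw: "continuous_on {\<tau>..T} w" using w by (rule trajectory_continuous)
    have "integral {0..\<tau>} (\<lambda>s. norm (?h s)) \<le> integral {0..T} (\<lambda>s. norm (?h s))"
      by (rule integral_subset_le) (use \<tau> hi in \<open>auto intro!: L1_imp_integrable(2)\<close>)
    then have "2 * (norm x + T * (norm (B *v 0) + M * integral {0..\<tau>} (\<lambda>s. norm (?h s)))) \<le> W"
      unfolding W_def using M_nonneg T_pos by (intro mult_left_mono add_left_mono) auto
    then have wW: "norm (w t) \<le> W" if "t \<in> {\<tau>..T}" for t using wb[OF that] by (rule order_trans[rotated])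
    have "(\<lambda>_. 0 :: real^'m) \<in> L2 \<tau> T" by (intro continuous_imp_L2 continuous_intros)
    from Q_le_cost[OF \<tau>(1,2) h\<tau> this w]
    have "Q \<tau> x ?h \<le> cost T C \<tau> (\<lambda>_. 0 :: real^'m) w" .
    also have "\<dots> \<le> integral {\<tau>..T} (\<lambda>_. (norm C * W)\<^sup>2)"
      unfolding cost_def
    proof (rule integral_le)
      show "(\<lambda>t. (norm (C *v w t))\<^sup>2 + (norm (0 :: real^'m))\<^sup>2) integrable_on {\<tau>..T}"
        by (intro integrable_continuous_real continuous_intros cw)
      show "(norm (C *v w t))\<^sup>2 + (norm (0 :: real^'m))\<^sup>2 \<le> (norm C * W)\<^sup>2" if "t \<in> {\<tau>..T}" for t
        using norm_matrix_vector_mult_le[of C "w t"] mult_left_mono[OF wW[OF that], of "norm C"]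
        by (auto intro!: power_mono)
    qed auto
    also have "\<dots> = (T - \<tau>) * (norm C * W)\<^sup>2" using \<tau> by simp
    finally show ?thesis .
  qed
  have "continuous_on {0..T} (\<lambda>\<tau>. R.form \<tau> x ?h x ?h)"
    by (rule continuous_on_subset[OF R.continuous_on_form[OF hi hi]]) auto
  then have lim: "((\<lambda>\<tau>. Q \<tau> x ?h) \<longlongrightarrow> Q T x ?h) (at_left T)"
    using T_pos at_within_Icc_at_left[OF T_pos] unfolding RQ by (auto simp: continuous_on_def dest!: bspec[of _ _ T])
  have lim0: "((\<lambda>\<tau>. (T - \<tau>) * (norm C * W)\<^sup>2) \<longlongrightarrow> (T - T) * (norm C * W)\<^sup>2) (at_left T)"
    by (intro tendsto_intros)
  have "((\<lambda>\<tau>. (T - \<tau>) * L) \<longlongrightarrow> (T - T) * L) (at_left T)" by (intro tendsto_intros)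
  then have ev: "\<forall>\<^sub>F \<tau> in at_left T. (T - \<tau>) * L < 1 / 2" by (rule order_tendstoD) simp
  have evT: "\<forall>\<^sub>F \<tau> in at_left T. \<tau> \<in> {0<..<T}" by (rule eventually_at_left_real[OF T_pos])
  have "Q T x ?h \<le> (T - T) * (norm C * W)\<^sup>2"
  proof (rule tendsto_le[OF _ lim0 lim])
    show "\<forall>\<^sub>F \<tau> in at_left T. Q \<tau> x ?h \<le> (T - \<tau>) * (norm C * W)\<^sup>2"
      using ev evT by eventually_elim (rule ub, auto)
  qed simp
  moreover have "0 \<le> Q T x ?h"
  proof (rule tendsto_lowerbound[OF lim])
    show "\<forall>\<^sub>F \<tau> in at_left T. 0 \<le> Q \<tau> x ?h"
      using evT
    proof eventually_elim
      case (elim \<tau>)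
      then show ?case
        unfolding Q_def by (intro form_nonneg L2_reflect L2_subset[OF h]) auto
    qed
  qed simp
  ultimately show ?thesis by (simp add: Q_def)
qed

lemma form_terminal_bilinear:
  assumes f: "f \<in> L2 0 T" and g: "g \<in> L2 0 T"
  shows "form T y g x f = 0"
proof -
  have i: "f absolutely_integrable_on {0..T}" "g absolutely_integrable_on {0..T}"
    "(\<lambda>s. g s + f s) absolutely_integrable_on {0..T}"
    using f g L2_add[OF g f] by (auto intro: L2_imp_L1)
  have "form T (y + x) (\<lambda>s. g s + f s) (y + x) (\<lambda>s. g s + f s) =
      form T y g y g + form T y g x f + (form T x f y g + form T x f x f)"
    unfolding form_add_left[OF i(3,2,1)] by (simp add: form_add_right i)
  then show ?thesis
    using form_terminal[OF L2_add[OF g f]] form_terminal[OF f] form_terminal[OF g] form_sym[OF i(1,2), of y x] by simp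
qed

end

section \<open>The Riccati operator\<close>

lemma L2_inner_integrable:
  assumes "f \<in> L2 a b" "g \<in> L2 a b"
  shows "(\<lambda>s. f s \<bullet> g s) integrable_on {a..b}"
proof -
  have "(\<lambda>s. f s \<bullet> g s) absolutely_integrable_on {a..b}"
  proof (rule measurable_bounded_by_integrable_imp_absolutely_integrable)
    have "f \<in> borel_measurable (lebesgue_on {a..b})" "g \<in> borel_measurable (lebesgue_on {a..b})"
      using assms by (auto simp: L2_def)
    then show "(\<lambda>s. f s \<bullet> g s) \<in> borel_measurable (lebesgue_on {a..b})" by measurable
    show "(\<lambda>s. (norm (f s))\<^sup>2 + (norm (g s))\<^sup>2) integrable_on {a..b}"
      using assms by (intro integrable_add) (auto simp: L2_iff)
    show "norm (f s \<bullet> g s) \<le> (norm (f s))\<^sup>2 + (norm (g s))\<^sup>2" for s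
    proof -
      have "\<bar>f s \<bullet> g s\<bar> \<le> norm (f s) * norm (g s)" by (rule Cauchy_Schwarz_ineq2)
      also have "\<dots> \<le> 2 * (norm (f s) * norm (g s))" by simp
      also have "\<dots> \<le> (norm (f s))\<^sup>2 + (norm (g s))\<^sup>2"
        using zero_le_power2[of "norm (f s) - norm (g s)"] by (simp add: power2_eq_square algebra_simps)
      finally show ?thesis by simp
    qed
  qed auto
  then show ?thesis by (rule L1_imp_integrable)
qed

text \<open>The adjoint is obtained by choice, so its defining property is all that is known of it;
  one explicit adjoint \<open>G\<close> shows that such a choice exists.\<close>

lemma adjoint_on_properties:
  assumes "\<And>y. y \<in> Y \<Longrightarrow> G y \<in> X" "\<And>x y. x \<in> X \<Longrightarrow> y \<in> Y \<Longrightarrow> ipY (F x) y = ipX x (G y)"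
  shows "y \<in> Y \<Longrightarrow> adjoint_on X ipX Y ipY F y \<in> X"
    and "x \<in> X \<Longrightarrow> y \<in> Y \<Longrightarrow> ipY (F x) y = ipX x (adjoint_on X ipX Y ipY F y)"
proof -
  have "\<exists>G. (\<forall>y\<in>Y. G y \<in> X) \<and> (\<forall>x\<in>X. \<forall>y\<in>Y. ipY (F x) y = ipX x (G y))"
    using assms by blast
  from someI_ex[OF this] show "y \<in> Y \<Longrightarrow> adjoint_on X ipX Y ipY F y \<in> X"
    "x \<in> X \<Longrightarrow> y \<in> Y \<Longrightarrow> ipY (F x) y = ipX x (adjoint_on X ipX Y ipY F y)"
    unfolding adjoint_on_def by blast+
qed

text \<open>The adjoint takes values in a finite-dimensional space, where inner products with all
  vectors determine the value itself and not just a class of representatives.\<close>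

lemma input_op_adj_eq:
  fixes B :: "real^'m^'d"
  assumes "X \<in> M2 \<tau>"
  shows "input_op_adj B \<tau> X = transpose B *v fst X"
proof -
  have ip: "M2_inner \<tau> (input_op B u) Y = u \<bullet> (transpose B *v fst Y)" for u and Y :: "(real^'d) \<times> (real \<Rightarrow> real^'d)"
    using inner_transpose_vector[of B "fst Y" u]
    by (simp add: M2_inner_def L2_inner_def input_op_def inner_commute)
  have "M2_inner \<tau> (input_op B u) X = u \<bullet> input_op_adj B \<tau> X" for u
    unfolding input_op_adj_def
    by (rule adjoint_on_properties(2)[where G = "\<lambda>Y. transpose B *v fst Y"]) (use assms ip in auto)
  then have "u \<bullet> input_op_adj B \<tau> X = u \<bullet> (transpose B *v fst X)" for u by (metis ip)
  then show ?thesis by (metis vector_eq_rdot inner_commute)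
qed

context kernels
begin

text \<open>The chosen adjoint of \<open>P1_op\<close> is determined up to null sets only. Hence the
  second component is compared with \<open>tail\<close> through pairings with square-integrable
  \<open>g\<close> and not pointwise.\<close>

lemma riccati_op_components:
  assumes p0: "P0 \<tau> = p0 \<tau>"
    and p1: "\<And>s. s \<in> {0..\<tau>} \<Longrightarrow> P1 (\<tau> - s) \<tau> = p1 s \<tau>"
    and p2: "\<And>s \<nu>. s \<in> {0..\<tau>} \<Longrightarrow> \<nu> \<in> {0..\<tau>} \<Longrightarrow> P2 (\<tau> - s) (\<tau> - \<nu>) \<tau> = p2 s \<nu> \<tau>"
    and f: "f \<in> L2 0 \<tau>"
  shows "fst (riccati_op P0 P1 P2 \<tau> (x, f)) = head \<tau> x f"
    and "snd (riccati_op P0 P1 P2 \<tau> (x, f)) \<in> L2 0 \<tau>"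
    and "g \<in> L2 0 \<tau> \<Longrightarrow> L2_inner 0 \<tau> g (snd (riccati_op P0 P1 P2 \<tau> (x, f))) = integral {0..\<tau>} (\<lambda>s. g s \<bullet> tail \<tau> x f s)"
proof -
  let ?a = "P1_op_adj P1 \<tau> x" and ?I = "\<lambda>s. integral {0..\<tau>} (\<lambda>\<nu>. p2 s \<nu> \<tau> *v f \<nu>)"
  have fi: "f absolutely_integrable_on {0..\<tau>}" using f by (rule L2_imp_L1)
  have op1: "P1_op P1 \<tau> h = integral {0..\<tau>} (\<lambda>s. p1 s \<tau> *v h s)" for h
    unfolding P1_op_def by (rule integral_cong) (simp add: p1)
  have op2: "P2_op P2 \<tau> f s = ?I s" if "s \<in> {0..\<tau>}" for s
    unfolding P2_op_def by (rule integral_cong) (simp add: p2[OF that])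
  show "fst (riccati_op P0 P1 P2 \<tau> (x, f)) = head \<tau> x f"
    by (simp add: riccati_op_def head_def op1 p0)
  have adj: "P1_op P1 \<tau> h \<bullet> y = L2_inner 0 \<tau> h (\<lambda>s. transpose (p1 s \<tau>) *v y)" if "h \<in> L2 0 \<tau>" for h y
  proof -
    have hi: "h absolutely_integrable_on {0..\<tau>}" using that by (rule L2_imp_L1)
    have "P1_op P1 \<tau> h \<bullet> y = integral {0..\<tau>} (\<lambda>s. (p1 s \<tau> *v h s) \<bullet> y)"
      unfolding op1 using integral_linear[OF integrable_p(1)[OF hi, of \<tau>] bounded_linear_inner_left[of y]] by (simp add: o_def)
    also have "\<dots> = L2_inner 0 \<tau> h (\<lambda>s. transpose (p1 s \<tau>) *v y)"
      using inner_transpose_vector[of "p1 _ \<tau>" y "h _"] by (simp add: L2_inner_def inner_commute)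
    finally show ?thesis .
  qed
  have adj_in: "(\<lambda>s. transpose (p1 s \<tau>) *v y) \<in> L2 0 \<tau>" for y
    by (intro continuous_imp_L2 continuous_intros)
  have a2: "?a \<in> L2 0 \<tau>"
    unfolding P1_op_adj_def
    by (rule adjoint_on_properties(1)[where G = "\<lambda>y s. transpose (p1 s \<tau>) *v y"]) (use adj_in adj in auto)
  have a_eq: "P1_op P1 \<tau> h \<bullet> x = L2_inner 0 \<tau> h ?a" if "h \<in> L2 0 \<tau>" for h
    unfolding P1_op_adj_def
    by (rule adjoint_on_properties(2)[where G = "\<lambda>y s. transpose (p1 s \<tau>) *v y"]) (use adj_in adj that in auto)
  have "continuous_on {0..\<tau>} (tail \<tau> 0 f)" by (rule continuous_on_tail[OF fi])
  then have cI: "continuous_on {0..\<tau>} ?I" by (simp add: tail_def[abs_def])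
  then have I2: "P2_op P2 \<tau> f \<in> L2 0 \<tau>"
    by (intro continuous_imp_L2) (rule continuous_on_eq, auto simp: op2)
  have snd_eq: "snd (riccati_op P0 P1 P2 \<tau> (x, f)) = (\<lambda>s. ?a s + P2_op P2 \<tau> f s)"
    by (simp add: riccati_op_def)
  show "snd (riccati_op P0 P1 P2 \<tau> (x, f)) \<in> L2 0 \<tau>"
    unfolding snd_eq by (rule L2_add[OF a2 I2])
  assume g: "g \<in> L2 0 \<tau>"
  then have gi: "g absolutely_integrable_on {0..\<tau>}" by (rule L2_imp_L1)
  have "L2_inner 0 \<tau> g (snd (riccati_op P0 P1 P2 \<tau> (x, f))) = L2_inner 0 \<tau> g ?a + L2_inner 0 \<tau> g (P2_op P2 \<tau> f)"
    unfolding snd_eq L2_inner_def inner_add_right by (intro integral_add L2_inner_integrable g a2 I2)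
  also have "L2_inner 0 \<tau> g ?a = x \<bullet> integral {0..\<tau>} (\<lambda>s. p1 s \<tau> *v g s)"
    using a_eq[OF g] by (simp add: op1 inner_commute)
  also have "L2_inner 0 \<tau> g (P2_op P2 \<tau> f) = integral {0..\<tau>} (\<lambda>s. g s \<bullet> ?I s)"
    unfolding L2_inner_def by (rule integral_cong) (simp add: op2)
  \<comment> \<open>The case y = 0 of \<open>form_eq_sum\<close> reassembles the two pieces into the
    pairing with \<open>tail\<close>.\<close>
  finally show "L2_inner 0 \<tau> g (snd (riccati_op P0 P1 P2 \<tau> (x, f))) = integral {0..\<tau>} (\<lambda>s. g s \<bullet> tail \<tau> x f s)"
    using form_eq_sum[OF fi gi, of 0 x] by (simp add: form_def)
qed

lemma kernel_form_eq_form: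
  assumes p0: "P0 \<tau> = p0 \<tau>" and p1: "\<And>s. s \<in> {0..\<tau>} \<Longrightarrow> P1 s \<tau> = p1 s \<tau>"
    and p2: "\<And>s \<nu>. s \<in> {0..\<tau>} \<Longrightarrow> \<nu> \<in> {0..\<tau>} \<Longrightarrow> P2 s \<nu> \<tau> = p2 s \<nu> \<tau>"
    and f: "f \<in> L2 0 \<tau>"
  shows "kernel_form P0 P1 P2 \<tau> (x, f) = form \<tau> x f x f"
proof -
  have fi: "f absolutely_integrable_on {0..\<tau>}" using f by (rule L2_imp_L1)
  have "integral {0..\<tau>} (\<lambda>s. P1 s \<tau> *v f s) = integral {0..\<tau>} (\<lambda>s. p1 s \<tau> *v f s)"
    by (rule integral_cong) (simp add: p1)
  moreover have "integral {0..\<tau>} (\<lambda>s. integral {0..\<tau>} (\<lambda>\<nu>. f s \<bullet> (P2 s \<nu> \<tau> *v f \<nu>))) =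
      integral {0..\<tau>} (\<lambda>s. f s \<bullet> integral {0..\<tau>} (\<lambda>\<nu>. p2 s \<nu> \<tau> *v f \<nu>))"
  proof (rule integral_cong)
    fix s assume s: "s \<in> {0..\<tau>}"
    have "integral {0..\<tau>} (\<lambda>\<nu>. f s \<bullet> (P2 s \<nu> \<tau> *v f \<nu>)) = integral {0..\<tau>} (\<lambda>\<nu>. f s \<bullet> (p2 s \<nu> \<tau> *v f \<nu>))"
      by (rule integral_cong) (simp add: p2[OF s])
    also have "\<dots> = f s \<bullet> integral {0..\<tau>} (\<lambda>\<nu>. p2 s \<nu> \<tau> *v f \<nu>)"
      using integral_linear[OF integrable_p(2)[OF fi, of s \<tau>] bounded_linear_inner_right[of "f s"]] by (simp add: o_def)
    finally show "integral {0..\<tau>} (\<lambda>\<nu>. f s \<bullet> (P2 s \<nu> \<tau> *v f \<nu>)) = f s \<bullet> integral {0..\<tau>} (\<lambda>\<nu>. p2 s \<nu> \<tau> *v f \<nu>)" .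
  qed
  ultimately show ?thesis by (simp add: kernel_form_def form_eq_sum[OF fi fi] p0)
qed

end

section \<open>Extension of the kernels to all arguments\<close>

definition clip :: "real \<Rightarrow> real \<Rightarrow> real" where
  "clip b t = max 0 (min b t)"

lemma clip_props: "0 \<le> b \<Longrightarrow> 0 \<le> clip b t \<and> clip b t \<le> b" "t \<in> {0..b} \<Longrightarrow> clip b t = t"
  "b \<le> T \<Longrightarrow> clip b (clip T t) = clip b t"
  by (auto simp: clip_def min_def max_def)

lemma continuous_on_clip [continuous_intros]:
  "continuous_on S a \<Longrightarrow> continuous_on S b \<Longrightarrow> continuous_on S (\<lambda>x. clip (a x) (b x))"
  unfolding clip_def by (intro continuous_intros)

text \<open>An extended kernel does not change when its arguments are clipped, so it takes only the
  values it has on a compact box.\<close>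

lemma bounded_if_factors_through_compact:
  fixes k :: "'a::topological_space \<Rightarrow> 'b::real_normed_vector"
  assumes "continuous_on S k" "compact S" "\<And>x. r x \<in> S" "\<And>x. k (r x) = k x"
  obtains K where "\<And>x. norm (k x) \<le> K"
proof -
  have "bounded (k ` S)" by (intro compact_imp_bounded compact_continuous_image assms)
  then obtain K where "\<And>x. x \<in> S \<Longrightarrow> norm (k x) \<le> K" unfolding bounded_iff by auto
  then have "norm (k x) \<le> K" for x using assms(3,4)[of x] by metis
  then show ?thesis by (rule that)
qed

text \<open>Up to time \<open>T\<close> the memory kernel is evaluated only at differences r - s in
  [0, T].\<close>

lemma trajectory_cong_kernel:
  assumes "0 \<le> \<tau>" and N: "\<And>t. t \<in> {0..T} \<Longrightarrow> N t = N' t"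
  shows "trajectory T A B N \<tau> X u w \<longleftrightarrow> trajectory T A B N' \<tau> X u w"
proof -
  have "integral {\<tau>..t} (\<lambda>r. A *v w r + integral {\<tau>..r} (\<lambda>s. N (r - s) *v w s) + B *v u r
        + integral {0..\<tau>} (\<lambda>s. N (r - s) *v snd X s)) =
      integral {\<tau>..t} (\<lambda>r. A *v w r + integral {\<tau>..r} (\<lambda>s. N' (r - s) *v w s) + B *v u r
        + integral {0..\<tau>} (\<lambda>s. N' (r - s) *v snd X s))" if t: "t \<in> {\<tau>..T}" for t
  proof (rule integral_cong)
    fix r assume r: "r \<in> {\<tau>..t}"
    have "integral {\<tau>..r} (\<lambda>s. N (r - s) *v w s) = integral {\<tau>..r} (\<lambda>s. N' (r - s) *v w s)"
      "integral {0..\<tau>} (\<lambda>s. N (r - s) *v snd X s) = integral {0..\<tau>} (\<lambda>s. N' (r - s) *v snd X s)"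
      by (rule integral_cong, use N r t assms(1) in auto)+
    then show "A *v w r + integral {\<tau>..r} (\<lambda>s. N (r - s) *v w s) + B *v u r
        + integral {0..\<tau>} (\<lambda>s. N (r - s) *v snd X s) =
      A *v w r + integral {\<tau>..r} (\<lambda>s. N' (r - s) *v w s) + B *v u r
        + integral {0..\<tau>} (\<lambda>s. N' (r - s) *v snd X s)" by simp
  qed
  then show ?thesis unfolding trajectory_def by auto
qed

lemma is_min_cost_cong_kernel:
  assumes "0 \<le> \<tau>" "\<And>t. t \<in> {0..T} \<Longrightarrow> N t = N' t"
  shows "is_min_cost T A B C N \<tau> X W \<longleftrightarrow> is_min_cost T A B C N' \<tau> X W"
proof -
  have "trajectory T A B N \<tau> X u w \<longleftrightarrow> trajectory T A B N' \<tau> X u w" for u w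
    by (rule trajectory_cong_kernel) (use assms in auto)
  then show ?thesis by (simp add: is_min_cost_def)
qed

text \<open>Each argument is projected to its admissible interval: \<open>\<tau>\<close> to [0, T],
  and the history variables to the interval from 0 to the projected \<open>\<tau>\<close>. This
  changes nothing on the original domains. The \<open>riccati\<close> instance takes the reversed
  kernels, while \<open>kernel_form\<close> speaks in natural time; \<open>form_reflect\<close>
  mediates.\<close>

lemma riccati_extension:
  fixes A :: "real^'d^'d" and B :: "real^'m^'d" and C :: "real^'d^'p"
  assumes T: "0 < T" and N: "continuous_on {0..T} N" and P: "riccati_kernels T A B C N P0 P1 P2"
  obtains K M p0 p1 p2 N' where "riccati T K p0 p1 p2 A B N' M C"
    and "\<And>\<tau>. \<tau> \<in> {0..T} \<Longrightarrow> P0 \<tau> = p0 \<tau>"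
    and "\<And>s \<tau>. \<tau> \<in> {0..T} \<Longrightarrow> s \<in> {0..\<tau>} \<Longrightarrow> P1 (\<tau> - s) \<tau> = p1 s \<tau>"
    and "\<And>s \<nu> \<tau>. \<tau> \<in> {0..T} \<Longrightarrow> s \<in> {0..\<tau>} \<Longrightarrow> \<nu> \<in> {0..\<tau>} \<Longrightarrow> P2 (\<tau> - s) (\<tau> - \<nu>) \<tau> = p2 s \<nu> \<tau>"
    and "\<And>t. t \<in> {0..T} \<Longrightarrow> N t = N' t"
proof -
  have c0: "continuous_on {0..T} P0"
    and c1: "continuous_on {(s, \<tau>). 0 \<le> s \<and> s \<le> \<tau> \<and> \<tau> \<le> T} (\<lambda>(s, \<tau>). P1 s \<tau>)"
    and c2: "continuous_on {(s, \<nu>, \<tau>). 0 \<le> s \<and> s \<le> \<tau> \<and> 0 \<le> \<nu> \<and> \<nu> \<le> \<tau> \<and> \<tau> \<le> T} (\<lambda>(s, \<nu>, \<tau>). P2 s \<nu> \<tau>)"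
    and s0: "\<And>\<tau>. \<tau> \<in> {0..T} \<Longrightarrow> P0 \<tau> = transpose (P0 \<tau>)"
    and s2: "\<And>\<tau> s \<nu>. \<tau> \<in> {0..T} \<Longrightarrow> s \<in> {0..\<tau>} \<Longrightarrow> \<nu> \<in> {0..\<tau>} \<Longrightarrow> P2 s \<nu> \<tau> = transpose (P2 \<nu> s \<tau>)"
    and min: "\<And>\<tau> X. \<tau> \<in> {0<..<T} \<Longrightarrow> X \<in> M2 \<tau> \<Longrightarrow> is_min_cost T A B C N \<tau> X (kernel_form P0 P1 P2 \<tau> X)"
    using P unfolding riccati_kernels_def by blast+
  let ?c = "clip T"
  define q0 where "q0 \<tau> = P0 (?c \<tau>)" for \<tau>
  define q1 where "q1 s \<tau> = P1 (clip (?c \<tau>) s) (?c \<tau>)" for s \<tau>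
  define q2 where "q2 s \<nu> \<tau> = P2 (clip (?c \<tau>) s) (clip (?c \<tau>) \<nu>) (?c \<tau>)" for s \<nu> \<tau>
  define N' where "N' t = N (?c t)" for t
  have cT: "0 \<le> ?c t" "?c t \<le> T" "?c t \<in> {0..T}" for t using clip_props(1)[of T t] T by auto
  have cc: "0 \<le> clip (?c \<tau>) s" "clip (?c \<tau>) s \<le> ?c \<tau>" "clip (?c \<tau>) s \<in> {0..?c \<tau>}" for s \<tau>
    using clip_props(1)[OF cT(1), of \<tau> s] by auto
  have cq0: "continuous_on UNIV q0"
    unfolding q0_def by (rule continuous_on_compose2[OF c0]) (auto intro!: continuous_intros cT)
  have "continuous_on UNIV (\<lambda>z. (\<lambda>(s, \<tau>). P1 s \<tau>) (clip (?c (snd z)) (fst z), ?c (snd z)))"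
    by (rule continuous_on_compose2[OF c1]) (auto simp: cT cc intro!: continuous_intros)
  then have cq1: "continuous_on UNIV (\<lambda>(s, \<tau>). q1 s \<tau>)" by (simp add: q1_def case_prod_beta)
  have "continuous_on UNIV (\<lambda>z. (\<lambda>(s, \<nu>, \<tau>). P2 s \<nu> \<tau>)
      (clip (?c (snd (snd z))) (fst z), clip (?c (snd (snd z))) (fst (snd z)), ?c (snd (snd z))))"
    by (rule continuous_on_compose2[OF c2]) (auto simp: cT cc intro!: continuous_intros)
  then have cq2: "continuous_on UNIV (\<lambda>(s, \<nu>, \<tau>). q2 s \<nu> \<tau>)" by (simp add: q2_def case_prod_beta)
  have cN: "continuous_on UNIV N'"
    unfolding N'_def by (rule continuous_on_compose2[OF N]) (auto intro!: continuous_intros cT)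
  obtain K0 where K0: "\<And>\<tau>. norm (q0 \<tau>) \<le> K0"
    by (rule bounded_if_factors_through_compact[OF continuous_on_subset[OF cq0 subset_UNIV], of "{0..T}" ?c])
       (auto simp: q0_def clip_props(3) cT)
  obtain K1 where "\<And>z. norm ((\<lambda>(s, \<tau>). q1 s \<tau>) z) \<le> K1"
    by (rule bounded_if_factors_through_compact[OF continuous_on_subset[OF cq1 subset_UNIV], of "{0..T} \<times> {0..T}" "\<lambda>(s, \<tau>). (?c s, ?c \<tau>)"])
       (auto simp: q1_def clip_props(3) cT intro: compact_Times)
  then have K1: "norm (q1 s \<tau>) \<le> K1" for s \<tau> by (metis case_prod_conv)
  obtain K2 where "\<And>z. norm ((\<lambda>(s, \<nu>, \<tau>). q2 s \<nu> \<tau>) z) \<le> K2"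
    by (rule bounded_if_factors_through_compact[OF continuous_on_subset[OF cq2 subset_UNIV], of "{0..T} \<times> {0..T} \<times> {0..T}" "\<lambda>(s, \<nu>, \<tau>). (?c s, ?c \<nu>, ?c \<tau>)"])
       (auto simp: q2_def clip_props(3) cT intro: compact_Times)
  then have K2: "norm (q2 s \<nu> \<tau>) \<le> K2" for s \<nu> \<tau> by (metis case_prod_conv)
  obtain M where M: "\<And>t. norm (N' t) \<le> M"
    by (rule bounded_if_factors_through_compact[OF continuous_on_subset[OF cN subset_UNIV], of "{0..T}" ?c])
       (auto simp: N'_def clip_props(3) cT)
  define K where "K = max K0 (max K1 K2)"
  have eq0: "P0 \<tau> = q0 \<tau>" if "\<tau> \<in> {0..T}" for \<tau> using that by (simp add: q0_def clip_props(2))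
  have eq1: "P1 s \<tau> = q1 s \<tau>" if "\<tau> \<in> {0..T}" "s \<in> {0..\<tau>}" for s \<tau>
    using that by (simp add: q1_def clip_props(2))
  have eq2: "P2 s \<nu> \<tau> = q2 s \<nu> \<tau>" if "\<tau> \<in> {0..T}" "s \<in> {0..\<tau>}" "\<nu> \<in> {0..\<tau>}" for s \<nu> \<tau>
    using that by (simp add: q2_def clip_props(2))
  have eqN: "N t = N' t" if "t \<in> {0..T}" for t using that by (simp add: N'_def clip_props(2))
  interpret Nat: kernels T K q0 q1 q2
  proof
    show "norm (q0 \<tau>) \<le> K" "norm (q1 s \<tau>) \<le> K" "norm (q2 s \<nu> \<tau>) \<le> K" for s \<nu> \<tau>
      using K0[of \<tau>] K1[of s \<tau>] K2[of s \<nu> \<tau>] by (auto simp: K_def)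
    show "transpose (q0 \<tau>) = q0 \<tau>" for \<tau> unfolding q0_def by (rule s0[OF cT(3), symmetric])
    show "transpose (q2 s \<nu> \<tau>) = q2 \<nu> s \<tau>" for s \<nu> \<tau> unfolding q2_def by (rule s2[OF cT(3) cc(3) cc(3), symmetric])
  qed (use T cq0 cq1 cq2 in auto)
  interpret R: kernels T K q0 "\<lambda>s \<tau>. q1 (\<tau> - s) \<tau>" "\<lambda>s \<nu> \<tau>. q2 (\<tau> - s) (\<tau> - \<nu>) \<tau>"
    by (rule Nat.kernels_reflect)
  have "riccati T K q0 (\<lambda>s \<tau>. q1 (\<tau> - s) \<tau>) (\<lambda>s \<nu> \<tau>. q2 (\<tau> - s) (\<tau> - \<nu>) \<tau>) A B N' M C"
  proof
    show "continuous_on UNIV N'" by (rule cN)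
    show "norm (N' t) \<le> M" for t by (rule M)
    fix \<tau> x and f :: "real \<Rightarrow> real^'d" assume \<tau>: "0 < \<tau>" "\<tau> < T" and f: "f \<in> L2 0 \<tau>"
    have "is_min_cost T A B C N \<tau> (x, \<lambda>s. f (\<tau> - s)) (kernel_form P0 P1 P2 \<tau> (x, \<lambda>s. f (\<tau> - s)))"
      using \<tau> L2_reflect[OF f] by (intro min) (auto simp: M2_def)
    also have "kernel_form P0 P1 P2 \<tau> (x, \<lambda>s. f (\<tau> - s)) = Nat.form \<tau> x (\<lambda>s. f (\<tau> - s)) x (\<lambda>s. f (\<tau> - s))"
      using \<tau> by (intro Nat.kernel_form_eq_form L2_reflect f eq0 eq1 eq2) auto
    also have "\<dots> = R.form \<tau> x f x f" by (simp add: Nat.form_reflect)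
    finally show "is_min_cost T A B C N' \<tau> (x, \<lambda>s. f (\<tau> - s)) (R.form \<tau> x f x f)"
      using is_min_cost_cong_kernel[of \<tau> T N N' A B C] eqN \<tau> by auto
  qed
  then show ?thesis by (rule that) (auto simp: eq0 eq1 eq2 eqN)
qed

section \<open>Weak derivatives and the Riccati equation\<close>

lemma H1_imp_primitive:
  assumes "f \<in> H1 0 T"
  obtains g where "\<forall>t\<in>{0..T}. f t = f 0 + integral {0..t} g" "g \<in> L2 0 T" "f \<in> L2 0 T"
  using assms unfolding H1_def is_H1_deriv_def by blast

lemma is_H1_deriv_H1_deriv:
  assumes "is_H1_deriv a b f g"
  shows "is_H1_deriv a b f (H1_deriv a b f)"
  using assms unfolding H1_deriv_def by (rule someI[where P = "is_H1_deriv a b f"])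

text \<open>\<open>H1_deriv\<close> is chosen separately for each \<open>\<tau>\<close> and need not
  be the restriction of \<open>g\<close>. Both have the same primitive on [0, \<tau>], which is
  enough for pairings with the continuous function \<open>tail\<close>.\<close>

lemma (in kernels) integral_H1_deriv_tail:
  assumes f: "\<forall>t\<in>{0..T}. f t = f 0 + integral {0..t} g" "g \<in> L2 0 T"
    and \<tau>: "0 < \<tau>" "\<tau> \<le> T" and h: "h absolutely_integrable_on {0..\<tau>}"
  shows "H1_deriv 0 \<tau> f \<in> L2 0 \<tau>"
    and "integral {0..\<tau>} (\<lambda>s. H1_deriv 0 \<tau> f s \<bullet> tail \<tau> x h s) = integral {0..\<tau>} (\<lambda>s. g s \<bullet> tail \<tau> x h s)"
proof -
  let ?k = "H1_deriv 0 \<tau> f"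
  have g: "g \<in> L2 0 \<tau>" by (rule L2_subset[OF f(2)]) (use \<tau> in auto)
  have "is_H1_deriv 0 \<tau> f g"
    unfolding is_H1_deriv_def by (intro conjI ballI g f(1)[rule_format]) (use \<tau> in auto)
  then have k: "is_H1_deriv 0 \<tau> f ?k" by (rule is_H1_deriv_H1_deriv)
  have prim: "\<forall>t\<in>{0..\<tau>}. f t = f 0 + integral {0..t} ?k"
    using k unfolding is_H1_deriv_def by (rule conjunct2)
  show k2: "?k \<in> L2 0 \<tau>" using k unfolding is_H1_deriv_def by (rule conjunct1)
  note ki = L2_imp_L1[OF k2] and gi = L2_imp_L1[OF g]
  have "integral {0..\<tau>} (\<lambda>s. (?k s - g s) \<bullet> tail \<tau> x h s) = 0"
  proof (rule integral_inner_eq_0_if_primitive_eq_0)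
    show "(\<lambda>s. ?k s - g s) absolutely_integrable_on {0..\<tau>}" using ki gi by (rule set_integral_diff(1))
    show "continuous_on UNIV (tail \<tau> x h)" by (rule continuous_on_tail[OF h])
    show "norm (tail \<tau> x h s) \<le> K * (norm x + integral {0..\<tau>} (\<lambda>s. norm (h s)))" for s by (rule norm_tail_le[OF h])
    fix t assume t: "t \<in> {0..\<tau>}"
    have "f t = f 0 + integral {0..t} ?k" "f t = f 0 + integral {0..t} g"
      by (rule prim[rule_format, OF t], rule f(1)[rule_format]) (use t \<tau> in auto)
    then have "integral {0..t} ?k = integral {0..t} g" by (metis add_left_cancel)
    then show "integral {0..t} (\<lambda>s. ?k s - g s) = 0"
      using t by (subst integral_diff)
        (auto intro!: L1_imp_integrable L1_subinterval[OF ki]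
          L1_subinterval[OF gi])
  qed (rule \<tau>)
  then show "integral {0..\<tau>} (\<lambda>s. ?k s \<bullet> tail \<tau> x h s) = integral {0..\<tau>} (\<lambda>s. g s \<bullet> tail \<tau> x h s)"
    unfolding inner_diff_left
    by (subst (asm) integral_diff) (intro L1_imp_integrable integrable_inner_tail h ki gi | simp)+
qed

lemma L2_norm_eq_0:
  assumes "f \<in> L2 a b" "integral {a..b} (\<lambda>s. (norm (f s))\<^sup>2) = 0"
  shows "AE s in lebesgue_on {a..b}. f s = 0"
proof -
  have i: "integrable (lebesgue_on {a..b}) (\<lambda>s. (norm (f s))\<^sup>2)" using assms(1) by (simp add: L2_def)
  then have "integral\<^sup>L (lebesgue_on {a..b}) (\<lambda>s. (norm (f s))\<^sup>2) = 0"
    using assms(2) by (simp add: lebesgue_integral_eq_integral)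
  then have "AE s in lebesgue_on {a..b}. (norm (f s))\<^sup>2 = 0"
    using integral_nonneg_eq_0_iff_AE[OF i] by simp
  then show ?thesis by simp
qed

theorem mainTheorem2:
  fixes T :: real
    and A :: "real^'d^'d" and B :: "real^'m^'d" and C :: "real^'d^'p"
    and N :: "real \<Rightarrow> real^'d^'d"
    and P0 :: "real \<Rightarrow> real^'d^'d"
    and P1 :: "real \<Rightarrow> real \<Rightarrow> real^'d^'d"
    and P2 :: "real \<Rightarrow> real \<Rightarrow> real \<Rightarrow> real^'d^'d"
    and \<Omega> \<Xi> :: "(real^'d) \<times> (real \<Rightarrow> real^'d)"
  assumes "T > 0"
    and "continuous_on {0..T} N"
    and "riccati_kernels T A B C N P0 P1 P2"
    and "snd \<Omega> \<in> H1 0 T" and "snd \<Omega> 0 = fst \<Omega>"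
    and "snd \<Xi> \<in> H1 0 T" and "snd \<Xi> 0 = fst \<Xi>"
  shows "(\<forall>\<tau>\<in>{0<..<T}. \<exists>D.
            ((\<lambda>\<sigma>. M2_inner \<sigma> \<Omega> (riccati_op P0 P1 P2 \<sigma> \<Xi>)) has_real_derivative D) (at \<tau>) \<and>
            D + M2_inner \<tau> (state_op A N \<tau> \<Omega>) (riccati_op P0 P1 P2 \<tau> \<Xi>)
              + M2_inner \<tau> (riccati_op P0 P1 P2 \<tau> \<Omega>) (state_op A N \<tau> \<Xi>)
              - input_op_adj B \<tau> (riccati_op P0 P1 P2 \<tau> \<Omega>)
                  \<bullet> input_op_adj B \<tau> (riccati_op P0 P1 P2 \<tau> \<Xi>)
              + output_op C \<Omega> \<bullet> output_op C \<Xi> = 0) \<and>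
         (\<forall>X\<in>M2 T. fst (riccati_op P0 P1 P2 T X) = 0 \<and>
            (AE s in lebesgue_on {0..T}. snd (riccati_op P0 P1 P2 T X) s = 0))"
proof -
  obtain \<omega> where \<omega>: "\<forall>t\<in>{0..T}. snd \<Omega> t = snd \<Omega> 0 + integral {0..t} \<omega>" "\<omega> \<in> L2 0 T" "snd \<Omega> \<in> L2 0 T"
    by (rule H1_imp_primitive[OF assms(4)])
  obtain \<xi> where \<xi>: "\<forall>t\<in>{0..T}. snd \<Xi> t = snd \<Xi> 0 + integral {0..t} \<xi>" "\<xi> \<in> L2 0 T" "snd \<Xi> \<in> L2 0 T"
    by (rule H1_imp_primitive[OF assms(6)])
  obtain K M p0 p1 p2 N' where R: "riccati T K p0 p1 p2 A B N' M C"
    and P0: "\<And>\<tau>. \<tau> \<in> {0..T} \<Longrightarrow> P0 \<tau> = p0 \<tau>"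
    and P1: "\<And>s \<tau>. \<tau> \<in> {0..T} \<Longrightarrow> s \<in> {0..\<tau>} \<Longrightarrow> P1 (\<tau> - s) \<tau> = p1 s \<tau>"
    and P2: "\<And>s \<nu> \<tau>. \<tau> \<in> {0..T} \<Longrightarrow> s \<in> {0..\<tau>} \<Longrightarrow> \<nu> \<in> {0..\<tau>} \<Longrightarrow> P2 (\<tau> - s) (\<tau> - \<nu>) \<tau> = p2 s \<nu> \<tau>"
    and N: "\<And>t. t \<in> {0..T} \<Longrightarrow> N t = N' t"
    by (rule riccati_extension[OF assms(1-3)]) blast
  interpret riccati T K p0 p1 p2 A B N' M C by (rule R)
  let ?P = "riccati_op P0 P1 P2"
  have op: "fst (?P \<tau> (x, f)) = head \<tau> x f" "snd (?P \<tau> (x, f)) \<in> L2 0 \<tau>"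
    "L2_inner 0 \<tau> g (snd (?P \<tau> (x, f))) = integral {0..\<tau>} (\<lambda>s. g s \<bullet> tail \<tau> x f s)"
    if "\<tau> \<in> {0..T}" "f \<in> L2 0 \<tau>" "g \<in> L2 0 \<tau>" for \<tau> x f g
    using that by (intro riccati_op_components P0 P1 P2; simp)+
  have ip: "M2_inner \<tau> (y, g) (?P \<tau> (x, f)) = form \<tau> y g x f"
    if "\<tau> \<in> {0..T}" "f \<in> L2 0 \<tau>" "g \<in> L2 0 \<tau>" for \<tau> x f y g
    using op[OF that] by (simp add: M2_inner_def form_def)
  have M2_sym: "M2_inner \<tau> X Y = M2_inner \<tau> Y X" for \<tau> and X Y :: "(real^'d) \<times> (real \<Rightarrow> real^'d)"
    by (simp add: M2_inner_def L2_inner_def inner_commute)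
  have L2s: "snd \<Omega> \<in> L2 0 \<tau>" "snd \<Xi> \<in> L2 0 \<tau>" if "\<tau> \<le> T" for \<tau>
    using L2_subset[OF \<omega>(3), of 0 \<tau>] L2_subset[OF \<xi>(3), of 0 \<tau>] that by auto
  have \<Omega>: "\<Omega> = (snd \<Omega> 0, snd \<Omega>)" and \<Xi>: "\<Xi> = (snd \<Xi> 0, snd \<Xi>)" using assms(5,7) by (auto simp: prod_eq_iff)
  have "\<exists>D. ((\<lambda>\<sigma>. M2_inner \<sigma> \<Omega> (?P \<sigma> \<Xi>)) has_real_derivative D) (at \<tau>) \<and>
            D + M2_inner \<tau> (state_op A N \<tau> \<Omega>) (?P \<tau> \<Xi>)
              + M2_inner \<tau> (?P \<tau> \<Omega>) (state_op A N \<tau> \<Xi>)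
              - input_op_adj B \<tau> (?P \<tau> \<Omega>) \<bullet> input_op_adj B \<tau> (?P \<tau> \<Xi>)
              + output_op C \<Omega> \<bullet> output_op C \<Xi> = 0" if "\<tau> \<in> {0<..<T}" for \<tau>
  proof -
    have \<tau>: "0 < \<tau>" "\<tau> < T" "\<tau> \<in> {0..T}" "\<tau> \<le> T" using that by auto
    note D = form_has_derivative[OF \<omega>(1) L2_imp_L1[OF \<omega>(2)]
        \<xi>(1) L2_imp_L1[OF \<xi>(2)] \<tau>(1,2)]
    \<comment> \<open>The identity is established on the whole open interval, so that
      differentiability at \<open>\<tau>\<close> can be transferred along it.\<close>
    have eq: "form \<sigma> (snd \<Omega> 0) (snd \<Omega>) (snd \<Xi> 0) (snd \<Xi>) = M2_inner \<sigma> \<Omega> (?P \<sigma> \<Xi>)" if "\<sigma> \<in> {0<..<T}" for \<sigma>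
      by (subst \<Omega>, subst \<Xi>, subst ip) (use that L2s in auto)
    note D' = has_field_derivative_transform_within_open[OF D open_greaterThanLessThan that eq]
    have conv: "integral {0..\<tau>} (\<lambda>s. N s *v h s) = integral {0..\<tau>} (\<lambda>s. N' s *v h s)" for h
      by (rule integral_cong) (use N \<tau> in auto)
    \<comment> \<open>The image under the state operator lies again in the state space, so its
      pairing is a value of \<open>form\<close> whose history slot holds minus the chosen
      derivative, which may then be replaced by \<open>g\<close>.\<close>
    have state: "M2_inner \<tau> (state_op A N \<tau> (f 0, f)) (?P \<tau> (h 0, h)) =
        (A *v f 0 + integral {0..\<tau>} (\<lambda>s. N' s *v f s)) \<bullet> head \<tau> (h 0) h - integral {0..\<tau>} (\<lambda>s. g s \<bullet> tail \<tau> (h 0) h s)"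
      if f: "\<forall>t\<in>{0..T}. f t = f 0 + integral {0..t} g" "g \<in> L2 0 T" and h: "h \<in> L2 0 \<tau>" for f g h
    proof -
      note hi = L2_imp_L1[OF h]
      have k: "(\<lambda>s. - H1_deriv 0 \<tau> f s) \<in> L2 0 \<tau>"
        using integral_H1_deriv_tail(1)[OF f \<tau>(1,4) hi] by (auto simp: L2_iff absolutely_integrable_on_def intro: integrable_neg)
      have "M2_inner \<tau> (state_op A N \<tau> (f 0, f)) (?P \<tau> (h 0, h)) =
          form \<tau> (A *v f 0 + integral {0..\<tau>} (\<lambda>s. N' s *v f s)) (\<lambda>s. - H1_deriv 0 \<tau> f s) (h 0) h"
        unfolding state_op_def fst_conv snd_conv conv by (rule ip[OF \<tau>(3) h k])
      then show ?thesis
        using integral_H1_deriv_tail(2)[OF f \<tau>(1,4) hi, of "h 0"] by (simp add: form_def)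
    qed
    have inp: "input_op_adj B \<tau> (?P \<tau> (x, f)) = transpose B *v head \<tau> x f" if "f \<in> L2 0 \<tau>" for x f
      using op(1,2)[OF \<tau>(3) that that] by (subst input_op_adj_eq) (auto simp: M2_def mem_Times_iff)
    have s1: "M2_inner \<tau> (state_op A N \<tau> \<Omega>) (?P \<tau> \<Xi>) =
        (A *v snd \<Omega> 0 + integral {0..\<tau>} (\<lambda>s. N' s *v snd \<Omega> s)) \<bullet> head \<tau> (snd \<Xi> 0) (snd \<Xi>)
        - integral {0..\<tau>} (\<lambda>s. \<omega> s \<bullet> tail \<tau> (snd \<Xi> 0) (snd \<Xi>) s)"
      using state[OF \<omega>(1,2) L2s(2)[OF \<tau>(4)]] \<Omega> \<Xi> by simp
    have s2: "M2_inner \<tau> (?P \<tau> \<Omega>) (state_op A N \<tau> \<Xi>) =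
        (A *v snd \<Xi> 0 + integral {0..\<tau>} (\<lambda>s. N' s *v snd \<Xi> s)) \<bullet> head \<tau> (snd \<Omega> 0) (snd \<Omega>)
        - integral {0..\<tau>} (\<lambda>s. \<xi> s \<bullet> tail \<tau> (snd \<Omega> 0) (snd \<Omega>) s)"
      using state[OF \<xi>(1,2) L2s(1)[OF \<tau>(4)]] \<Omega> \<Xi> M2_sym by simp
    have i: "input_op_adj B \<tau> (?P \<tau> \<Omega>) = transpose B *v head \<tau> (snd \<Omega> 0) (snd \<Omega>)"
      "input_op_adj B \<tau> (?P \<tau> \<Xi>) = transpose B *v head \<tau> (snd \<Xi> 0) (snd \<Xi>)"
      using inp[OF L2s(1)[OF \<tau>(4)], of "snd \<Omega> 0"] inp[OF L2s(2)[OF \<tau>(4)], of "snd \<Xi> 0"] \<Omega> \<Xi> by simp_all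
    have o: "output_op C \<Omega> = C *v snd \<Omega> 0" "output_op C \<Xi> = C *v snd \<Xi> 0"
      using assms(5,7) by (simp_all add: output_op_def)
    show ?thesis
      unfolding s1 s2 i o by (rule exI, rule conjI, rule D') simp_all
  qed
  moreover have "fst (?P T X) = 0 \<and> (AE s in lebesgue_on {0..T}. snd (?P T X) s = 0)" if X: "X \<in> M2 T" for X
  proof -
    obtain x f where Xeq: "X = (x, f)" and f: "f \<in> L2 0 T" using X by (auto simp: M2_def)
    have TT: "T \<in> {0..T}" using assms(1) by simp
    let ?y = "fst (?P T X)" and ?g = "snd (?P T X)"
    have g: "?g \<in> L2 0 T" using op(2)[OF TT f f] by (simp add: Xeq)
    \<comment> \<open>The image of \<open>X\<close> is paired with itself: as the form vanishes on
      all pairs of states at \<open>T\<close>, the norm of the image is 0. For the history component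
      this means vanishing almost everywhere.\<close>
    have "M2_inner T (?y, ?g) (?P T (x, f)) = 0"
      unfolding ip[OF TT f g] by (rule form_terminal_bilinear[OF f g])
    then have sum0: "?y \<bullet> ?y + integral {0..T} (\<lambda>s. (norm (?g s))\<^sup>2) = 0"
      by (simp add: M2_inner_def L2_inner_def Xeq power2_norm_eq_inner)
    have "0 \<le> integral {0..T} (\<lambda>s. (norm (?g s))\<^sup>2)"
      using g by (intro integral_nonneg) (auto simp: L2_iff)
    then have "?y \<bullet> ?y = 0" "integral {0..T} (\<lambda>s. (norm (?g s))\<^sup>2) = 0"
      using sum0 inner_ge_zero[of ?y] by linarith+
    then show ?thesis using L2_norm_eq_0[OF g] by simp
  qed
  ultimately show ?thesis by blast
qed

end
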